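(* Let $\{G^N\}_N$ be an $f$-sequence with stepwise $f$ that is in the $\mathbf p$-subcritical regime, operated under the $\mathbf p$-based JIQ policy. Assume that for each $N$ the $N$-th system starts from the all-empty state, so $\bar X^N_{m,k}(0)=0$ for all $m\in[M],k\in[K]$. Then for any finite $T\ge0$, the scaled process $\bar X^N$ converges weakly, uniformly on $[0,T]$, to the deterministic process $\bar X(t)=(\bar X_{m,k}(t),\,m\in[M],k\in[K])$, $t\in[0,T]$, where $\bar X_{m,k}(0)=0$ and $$\frac{d\bar X_{m,k}(t)}{dt}=\lambda^{\mathbf p}_{m,k}-\mu_k\bar X_{m,k}(t),\qquad m\in[M],\ k\in[K].$$
   Context: Notation: $[n]=\{1,\dots,n\}$. Model. $G^N=(\mathcal W^N,\mathcal V^N,\boldsymbol\lambda^N,\mathcal U^N)$ is a load balancing system with dispatchers $\mathcal W^N=\{1,\dots,W(N)\}$ (each dispatcher handles exactly one type of task, so dispatcher = task type) and servers $\mathcal V^N=\{1,\dots,N\}$. Each server has its own infinite-buffer queue served First-Come-First-Served. Tasks arrive at dispatcher $i$ as a Poisson process of rate $\lambda_i^N$, independently of everything else, and must be assigned immediately and irrevocably to a server. The service time of a type-$i$ task at server $j$ is exponential with mean $1/\mu^N_{i,j}$ if $\mu^N_{i,j}>0$ (all service times independent); if $\mu^N_{i,j}=0$ server $j$ cannot process type-$i$ tasks. $\mathcal U^N=(\mu^N_{i,j})$. $f$-sequence. There are fixed maps $\phi_1,\phi_2:\mathbb N\to[0,1)$ (for dispatchers and servers), and $f:[0,1)^2\to\mathbb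 R_+$; the sets $\mathcal W^N,\mathcal V^N$ are increasing in $N$, and $\mu^N_{i,j}=f(\phi_1(i),\phi_2(j))$ for all $(i,j)\in\mathcal W^N\times\mathcal V^N$. Stepwise $f$. There are partitions $0=w_0<\dots<w_H=1$ and $0=v_0<\dots<v_M=1$ and constants $\mu_{h,m}\ge0$ with $f(x,y)=\mu_{h,m}$ for $(x,y)\in[w_{h-1},w_h)\times[v_{m-1},v_m)$. Put $\mathcal W^N_h=\{i\in\mathcal W^N:\phi_1(i)\in[w_{h-1},w_h)\}$ and $\mathcal V^N_m=\{j\in\mathcal V^N:\phi_2(j)\in[v_{m-1},v_m)\}$. $\mathbf p$-subcritical regime. (i) For each $h$, $\lim_N \frac1N\sum_{i\in\mathcal W^N_h}\lambda^N_i=\lambda_h>0$; (ii) for each $m$, $\lim_N|\mathcal V^N_m|/N=v_m-v_{m-1}$; (iii) $\mathbf p=(p_{h,m})\in[0,1]^{H\times M}$ has unit row sums and $\sum_{h\in[H]}\frac{\lambda_hp_{h,m}}{\mu_{h,m}(v_m-v_{m-1})}<1$ for all $m\in[M]$. Convention: a quotient with numerator $0$ is $0$, and one with positive numerator and zero denominator is $+\infty$ (so $p_{h,m}>0$ forces $\mu_{h,m}>0$). $\mathbf p$-based JIQ policy. When a task arrives at a dispatcher $i\in\mathcal W^N_h$, the dispatcher first selects a target type $m^*\in[M]$ at random with distribution $(p_{h,m})_{m\in[M]}$ (independently of everything else); the task is then sent to a uniformly random idle server in $\mathcal V^N_{m^*}$ if there is one, and otherwise to a uniformly random server in $\mathcal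 V^N_{m^*}$. State. Let $\mu_1,\dots,\mu_K$ be the distinct values of $\mu_{h,m}$, $(h,m)\in[H]\times[M]$. $\bar X^N_{m,k}(t)$ is $1/N$ times the number of servers in $\mathcal V^N_m$ that at time $t$ are serving a task at rate $\mu_k$; $\bar X^N(t)=(\bar X^N_{m,k}(t),m\in[M],k\in[K])\in\mathbb R_+^{M\times K}$, with the $\ell_1$-norm. Finally $\lambda^{\mathbf p}_{m,k}=\sum_{h\in[H]}p_{h,m}\lambda_h\mathbf 1_{(\mu_{h,m}=\mu_k)}$. *)

theory Defs
  imports "HOL-Probability.Probability"
begin

section \<open>Stepwise $f$-sequences and the subcritical regime\<close>

text \<open>
  Dispatchers, servers, and the classes of both are numbered from 1: the $N$-th system has
  dispatchers \<open>{1..W N}\<close> and servers \<open>{1..N}\<close>; a quantity of the $N$-th system carries \<open>N\<close> as its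
  first argument. Breakpoints \<open>w 0 < ... < w H\<close> and \<open>v 0 < ... < v M\<close> delimit the classes.
\<close>

definition f_sequence ::
  "(real \<Rightarrow> real \<Rightarrow> real) \<Rightarrow> (nat \<Rightarrow> real) \<Rightarrow> (nat \<Rightarrow> real) \<Rightarrow> (nat \<Rightarrow> nat) \<Rightarrow>
    (nat \<Rightarrow> nat \<Rightarrow> nat \<Rightarrow> real) \<Rightarrow> bool" where
  "f_sequence f \<phi>1 \<phi>2 W \<mu> \<longleftrightarrow>
     (\<forall>x\<in>{0..<1}. \<forall>y\<in>{0..<1}. 0 \<le> f x y) \<and>
     (\<forall>i\<ge>1. \<phi>1 i \<in> {0..<1}) \<and> (\<forall>j\<ge>1. \<phi>2 j \<in> {0..<1}) \<and>
     mono W \<and>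
     (\<forall>N. \<forall>i\<in>{1..W N}. \<forall>j\<in>{1..N}. \<mu> N i j = f (\<phi>1 i) (\<phi>2 j))"

definition partition_of_unit_interval :: "nat \<Rightarrow> (nat \<Rightarrow> real) \<Rightarrow> bool" where
  "partition_of_unit_interval H w \<longleftrightarrow> w 0 = 0 \<and> w H = 1 \<and> (\<forall>h<H. w h < w (Suc h))"

definition stepwise ::
  "(real \<Rightarrow> real \<Rightarrow> real) \<Rightarrow> nat \<Rightarrow> (nat \<Rightarrow> real) \<Rightarrow> nat \<Rightarrow> (nat \<Rightarrow> real) \<Rightarrow> (nat \<Rightarrow> nat \<Rightarrow> real) \<Rightarrow> bool" where
  "stepwise f H w M v c \<longleftrightarrow>
     partition_of_unit_interval H w \<and> partition_of_unit_interval M v \<and>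
     (\<forall>h\<in>{1..H}. \<forall>m\<in>{1..M}. 0 \<le> c h m \<and>
        (\<forall>x\<in>{w (h - 1)..<w h}. \<forall>y\<in>{v (m - 1)..<v m}. f x y = c h m))"

definition disp_class :: "(nat \<Rightarrow> real) \<Rightarrow> (nat \<Rightarrow> real) \<Rightarrow> (nat \<Rightarrow> nat) \<Rightarrow> nat \<Rightarrow> nat \<Rightarrow> nat set" where
  "disp_class \<phi>1 w W N h = {i \<in> {1..W N}. \<phi>1 i \<in> {w (h - 1)..<w h}}"

definition serv_class :: "(nat \<Rightarrow> real) \<Rightarrow> (nat \<Rightarrow> real) \<Rightarrow> nat \<Rightarrow> nat \<Rightarrow> nat set" where
  "serv_class \<phi>2 v N m = {j \<in> {1..N}. \<phi>2 j \<in> {v (m - 1)..<v m}}"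

definition class_of :: "nat \<Rightarrow> (nat \<Rightarrow> real) \<Rightarrow> real \<Rightarrow> nat" where
  "class_of H w x = (THE h. h \<in> {1..H} \<and> x \<in> {w (h - 1)..<w h})"

text \<open>
  The load condition is an inequality in \<^typ>\<open>ennreal\<close>, where $0/0 = 0$ and $a/0 = \infty$ for
  $a > 0$; in particular it forces \<open>c h m > 0\<close> whenever \<open>p h m > 0\<close>.
\<close>

definition subcritical ::
  "(nat \<Rightarrow> real) \<Rightarrow> (nat \<Rightarrow> real) \<Rightarrow> (nat \<Rightarrow> nat) \<Rightarrow> nat \<Rightarrow> (nat \<Rightarrow> real) \<Rightarrow> nat \<Rightarrow> (nat \<Rightarrow> real) \<Rightarrow>
    (nat \<Rightarrow> nat \<Rightarrow> real) \<Rightarrow> (nat \<Rightarrow> nat \<Rightarrow> real) \<Rightarrow> (nat \<Rightarrow> real) \<Rightarrow> (nat \<Rightarrow> nat \<Rightarrow> real) \<Rightarrow> bool" where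
  "subcritical \<phi>1 \<phi>2 W H w M v c lam \<Lambda> p \<longleftrightarrow>
     (\<forall>h\<in>{1..H}. 0 < \<Lambda> h \<and>
        (\<lambda>N. (\<Sum>i\<in>disp_class \<phi>1 w W N h. lam N i) / real N) \<longlonglongrightarrow> \<Lambda> h) \<and>
     (\<forall>m\<in>{1..M}. (\<lambda>N. real (card (serv_class \<phi>2 v N m)) / real N) \<longlonglongrightarrow> v m - v (m - 1)) \<and>
     (\<forall>h\<in>{1..H}. \<forall>m\<in>{1..M}. p h m \<in> {0..1}) \<and>
     (\<forall>h\<in>{1..H}. (\<Sum>m=1..M. p h m) = 1) \<and>
     (\<forall>m\<in>{1..M}. (\<Sum>h=1..H. ennreal (\<Lambda> h * p h m) / ennreal (c h m * (v m - v (m - 1)))) < 1)"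


section \<open>A load balancing system under the JIQ policy\<close>

text \<open>
  The task \<open>(i, n)\<close> is the \<open>n\<close>-th task (\<open>n = 0, 1, ...\<close>) arriving at dispatcher \<open>i\<close>.
  A Poisson process of rate zero has no points, so dispatchers of rate zero have no tasks.
\<close>

type_synonym task = "nat \<times> nat"

definition tasks :: "nat \<Rightarrow> (nat \<Rightarrow> real) \<Rightarrow> task set" where
  "tasks n_disp lam = {i \<in> {1..n_disp}. 0 < lam i} \<times> UNIV"

text \<open>
  The data attached to a task: the interarrival time since the previous task of the same dispatcher
  (exponential, so that the arrival epochs form a Poisson process), the target class drawn from
  \<open>q\<close>, a uniform variable with which the server is selected, and a unit mean exponential service
  requirement \<open>e\<close>. A task of type \<open>i\<close> served by \<open>j\<close> has service time \<open>e / \<mu> i j\<close>, which is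
  exponential with mean \<open>1 / \<mu> i j\<close>; as a task is served by one server only, this yields independent
  service times. The four components are independent by the product law, and all
  tasks are independent of each other.
\<close>

definition task_law :: "real \<Rightarrow> nat \<Rightarrow> (nat \<Rightarrow> real) \<Rightarrow> (real \<times> nat \<times> real \<times> real) measure" where
  "task_law r M q =
     density lborel (exponential_density r) \<Otimes>\<^sub>M
     (point_measure {1..M} (\<lambda>m. ennreal (q m)) \<Otimes>\<^sub>M
     (uniform_measure lborel {0..<1} \<Otimes>\<^sub>M
      density lborel (exponential_density 1)))"

definition jiq_inputs ::
  "'a measure \<Rightarrow> task set \<Rightarrow> (nat \<Rightarrow> real) \<Rightarrow> nat \<Rightarrow> (nat \<Rightarrow> nat \<Rightarrow> real) \<Rightarrow>
    (task \<Rightarrow> 'a \<Rightarrow> real) \<Rightarrow> (task \<Rightarrow> 'a \<Rightarrow> nat) \<Rightarrow> (task \<Rightarrow> 'a \<Rightarrow> real) \<Rightarrow> (task \<Rightarrow> 'a \<Rightarrow> real) \<Rightarrow> bool" where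
  "jiq_inputs P Tk lam M q A B U E \<longleftrightarrow>
     prob_space P \<and>
     prob_space.indep_vars P (\<lambda>a. task_law (lam (fst a)) M (q (fst a)))
       (\<lambda>a \<omega>. (A a \<omega>, B a \<omega>, U a \<omega>, E a \<omega>)) Tk \<and>
     (\<forall>a\<in>Tk. distr P (task_law (lam (fst a)) M (q (fst a)))
         (\<lambda>\<omega>. (A a \<omega>, B a \<omega>, U a \<omega>, E a \<omega>)) = task_law (lam (fst a)) M (q (fst a)))"

definition arrival_time :: "(task \<Rightarrow> real) \<Rightarrow> task \<Rightarrow> real" where
  "arrival_time A a = (\<Sum>l\<le>snd a. A (fst a, l))"

text \<open>For \<open>u\<close> uniform on $[0,1)$, \<open>pick S u\<close> is uniform on the finite nonempty set \<open>S\<close>.\<close>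

definition pick :: "nat set \<Rightarrow> real \<Rightarrow> nat" where
  "pick S u = sorted_list_of_set S ! nat \<lfloor>u * real (card S)\<rfloor>"

definition completion_time ::
  "(nat \<Rightarrow> nat \<Rightarrow> real) \<Rightarrow> (task \<Rightarrow> real) \<Rightarrow> (task \<Rightarrow> nat) \<Rightarrow> (task \<Rightarrow> real) \<Rightarrow> task \<Rightarrow> real" where
  "completion_time \<mu> e J s a = s a + e a / \<mu> (fst a) (J a)"

definition idle_servers ::
  "task set \<Rightarrow> (nat \<Rightarrow> nat \<Rightarrow> real) \<Rightarrow> (task \<Rightarrow> real) \<Rightarrow> (task \<Rightarrow> real) \<Rightarrow> (task \<Rightarrow> nat) \<Rightarrow> (task \<Rightarrow> real) \<Rightarrow>
    nat set \<Rightarrow> real \<Rightarrow> nat set" where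
  "idle_servers Tk \<mu> \<tau> e J s S t =
     {j \<in> S. \<forall>a\<in>Tk. \<tau> a < t \<and> J a = j \<longrightarrow> completion_time \<mu> e J s a \<le> t}"

text \<open>
  The evolution of one sample path from the empty state. Given arrival epochs \<open>\<tau>\<close>, targets \<open>b\<close>,
  selection variables \<open>u\<close> and requirements \<open>e\<close>, the assigned servers \<open>J\<close> and the epochs \<open>s\<close> at which
  service starts obey the policy and the First-Come-First-Served discipline: a task starts service
  when it has arrived and all earlier tasks at its server are completed. When the arrival epochs are
  distinct and locally finite, which holds almost surely, this recursion along the arrivals has
  exactly one solution on \<open>Tk\<close>. The set \<open>V m\<close> consists of the servers of class \<open>m\<close>.
\<close>

definition jiq_path ::
  "task set \<Rightarrow> (nat \<Rightarrow> nat set) \<Rightarrow> (nat \<Rightarrow> nat \<Rightarrow> real) \<Rightarrow>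
    (task \<Rightarrow> real) \<Rightarrow> (task \<Rightarrow> nat) \<Rightarrow> (task \<Rightarrow> real) \<Rightarrow> (task \<Rightarrow> real) \<Rightarrow>
    (task \<Rightarrow> nat) \<Rightarrow> (task \<Rightarrow> real) \<Rightarrow> bool" where
  "jiq_path Tk V \<mu> \<tau> b u e J s \<longleftrightarrow>
     (\<forall>a\<in>Tk.
        J a = (let I = idle_servers Tk \<mu> \<tau> e J s (V (b a)) (\<tau> a)
               in pick (if I \<noteq> {} then I else V (b a)) (u a)) \<and>
        s a = Max (insert (\<tau> a) (completion_time \<mu> e J s ` {a'\<in>Tk. \<tau> a' < \<tau> a \<and> J a' = J a})))"

text \<open>
  The system described by \<open>J\<close> and \<open>s\<close> is operated under the JIQ policy in which dispatcher \<open>i\<close>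
  selects target class \<open>m\<close> with probability \<open>q i m\<close>.
\<close>

definition jiq_system ::
  "'a measure \<Rightarrow> task set \<Rightarrow> (nat \<Rightarrow> nat set) \<Rightarrow> (nat \<Rightarrow> nat \<Rightarrow> real) \<Rightarrow> (nat \<Rightarrow> real) \<Rightarrow> nat \<Rightarrow>
    (nat \<Rightarrow> nat \<Rightarrow> real) \<Rightarrow>
    (task \<Rightarrow> 'a \<Rightarrow> real) \<Rightarrow> (task \<Rightarrow> 'a \<Rightarrow> nat) \<Rightarrow> (task \<Rightarrow> 'a \<Rightarrow> real) \<Rightarrow> (task \<Rightarrow> 'a \<Rightarrow> real) \<Rightarrow>
    (task \<Rightarrow> 'a \<Rightarrow> nat) \<Rightarrow> (task \<Rightarrow> 'a \<Rightarrow> real) \<Rightarrow> bool" where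
  "jiq_system P Tk V \<mu> lam M q A B U E J s \<longleftrightarrow>
     jiq_inputs P Tk lam M q A B U E \<and>
     (AE \<omega> in P. jiq_path Tk V \<mu> (arrival_time (\<lambda>a. A a \<omega>)) (\<lambda>a. B a \<omega>) (\<lambda>a. U a \<omega>) (\<lambda>a. E a \<omega>)
        (\<lambda>a. J a \<omega>) (\<lambda>a. s a \<omega>))"

text \<open>
  The fraction, out of \<open>N\<close>, of servers in \<open>S\<close> that at time \<open>t\<close> are serving a task at rate \<open>r\<close>.
  A task in service at a server with \<open>\<mu> i j = 0\<close> would count as completed at once, but
  subcriticality makes such assignments a null event.
\<close>

definition occupancy ::
  "nat \<Rightarrow> task set \<Rightarrow> (nat \<Rightarrow> nat \<Rightarrow> real) \<Rightarrow> (task \<Rightarrow> real) \<Rightarrow> (task \<Rightarrow> nat) \<Rightarrow> (task \<Rightarrow> real) \<Rightarrow>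
    nat set \<Rightarrow> real \<Rightarrow> real \<Rightarrow> real" where
  "occupancy N Tk \<mu> e J s S r t =
     real (card {j\<in>S. \<exists>a\<in>Tk. J a = j \<and> \<mu> (fst a) j = r \<and> s a \<le> t \<and> t < completion_time \<mu> e J s a})
       / real N"


section \<open>Weak convergence for the uniform topology\<close>

text \<open>
  A path maps \<open>m \<in> {1..M}\<close>, \<open>k \<in> {1..K}\<close> and a time in $[0,T]$ to a real. Jump processes such as
  the occupancy processes need not be Borel measurable as maps into the nonseparable space of paths
  with the uniform norm, so weak convergence is meant in the sense of Hoffmann-Joergensen, that is,
  with outer expectations of bounded continuous functionals. For a functional whose composition with
  the process is a random variable this is the usual expectation.
\<close>

type_synonym path = "nat \<Rightarrow> nat \<Rightarrow> real \<Rightarrow> real"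

definition bounded_paths :: "real \<Rightarrow> nat \<Rightarrow> nat \<Rightarrow> path set" where
  "bounded_paths T M K =
     {x. bdd_above ((\<lambda>t. \<Sum>m=1..M. \<Sum>k=1..K. \<bar>x m k t\<bar>) ` {0..T})}"

definition unif_dist :: "real \<Rightarrow> nat \<Rightarrow> nat \<Rightarrow> path \<Rightarrow> path \<Rightarrow> real" where
  "unif_dist T M K x y = (SUP t\<in>{0..T}. \<Sum>m=1..M. \<Sum>k=1..K. \<bar>x m k t - y m k t\<bar>)"

definition unif_continuous_functional :: "real \<Rightarrow> nat \<Rightarrow> nat \<Rightarrow> (path \<Rightarrow> real) \<Rightarrow> bool" where
  "unif_continuous_functional T M K F \<longleftrightarrow>
     (\<forall>x\<in>bounded_paths T M K. \<forall>\<epsilon>>0. \<exists>\<delta>>0. \<forall>y\<in>bounded_paths T M K.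
        unif_dist T M K x y < \<delta> \<longrightarrow> \<bar>F x - F y\<bar> < \<epsilon>)"

definition outer_expectation :: "'a measure \<Rightarrow> ('a \<Rightarrow> real) \<Rightarrow> real" where
  "outer_expectation P Y =
     Inf {integral\<^sup>L P Z | Z. integrable P Z \<and> (\<forall>\<omega>\<in>space P. Y \<omega> \<le> Z \<omega>)}"

definition weakly_converges_unif ::
  "real \<Rightarrow> nat \<Rightarrow> nat \<Rightarrow> (nat \<Rightarrow> 'a measure) \<Rightarrow> (nat \<Rightarrow> 'a \<Rightarrow> path) \<Rightarrow> path \<Rightarrow> bool" where
  "weakly_converges_unif T M K P X x \<longleftrightarrow>
     (\<forall>F. bounded (F ` bounded_paths T M K) \<and> unif_continuous_functional T M K F \<longrightarrow>
        (\<lambda>N. outer_expectation (P N) (\<lambda>\<omega>. F (X N \<omega>))) \<longlonglongrightarrow> F x)"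


section \<open>The fluid limit\<close>

definition lam_p ::
  "nat \<Rightarrow> (nat \<Rightarrow> nat \<Rightarrow> real) \<Rightarrow> (nat \<Rightarrow> real) \<Rightarrow> (nat \<Rightarrow> nat \<Rightarrow> real) \<Rightarrow> (nat \<Rightarrow> real) \<Rightarrow> nat \<Rightarrow> nat \<Rightarrow> real" where
  "lam_p H p \<Lambda> c \<nu> m k = (\<Sum>h=1..H. p h m * \<Lambda> h * (if c h m = \<nu> k then 1 else 0))"

definition fluid_solution ::
  "real \<Rightarrow> nat \<Rightarrow> nat \<Rightarrow> (nat \<Rightarrow> nat \<Rightarrow> real) \<Rightarrow> (nat \<Rightarrow> real) \<Rightarrow> path \<Rightarrow> bool" where
  "fluid_solution T M K lp \<nu> x \<longleftrightarrow>
     (\<forall>m\<in>{1..M}. \<forall>k\<in>{1..K}. x m k 0 = 0 \<and>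
        (\<forall>t\<in>{0..T}. (x m k has_real_derivative (lp m k - \<nu> k * x m k t)) (at t within {0..T})))"

end

theory Submission
  imports Defs
begin

text \<open>
  As long as no class of servers is full, every task starts its service on arrival at a server of its
  target class, and the service time of a task from class \<open>h\<close> with target \<open>m\<close> is its requirement
  divided by \<open>c h m\<close>, whichever server is chosen. The numbers of busy servers then coincide with the
  numbers of customers in independent M/G/\<open>\<infinity>\<close> queues, which are explicit functions of the inputs:
  they count the points of a marked Poisson process in a region of the plane. The variance of such a
  count is at most its mean, so Chebyshev's inequality yields the law of large numbers at fixed times.
  Arrivals and departures are monotone in time with continuous limits, hence the convergence is
  uniform on $[0,T]$. By subcriticality the limiting total occupancy of each class stays below its
  capacity, so with high probability no class is ever full before \<open>T\<close> and the coincidence holds.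
\<close>

section \<open>Sample paths without full classes\<close>

text \<open>The comparison with infinite-server queues looks circular: it needs room in each class,
  and room is a property of the assigned system. The circle is broken by stating room for the
  infinite-server counts alone, which do not depend on the chosen servers; induction along the
  arrivals transfers it to the system, path by path, with no stopping time. What is left to
  probability is a law of large numbers, and no Poisson law of the counts is derived for it. The
  square of a count is its value plus twice the number of ordered pairs of points; after the earlier
  point of a pair the process starts afresh, so the mean number of pairs follows from the mean
  formula applied twice. The number of busy servers is not monotone in time, so arrivals and
  departures are treated separately, and one formula serves both: arrivals are departures with
  service time zero. Functionals of the path need not be measurable, so the weak limit is read off
  from measurable events of probability near one on which the path is uniformly close to the
  limit.\<close>

lemma pick_in:
  assumes "finite S" "S \<noteq> {}" "0 \<le> u" "u < 1"
  shows "pick S u \<in> S"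
proof -
  have "0 < card S" using assms by (simp add: card_gt_0_iff)
  then have "u * real (card S) < real (card S)" using assms by simp
  then have "nat \<lfloor>u * real (card S)\<rfloor> < length (sorted_list_of_set S)"
    using assms by (simp add: nat_less_iff floor_less_iff)
  then show ?thesis
    unfolding pick_def using assms(1) nth_mem set_sorted_list_of_set by metis
qed

text \<open>\<open>\<rho> a\<close> is the service rate of \<open>a\<close> at whichever server of
  its target class takes it, so the time \<open>e a / \<rho> a\<close> does not depend on
  \<open>J\<close>. Consequently \<open>room\<close> speaks of a queue with unlimited servers and
  can be verified without knowing \<open>J\<close> and \<open>s\<close>.\<close>

locale jiq_sample_path =
  fixes Tk :: "task set" and V :: "nat \<Rightarrow> nat set" and \<mu> :: "nat \<Rightarrow> nat \<Rightarrow> real"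
    and \<tau> :: "task \<Rightarrow> real" and b :: "task \<Rightarrow> nat" and u e :: "task \<Rightarrow> real"
    and J :: "task \<Rightarrow> nat" and s :: "task \<Rightarrow> real"
    and C :: "nat set" and \<rho> :: "task \<Rightarrow> real" and T :: real
  assumes path: "jiq_path Tk V \<mu> \<tau> b u e J s"
    and inj_\<tau>: "inj_on \<tau> Tk"
    and locally_finite: "finite {a \<in> Tk. \<tau> a \<le> t}"
    and \<tau>_nonneg: "a \<in> Tk \<Longrightarrow> 0 \<le> \<tau> a"
    and u: "a \<in> Tk \<Longrightarrow> 0 \<le> u a \<and> u a < 1"
    and b: "a \<in> Tk \<Longrightarrow> b a \<in> C"
    and finite_V: "m \<in> C \<Longrightarrow> finite (V m)"
    and disjoint_V: "m \<in> C \<Longrightarrow> m' \<in> C \<Longrightarrow> m \<noteq> m' \<Longrightarrow> V m \<inter> V m' = {}"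
    and rate: "a \<in> Tk \<Longrightarrow> j \<in> V (b a) \<Longrightarrow> \<mu> (fst a) j = \<rho> a"
    and room: "t \<in> {0..T} \<Longrightarrow> m \<in> C \<Longrightarrow>
      card {a \<in> Tk. b a = m \<and> \<tau> a \<le> t \<and> t < \<tau> a + e a / \<rho> a} < card (V m)"
begin

lemma finite_earlier: "finite {a' \<in> Tk. \<tau> a' < \<tau> a \<and> Q a'}"
  by (rule finite_subset[OF _ locally_finite[of "\<tau> a"]]) auto

lemma J_eq: "a \<in> Tk \<Longrightarrow> J a =
    (let I = idle_servers Tk \<mu> \<tau> e J s (V (b a)) (\<tau> a) in pick (if I \<noteq> {} then I else V (b a)) (u a))"
  using path by (simp add: jiq_path_def)

lemma s_eq: "a \<in> Tk \<Longrightarrow>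
    s a = Max (insert (\<tau> a) (completion_time \<mu> e J s ` {a' \<in> Tk. \<tau> a' < \<tau> a \<and> J a' = J a}))"
  using path by (simp add: jiq_path_def)

lemma arrival_le_start: "a \<in> Tk \<Longrightarrow> \<tau> a \<le> s a"
  by (subst s_eq) (auto intro!: Max_ge finite_earlier)

text \<open>Induction over the number of earlier arrivals, finite by local finiteness. The earlier
  tasks started at once in their own classes, so every busy server in the target class holds a task
  counted by \<open>room\<close>; some server is then idle. The last conjunct, that the chosen
  server has nothing left to do, gives injectivity of \<open>J\<close> in the occupancy
  formula.\<close>

lemma immediate_start:
  assumes "a \<in> Tk" "\<tau> a \<le> T"
  shows "J a \<in> V (b a) \<and> s a = \<tau> a \<and>
    (\<forall>a'\<in>Tk. \<tau> a' < \<tau> a \<and> J a' = J a \<longrightarrow> completion_time \<mu> e J s a' \<le> \<tau> a)"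
  using assms
proof (induction "card {a' \<in> Tk. \<tau> a' < \<tau> a}" arbitrary: a rule: less_induct)
  case less
  note a = less.prems(1)
  have earlier: "J a' \<in> V (b a') \<and> s a' = \<tau> a'" if "a' \<in> Tk" "\<tau> a' < \<tau> a" for a'
  proof -
    have "card {a'' \<in> Tk. \<tau> a'' < \<tau> a'} < card {a' \<in> Tk. \<tau> a' < \<tau> a}"
      using that finite_earlier[of a "\<lambda>_. True"] by (intro psubset_card_mono) auto
    then show ?thesis using less.hyps[of a'] that less.prems by auto
  qed
  have compl: "completion_time \<mu> e J s a' = \<tau> a' + e a' / \<rho> a'" if "a' \<in> Tk" "\<tau> a' < \<tau> a" for a'
    using earlier[OF that] rate[OF that(1)] by (simp add: completion_time_def)
  define I where "I = idle_servers Tk \<mu> \<tau> e J s (V (b a)) (\<tau> a)"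
  let ?In = "{a' \<in> Tk. b a' = b a \<and> \<tau> a' \<le> \<tau> a \<and> \<tau> a < \<tau> a' + e a' / \<rho> a'}"
  have fin: "finite ?In"
    by (rule finite_subset[OF _ locally_finite[of "\<tau> a"]]) auto
  have "V (b a) - I \<subseteq> J ` ?In"
  proof
    fix j assume j: "j \<in> V (b a) - I"
    then obtain a' where a': "a' \<in> Tk" "\<tau> a' < \<tau> a" "J a' = j" "\<not> completion_time \<mu> e J s a' \<le> \<tau> a"
      by (auto simp: I_def idle_servers_def)
    then have "V (b a') \<inter> V (b a) \<noteq> {}" using earlier[of a'] j by auto
    then have "b a' = b a" using disjoint_V[OF b[OF a'(1)] b[OF a]] by auto
    then show "j \<in> J ` ?In" using a' compl[of a'] by auto
  qed
  then have "card (V (b a) - I) \<le> card ?In"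
    using fin by (meson card_image_le card_mono finite_imageI le_trans)
  also have "\<dots> < card (V (b a))"
    using less.prems \<tau>_nonneg[OF a] b[OF a] by (intro room) auto
  finally have "I \<noteq> {}" by auto
  moreover have "I \<subseteq> V (b a)" by (auto simp: I_def idle_servers_def)
  moreover have "J a = pick I (u a)"
    using J_eq[OF a] \<open>I \<noteq> {}\<close> by (simp add: I_def[symmetric])
  ultimately have "J a \<in> I"
    using pick_in[of I "u a"] u[OF a] finite_subset[OF _ finite_V[OF b[OF a]]] by auto
  then have idle: "\<forall>a'\<in>Tk. \<tau> a' < \<tau> a \<and> J a' = J a \<longrightarrow> completion_time \<mu> e J s a' \<le> \<tau> a"
    by (auto simp: I_def idle_servers_def)
  moreover have "s a = \<tau> a"
    unfolding s_eq[OF a] by (rule Max_eqI) (use idle finite_earlier[of a] in auto)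
  ultimately show ?case using \<open>J a \<in> I\<close> \<open>I \<subseteq> V (b a)\<close> by auto
qed

text \<open>\<open>J\<close> is a bijection from the tasks in service at time \<open>t\<close> in
  the unlimited queue onto the busy servers, because a server is assigned again only after its
  earlier tasks are completed.\<close>

lemma occupancy_eq:
  assumes t: "t \<in> {0..T}" and m: "m \<in> C"
  shows "occupancy N Tk \<mu> e J s (V m) r t =
    real (card {a \<in> Tk. b a = m \<and> \<rho> a = r \<and> \<tau> a \<le> t \<and> t < \<tau> a + e a / \<rho> a}) / real N"
proof -
  let ?A = "{a \<in> Tk. b a = m \<and> \<rho> a = r \<and> \<tau> a \<le> t \<and> t < \<tau> a + e a / \<rho> a}"
  have start: "J a \<in> V (b a)" "s a = \<tau> a" "completion_time \<mu> e J s a = \<tau> a + e a / \<rho> a"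
    "\<mu> (fst a) (J a) = \<rho> a" if "a \<in> Tk" "\<tau> a \<le> t" for a
    using immediate_start[of a] that t rate[OF that(1)] by (auto simp: completion_time_def)
  have "{j \<in> V m. \<exists>a\<in>Tk. J a = j \<and> \<mu> (fst a) j = r \<and> s a \<le> t \<and> t < completion_time \<mu> e J s a} = J ` ?A"
  proof (intro equalityI subsetI)
    fix j assume "j \<in> {j \<in> V m. \<exists>a\<in>Tk. J a = j \<and> \<mu> (fst a) j = r \<and> s a \<le> t \<and> t < completion_time \<mu> e J s a}"
    then obtain a where a: "a \<in> Tk" "j \<in> V m" "J a = j" "\<mu> (fst a) (J a) = r" "s a \<le> t" "t < completion_time \<mu> e J s a"
      by blast
    then have at: "\<tau> a \<le> t" using arrival_le_start[of a] by simp
    have "b a = m" using start(1)[OF a(1) at] a(2,3) disjoint_V[OF b[OF a(1)] m] by blast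
    then have "a \<in> ?A" using start(3,4)[OF a(1) at] a(1,4,6) at by simp
    then show "j \<in> J ` ?A" using a(3) by blast
  next
    fix j assume "j \<in> J ` ?A"
    then obtain a where a: "a \<in> Tk" "b a = m" "\<tau> a \<le> t" "t < \<tau> a + e a / \<rho> a" "\<rho> a = r" "j = J a"
      by blast
    note st = start[OF a(1,3)]
    have "\<mu> (fst a) j = r \<and> s a \<le> t \<and> t < completion_time \<mu> e J s a"
      using st(2-4) a(3-6) by simp
    then show "j \<in> {j \<in> V m. \<exists>a\<in>Tk. J a = j \<and> \<mu> (fst a) j = r \<and> s a \<le> t \<and> t < completion_time \<mu> e J s a}"
      using st(1) a(1,2,6) by blast
  qed
  moreover have "inj_on J ?A"
  proof (rule inj_onI, rule ccontr)
    fix a a'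
    assume aa: "a \<in> ?A" "a' \<in> ?A" "J a = J a'" "a \<noteq> a'"
    have "\<tau> a \<noteq> \<tau> a'" using inj_onD[OF inj_\<tau>, of a a'] aa by blast
    \<comment> \<open>The later of two tasks on one server found the earlier one completed on its
      arrival, which is not after \<open>t\<close>; so the earlier one cannot still be in service at
      \<open>t\<close>.\<close>
    moreover have False if c: "c \<in> ?A" "c' \<in> ?A" "J c = J c'" "\<tau> c < \<tau> c'" for c c'
    proof -
      have "\<tau> c' \<le> T" using c(2) t by simp
      then have "completion_time \<mu> e J s c \<le> \<tau> c'" using immediate_start[of c'] c by simp
      moreover have "completion_time \<mu> e J s c = \<tau> c + e c / \<rho> c" using c(1) by (intro start(3)) simp_all
      ultimately show False using c(1,2) by simp
    qed
    ultimately show False using aa(1,2,3) aa(3)[symmetric] linorder_neqE_linordered_idom by blast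
  qed
  ultimately show ?thesis by (simp add: occupancy_def card_image)
qed

end

section \<open>Marked Poisson processes\<close>

definition epoch :: "(nat \<Rightarrow> real \<times> 'k) \<Rightarrow> nat \<Rightarrow> real" where
  "epoch z n = (\<Sum>l\<le>n. fst (z l))"

lemma epoch_0: "epoch z 0 = fst (z 0)"
  by (simp add: epoch_def)

lemma epoch_case_nat_Suc: "epoch (case_nat s z) (Suc n) = fst s + epoch z n"
  unfolding epoch_def by (subst sum.atMost_Suc_shift) simp

lemma epoch_comb_seq_less: "n < i \<Longrightarrow> epoch (comb_seq i z z') n = epoch z n"
  by (simp add: epoch_def comb_seq_less)

text \<open>Regeneration: \<open>comb_seq (Suc n)\<close> continues \<open>z\<close> after its entry
  \<open>n\<close> by a fresh sequence, whose epochs are then counted from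
  \<open>epoch z n\<close>.\<close>

lemma epoch_comb_seq_add: "epoch (comb_seq (Suc n) z z') (Suc n + k) = epoch z n + epoch z' k"
proof -
  have "epoch (comb_seq (Suc n) z z') (Suc n + k) =
    (\<Sum>l\<in>{..n} \<union> {Suc n..Suc n + k}. fst (comb_seq (Suc n) z z' l))"
    unfolding epoch_def by (rule sum.cong) auto
  also have "\<dots> = (\<Sum>l\<le>n. fst (comb_seq (Suc n) z z' l)) + (\<Sum>l=Suc n..Suc n + k. fst (comb_seq (Suc n) z z' l))"
    by (rule sum.union_disjoint) auto
  also have "(\<Sum>l\<le>n. fst (comb_seq (Suc n) z z' l)) = epoch z n"
    by (simp add: epoch_def comb_seq_less)
  also have "(\<Sum>l=Suc n..Suc n + k. fst (comb_seq (Suc n) z z' l)) = (\<Sum>l=0..k. fst (comb_seq (Suc n) z z' (Suc n + l)))"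
    using sum.shift_bounds_cl_nat_ivl[of "\<lambda>l. fst (comb_seq (Suc n) z z' l)" 0 "Suc n" k] by (simp add: add.commute)
  also have "\<dots> = epoch z' k"
    unfolding epoch_def atMost_atLeast0 using comb_seq_add[of "Suc n" z z'] by (intro sum.cong) (auto simp: add.commute)
  finally show ?thesis .
qed

lemma nn_integral_shift:
  fixes f :: "real \<Rightarrow> ennreal"
  assumes "f \<in> borel_measurable borel"
  shows "(\<integral>\<^sup>+u. f (a + u) \<partial>lborel) = (\<integral>\<^sup>+u. f u \<partial>lborel)"
  using nn_integral_real_affine[OF assms, of 1 a] by simp

text \<open>The Erlang density of order \<open>n\<close> is the density of epoch \<open>n\<close>,
  so the sum is the intensity of all epochs together. It is an exponential series, hence constant:
  the mean number of epochs in a set of positive times is \<open>l\<close> times its length.\<close>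

lemma suminf_erlang_density:
  assumes "0 < l"
  shows "(\<Sum>n. ennreal (erlang_density n l u)) = ennreal l * indicator {0..} u"
proof (cases "u < 0")
  case False
  have "(\<lambda>n. (l * exp (- l * u)) * ((l * u) ^ n /\<^sub>R fact n)) sums ((l * exp (- l * u)) * exp (l * u))"
    by (intro sums_mult exp_converges)
  also have "(l * exp (- l * u)) * exp (l * u) = l"
    by (simp add: exp_minus)
  also have "(\<lambda>n. (l * exp (- l * u)) * ((l * u) ^ n /\<^sub>R fact n)) = (\<lambda>n. erlang_density n l u)"
    using False by (auto simp: erlang_density_def fun_eq_iff power_mult_distrib divide_simps)
  finally have s: "(\<lambda>n. erlang_density n l u) sums l" .
  have "(\<Sum>n. ennreal (erlang_density n l u)) = ennreal l"
    using s assms by (subst suminf_ennreal2) (auto simp: sums_iff)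
  then show ?thesis using False by simp
qed (simp add: erlang_density_def)

text \<open>The values are in \<open>ennreal\<close>, so the count can be integrated and summed
  before anything is known about its finiteness.\<close>

definition marked_count :: "(real \<times> 'k) set \<Rightarrow> (nat \<Rightarrow> real \<times> 'k) \<Rightarrow> ennreal" where
  "marked_count G z = (\<Sum>n. indicator G (epoch z n, snd (z n)))"

text \<open>The process is encoded by an i.i.d. sequence of pairs (gap, mark). On sequence space,
  splitting off the head or an initial segment gives independent parts, and this takes the place of
  conditioning on the past.\<close>

locale marked_poisson = K: prob_space \<kappa> for \<kappa> :: "'k measure" +
  fixes l :: real
  assumes l_pos: "0 < l"
begin

definition L :: "(real \<times> 'k) measure" where
  "L = density lborel (exponential_density l) \<Otimes>\<^sub>M \<kappa>"

lemma sets_L[measurable_cong]: "sets L = sets (borel \<Otimes>\<^sub>M \<kappa>)"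
  unfolding L_def by (intro sets_pair_measure_cong) auto

lemma prob_space_L: "prob_space L"
proof -
  interpret e: prob_space "density lborel (exponential_density l)"
    using l_pos by (rule prob_space_exponential_density)
  interpret pair_prob_space "density lborel (exponential_density l)" \<kappa> ..
  show ?thesis unfolding L_def by unfold_locales
qed

sublocale sequence_space L
proof -
  interpret l: prob_space L by (rule prob_space_L)
  show "sequence_space L" unfolding sequence_space_def by (rule product_prob_spaceI) unfold_locales
qed

lemma measurable_epoch[measurable]: "(\<lambda>z. epoch z n) \<in> borel_measurable S"
  unfolding epoch_def by measurable

lemma nn_integral_L:
  assumes [measurable]: "h \<in> borel_measurable (borel \<Otimes>\<^sub>M \<kappa>)"
  shows "(\<integral>\<^sup>+y. h y \<partial>L) = (\<integral>\<^sup>+a. ennreal (exponential_density l a) * (\<integral>\<^sup>+k. h (a, k) \<partial>\<kappa>) \<partial>lborel)"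
proof -
  have "h \<in> borel_measurable (density lborel (exponential_density l) \<Otimes>\<^sub>M \<kappa>)"
    using assms measurable_cong_sets[OF sets_L[unfolded L_def] refl] by blast
  then have "(\<integral>\<^sup>+y. h y \<partial>L) = (\<integral>\<^sup>+a. (\<integral>\<^sup>+k. h (a, k) \<partial>\<kappa>) \<partial>density lborel (exponential_density l))"
    unfolding L_def by (rule K.nn_integral_fst[symmetric])
  then show ?thesis
    by (subst (asm) nn_integral_density) auto
qed

text \<open>Induction by splitting off the first gap, which moves the origin; hence the arbitrary
  offset \<open>x\<close>. The mark of point \<open>n\<close> is independent of its epoch and is
  integrated out by \<open>\<kappa>\<close>, and the epochs compose by convolution of Erlang
  densities.\<close>

lemma nn_integral_epoch:
  assumes \<psi>[measurable]: "\<psi> \<in> borel_measurable (borel \<Otimes>\<^sub>M \<kappa>)"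
  shows "(\<integral>\<^sup>+z. \<psi> (x + epoch z n, snd (z n)) \<partial>S) =
    (\<integral>\<^sup>+u. ennreal (erlang_density n l u) * (\<integral>\<^sup>+k. \<psi> (x + u, k) \<partial>\<kappa>) \<partial>lborel)"
proof (induction n arbitrary: x)
  case 0
  have "(\<integral>\<^sup>+z. \<psi> (x + epoch z 0, snd (z 0)) \<partial>S) = (\<integral>\<^sup>+z. (\<lambda>y. \<psi> (x + fst y, snd y)) (z 0) \<partial>S)"
    by (simp add: epoch_0)
  also have "\<dots> = (\<integral>\<^sup>+y. \<psi> (x + fst y, snd y) \<partial>distr S L (\<lambda>z. z 0))"
    by (subst nn_integral_distr) auto
  also have "\<dots> = (\<integral>\<^sup>+y. \<psi> (x + fst y, snd y) \<partial>L)"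
    by (simp add: PiM_component)
  finally show ?case
    by (simp add: nn_integral_L)
next
  case (Suc n)
  define g where "g y = (\<integral>\<^sup>+k. \<psi> (y, k) \<partial>\<kappa>)" for y
  have [measurable]: "g \<in> borel_measurable borel" unfolding g_def by measurable
  let ?E = "\<lambda>n u. ennreal (erlang_density n l u)"
  have "(\<integral>\<^sup>+z. \<psi> (x + epoch z (Suc n), snd (z (Suc n))) \<partial>S) =
    (\<integral>\<^sup>+z. \<psi> (x + epoch z (Suc n), snd (z (Suc n))) \<partial>distr (L \<Otimes>\<^sub>M S) S (\<lambda>(s, \<omega>). case_nat s \<omega>))"
    by (simp add: PiM_iter)
  also have "\<dots> = (\<integral>\<^sup>+y. \<psi> (x + fst (fst y) + epoch (snd y) n, snd (snd y n)) \<partial>(L \<Otimes>\<^sub>M S))"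
    by (subst nn_integral_distr) (auto simp: case_prod_beta epoch_case_nat_Suc add.assoc)
  also have "\<dots> = (\<integral>\<^sup>+s. (\<integral>\<^sup>+z. \<psi> (x + fst s + epoch z n, snd (z n)) \<partial>S) \<partial>L)"
    by (subst P.nn_integral_fst[symmetric]) auto
  also have "\<dots> = (\<integral>\<^sup>+s. (\<integral>\<^sup>+u. ?E n u * g (x + fst s + u) \<partial>lborel) \<partial>L)"
    by (simp add: Suc.IH g_def)
  also have "\<dots> = (\<integral>\<^sup>+a. ?E 0 a * (\<integral>\<^sup>+u. ?E n u * g (x + a + u) \<partial>lborel) \<partial>lborel)"
    by (subst nn_integral_L) (auto simp: K.emeasure_space_1)
  \<comment> \<open>Substituting \<open>v = a + u\<close> makes the inner integrand a convolution
    kernel, so that after Fubini the integral over \<open>a\<close> is the next Erlang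
    density.\<close>
  also have "\<dots> = (\<integral>\<^sup>+a. ?E 0 a * (\<integral>\<^sup>+v. ?E n (v - a) * g (x + v) \<partial>lborel) \<partial>lborel)"
  proof -
    have "(\<integral>\<^sup>+u. ?E n u * g (x + a + u) \<partial>lborel) = (\<integral>\<^sup>+v. ?E n (v - a) * g (x + v) \<partial>lborel)" for a
      using nn_integral_shift[of "\<lambda>v. ?E n (v - a) * g (x + v)" a] by (simp add: add.assoc)
    then show ?thesis by simp
  qed
  also have "\<dots> = (\<integral>\<^sup>+a. (\<integral>\<^sup>+v. ?E n (v - a) * ?E 0 a * g (x + v) \<partial>lborel) \<partial>lborel)"
    by (subst nn_integral_cmult[symmetric]) (auto intro!: nn_integral_cong simp: ac_simps)
  also have "\<dots> = (\<integral>\<^sup>+v. (\<integral>\<^sup>+a. ?E n (v - a) * ?E 0 a * g (x + v) \<partial>lborel) \<partial>lborel)"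
    by (rule lborel_pair.Fubini') measurable
  also have "\<dots> = (\<integral>\<^sup>+v. (\<integral>\<^sup>+a. ?E n (v - a) * ?E 0 a \<partial>lborel) * g (x + v) \<partial>lborel)"
    by (subst nn_integral_multc) auto
  also have "\<dots> = (\<integral>\<^sup>+v. ?E (Suc n) v * g (x + v) \<partial>lborel)"
    using convolution_erlang_density[OF l_pos, of n 0] by (simp add: fun_eq_iff)
  finally show ?case by (simp add: g_def)
qed

text \<open>Campbell's formula. The offset \<open>x\<close> lets it also count the points that
  follow a given epoch, as the second moment requires.\<close>

lemma nn_integral_marked_points:
  assumes \<psi>[measurable]: "\<psi> \<in> borel_measurable (borel \<Otimes>\<^sub>M \<kappa>)"
  shows "(\<integral>\<^sup>+z. (\<Sum>n. \<psi> (x + epoch z n, snd (z n))) \<partial>S) =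
    ennreal l * (\<integral>\<^sup>+u. indicator {0..} u * (\<integral>\<^sup>+k. \<psi> (x + u, k) \<partial>\<kappa>) \<partial>lborel)"
proof -
  have "(\<integral>\<^sup>+z. (\<Sum>n. \<psi> (x + epoch z n, snd (z n))) \<partial>S) =
    (\<Sum>n. \<integral>\<^sup>+u. ennreal (erlang_density n l u) * (\<integral>\<^sup>+k. \<psi> (x + u, k) \<partial>\<kappa>) \<partial>lborel)"
    by (subst nn_integral_suminf) (auto simp: nn_integral_epoch)
  also have "\<dots> = (\<integral>\<^sup>+u. (\<Sum>n. ennreal (erlang_density n l u) * (\<integral>\<^sup>+k. \<psi> (x + u, k) \<partial>\<kappa>)) \<partial>lborel)"
    by (subst nn_integral_suminf) auto
  also have "\<dots> = (\<integral>\<^sup>+u. ennreal l * (indicator {0..} u * (\<integral>\<^sup>+k. \<psi> (x + u, k) \<partial>\<kappa>)) \<partial>lborel)"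
    by (simp add: ennreal_suminf_multc suminf_erlang_density[OF l_pos] mult.assoc)
  finally show ?thesis by (subst (asm) nn_integral_cmult) auto
qed

lemma measurable_marked_count[measurable]:
  assumes [measurable]: "G \<in> sets (borel \<Otimes>\<^sub>M \<kappa>)"
  shows "marked_count G \<in> borel_measurable S"
  unfolding marked_count_def by measurable

lemma nn_integral_marked_count:
  assumes [measurable]: "G \<in> sets (borel \<Otimes>\<^sub>M \<kappa>)"
  shows "(\<integral>\<^sup>+z. marked_count G z \<partial>S) =
    ennreal l * (\<integral>\<^sup>+u. indicator {0..} u * emeasure \<kappa> (Pair u -` G) \<partial>lborel)"
proof -
  have "(\<integral>\<^sup>+k. indicator G (u, k) \<partial>\<kappa>) = emeasure \<kappa> (Pair u -` G)" for u
  proof -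
    have "(\<integral>\<^sup>+k. indicator G (u, k) \<partial>\<kappa>) = (\<integral>\<^sup>+k. indicator (Pair u -` G) k \<partial>\<kappa>)"
      by (intro nn_integral_cong) (auto simp: indicator_def)
    then show ?thesis by (simp add: sets_Pair1[OF assms])
  qed
  then show ?thesis
    unfolding marked_count_def using nn_integral_marked_points[of "indicator G" 0] by simp
qed

end

section \<open>Second moments of marked counts\<close>

lemma nn_integral_triangle_le:
  fixes f :: "real \<Rightarrow> ennreal"
  assumes [measurable]: "f \<in> borel_measurable borel"
  shows "2 * (\<integral>\<^sup>+u. f u * (\<integral>\<^sup>+v. indicator {0..} v * f (u + v) \<partial>lborel) \<partial>lborel) \<le> (\<integral>\<^sup>+u. f u \<partial>lborel)\<^sup>2"
proof -
  let ?T = "\<integral>\<^sup>+u. f u * (\<integral>\<^sup>+v. indicator {0..} v * f (u + v) \<partial>lborel) \<partial>lborel"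
  have eq: "(\<integral>\<^sup>+v. indicator {0..} v * f (u + v) \<partial>lborel) = (\<integral>\<^sup>+v. indicator {u<..} v * f v \<partial>lborel)" for u
  proof -
    have "(\<integral>\<^sup>+v. indicator {0..} v * f (u + v) \<partial>lborel) = (\<integral>\<^sup>+v. indicator {u..} (u + v) * f (u + v) \<partial>lborel)"
      by (intro nn_integral_cong) (auto simp: indicator_def)
    also have "\<dots> = (\<integral>\<^sup>+v. indicator {u..} v * f v \<partial>lborel)"
      by (rule nn_integral_shift[of "\<lambda>v. indicator {u..} v * f v" u]) measurable
    \<comment> \<open>Dropping the diagonal, a null set in \<open>v\<close>, makes the triangle and
      its mirror image disjoint.\<close>
    also have "\<dots> = (\<integral>\<^sup>+v. indicator {u<..} v * f v \<partial>lborel)"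
      using AE_lborel_singleton[of u] by (intro nn_integral_cong_AE) (auto simp: indicator_def elim!: eventually_mono)
    finally show ?thesis .
  qed
  have A: "?T = (\<integral>\<^sup>+u. \<integral>\<^sup>+v. (if u < v then f u * f v else 0) \<partial>lborel \<partial>lborel)"
    unfolding eq by (subst nn_integral_cmult[symmetric]) (auto intro!: nn_integral_cong simp: indicator_def)
  \<comment> \<open>Exchanging the two integrations turns the triangle above the diagonal into the
    one below; the two together lie in the square, whence the factor 2.\<close>
  have B: "?T = (\<integral>\<^sup>+u. \<integral>\<^sup>+v. (if v < u then f u * f v else 0) \<partial>lborel \<partial>lborel)"
    unfolding A by (subst lborel_pair.Fubini') (auto intro!: nn_integral_cong simp: ac_simps)
  have "2 * ?T = (\<integral>\<^sup>+u. \<integral>\<^sup>+v. ((if u < v then f u * f v else 0) + (if v < u then f u * f v else 0)) \<partial>lborel \<partial>lborel)"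
    unfolding mult_2
    by (subst A, subst B) (simp add: nn_integral_add[symmetric])
  also have "\<dots> \<le> (\<integral>\<^sup>+u. \<integral>\<^sup>+v. f u * f v \<partial>lborel \<partial>lborel)"
    by (intro nn_integral_mono) (auto simp: indicator_def)
  also have "\<dots> = (\<integral>\<^sup>+u. f u \<partial>lborel)\<^sup>2"
    by (simp add: nn_integral_cmult nn_integral_multc power2_eq_square)
  finally show ?thesis .
qed


text \<open>The square of a sum is its diagonal plus twice the pairs \<open>n < k\<close>, and for
  idempotent terms the diagonal is the sum itself. The identity is proved for finite sums and passes
  to the limit as an inequality. The inner index \<open>Suc n + k\<close> matches a split of the
  sequence after entry \<open>n\<close>.\<close>

lemma square_suminf_indicator_le:
  fixes X :: "nat \<Rightarrow> ennreal"
  assumes X: "\<And>n. X n * X n = X n"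
  shows "(\<Sum>n. X n)\<^sup>2 \<le> (\<Sum>n. X n) + 2 * (\<Sum>n. X n * (\<Sum>k. X (Suc n + k)))"
proof -
  have fin: "(\<Sum>n<N. X n)\<^sup>2 = (\<Sum>n<N. X n) + 2 * (\<Sum>n<N. X n * (\<Sum>k\<in>{n<..<N}. X k))" for N
  proof (induction N)
    case (Suc N)
    have "{n<..<Suc N} = insert N {n<..<N}" if "n < N" for n using that by auto
    moreover have "{N<..<Suc N} = {}" by auto
    ultimately have "(\<Sum>n<Suc N. X n * (\<Sum>k\<in>{n<..<Suc N}. X k)) =
        (\<Sum>n<N. X n * (\<Sum>k\<in>{n<..<N}. X k)) + (\<Sum>n<N. X n) * X N"
      by (simp add: distrib_left sum.distrib sum_distrib_right add.commute)
    then show ?case using Suc X[of N] by (simp add: power2_eq_square algebra_simps mult_2)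
  qed simp
  have le: "(\<Sum>n<N. X n)\<^sup>2 \<le> (\<Sum>n. X n) + 2 * (\<Sum>n. X n * (\<Sum>k. X (Suc n + k)))" for N
  proof -
    have "(\<Sum>k\<in>{n<..<N}. X k) \<le> (\<Sum>k. X (Suc n + k))" for n
    proof -
      have "(\<Sum>k\<in>{n<..<N}. X k) = (\<Sum>k<N - Suc n. X (Suc n + k))"
        by (rule sum.reindex_bij_witness[of _ "\<lambda>k. Suc n + k" "\<lambda>k. k - Suc n"]) auto
      also have "\<dots> \<le> (\<Sum>k. X (Suc n + k))" by (rule sum_le_suminf) auto
      finally show ?thesis .
    qed
    then have "(\<Sum>n<N. X n * (\<Sum>k\<in>{n<..<N}. X k)) \<le> (\<Sum>n<N. X n * (\<Sum>k. X (Suc n + k)))"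
      by (intro sum_mono mult_left_mono) auto
    also have "\<dots> \<le> (\<Sum>n. X n * (\<Sum>k. X (Suc n + k)))" by (rule sum_le_suminf) auto
    finally show ?thesis unfolding fin by (intro add_mono mult_left_mono sum_le_suminf) auto
  qed
  have "(\<lambda>N. \<Sum>n<N. X n) \<longlonglongrightarrow> (\<Sum>n. X n)" by (rule summable_LIMSEQ) simp
  then have "(\<lambda>N. (\<Sum>n<N. X n) * (\<Sum>n<N. X n)) \<longlonglongrightarrow> (\<Sum>n. X n) * (\<Sum>n. X n)"
    by (intro tendsto_mult_ennreal) auto
  then show ?thesis
    using le unfolding power2_eq_square by (blast intro: LIMSEQ_le_const2)
qed

context marked_poisson
begin

text \<open>Beyond point \<open>n\<close> the process is a fresh one started at
  \<open>epoch z n\<close>, so the mean number of pairs comes from Campbell's formula for the later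
  point and again for the earlier one. The resulting double integral runs over a triangle, and twice
  it is at most \<open>m\<^sup>2\<close>. The variance is thus at most the mean.\<close>

lemma nn_integral_marked_count_square_le:
  assumes G[measurable]: "G \<in> sets (borel \<Otimes>\<^sub>M \<kappa>)"
  defines "m \<equiv> \<integral>\<^sup>+z. marked_count G z \<partial>S"
  shows "(\<integral>\<^sup>+z. (marked_count G z)\<^sup>2 \<partial>S) \<le> m + m\<^sup>2"
proof -
  define g where "g u = (\<integral>\<^sup>+k. indicator G (u, k) \<partial>\<kappa>)" for u
  have [measurable]: "g \<in> borel_measurable borel" unfolding g_def by measurable
  define f where "f u = indicator {0..} u * g u" for u :: real
  have [measurable]: "f \<in> borel_measurable borel" unfolding f_def by measurable
  \<comment> \<open>The mean number of points in \<open>G\<close> of a fresh process started at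
    \<open>x\<close>.\<close>
  define M1 where "M1 x = ennreal l * (\<integral>\<^sup>+v. indicator {0..} v * g (x + v) \<partial>lborel)" for x
  have [measurable]: "M1 \<in> borel_measurable borel" unfolding M1_def by measurable
  define X where "X z n = (indicator G (epoch z n, snd (z n)) :: ennreal)" for z n
  have [measurable]: "(\<lambda>z. X z n) \<in> borel_measurable S" for n unfolding X_def by measurable
  have m: "m = ennreal l * (\<integral>\<^sup>+u. f u \<partial>lborel)"
    unfolding m_def marked_count_def f_def g_def
    using nn_integral_marked_points[of "indicator G" 0] by simp
  have split: "(\<integral>\<^sup>+z. X z n * (\<Sum>k. X z (Suc n + k)) \<partial>S) = (\<integral>\<^sup>+z. X z n * M1 (epoch z n) \<partial>S)" for n
  proof -
    have "(\<integral>\<^sup>+z. X z n * (\<Sum>k. X z (Suc n + k)) \<partial>S) =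
      (\<integral>\<^sup>+z. X z n * (\<Sum>k. X z (Suc n + k)) \<partial>distr (S \<Otimes>\<^sub>M S) S (\<lambda>(\<omega>, \<omega>'). comb_seq (Suc n) \<omega> \<omega>'))"
      by (simp add: PiM_comb_seq)
    also have "\<dots> = (\<integral>\<^sup>+y. X (comb_seq (Suc n) (fst y) (snd y)) n * (\<Sum>k. X (comb_seq (Suc n) (fst y) (snd y)) (Suc n + k)) \<partial>(S \<Otimes>\<^sub>M S))"
      by (subst nn_integral_distr) (auto simp: case_prod_beta)
    also have "\<dots> = (\<integral>\<^sup>+y. X (fst y) n * (\<Sum>k. indicator G (epoch (fst y) n + epoch (snd y) k, snd (snd y k))) \<partial>(S \<Otimes>\<^sub>M S))"
    proof -
      have "X (comb_seq (Suc n) z z') (Suc n + k) = indicator G (epoch z n + epoch z' k, snd (z' k))" for z z' k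
        unfolding X_def epoch_comb_seq_add comb_seq_add[of "Suc n" z z' k, unfolded add.commute[of k]] ..
      moreover have "X (comb_seq (Suc n) z z') n = X z n" for z z'
        by (simp add: X_def epoch_comb_seq_less comb_seq_less)
      ultimately show ?thesis by presburger
    qed
    also have "\<dots> = (\<integral>\<^sup>+z. \<integral>\<^sup>+z'. X z n * (\<Sum>k. indicator G (epoch z n + epoch z' k, snd (z' k))) \<partial>S \<partial>S)"
      by (subst P.nn_integral_fst[symmetric]) auto
    also have "\<dots> = (\<integral>\<^sup>+z. X z n * (\<integral>\<^sup>+z'. (\<Sum>k. indicator G (epoch z n + epoch z' k, snd (z' k))) \<partial>S) \<partial>S)"
      by (subst nn_integral_cmult) auto
    also have "\<dots> = (\<integral>\<^sup>+z. X z n * M1 (epoch z n) \<partial>S)"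
      by (subst nn_integral_marked_points) (auto simp: M1_def g_def)
    finally show ?thesis .
  qed
  have "(\<integral>\<^sup>+z. (\<Sum>n. X z n * (\<Sum>k. X z (Suc n + k))) \<partial>S) = (\<Sum>n. \<integral>\<^sup>+z. X z n * (\<Sum>k. X z (Suc n + k)) \<partial>S)"
    by (rule nn_integral_suminf) measurable
  also have "\<dots> = (\<integral>\<^sup>+z. (\<Sum>n. X z n * M1 (epoch z n)) \<partial>S)"
    unfolding split by (rule nn_integral_suminf[symmetric]) measurable
  also have "\<dots> = ennreal l * (\<integral>\<^sup>+u. indicator {0..} u * (\<integral>\<^sup>+k. indicator G (u, k) * M1 u \<partial>\<kappa>) \<partial>lborel)"
    using nn_integral_marked_points[of "\<lambda>y. indicator G y * M1 (fst y)" 0] by (simp add: X_def)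
  also have "\<dots> = ennreal l * (\<integral>\<^sup>+u. ennreal l * (f u * (\<integral>\<^sup>+v. indicator {0..} v * f (u + v) \<partial>lborel)) \<partial>lborel)"
  proof -
    have "indicator {0..} u * (\<integral>\<^sup>+k. indicator G (u, k) * M1 u \<partial>\<kappa>) =
      ennreal l * (f u * (\<integral>\<^sup>+v. indicator {0..} v * f (u + v) \<partial>lborel))" for u :: real
    proof -
    have "indicator {0..} u * (\<integral>\<^sup>+k. indicator G (u, k) * M1 u \<partial>\<kappa>) = f u * M1 u"
      by (subst nn_integral_multc) (auto simp: f_def g_def mult.assoc)
    also have "\<dots> = ennreal l * (f u * (\<integral>\<^sup>+v. indicator {0..} v * f (u + v) \<partial>lborel))"
    proof (cases "0 \<le> u")
      case True
      \<comment> \<open>For nonnegative \<open>u\<close> and \<open>v\<close> the indicator inside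
        \<open>f (u + v)\<close> is one, so \<open>g\<close> may be replaced by \<open>f\<close> and
        the triangle bound applies.\<close>
      then have "(\<integral>\<^sup>+v. indicator {0..} v * f (u + v) \<partial>lborel) = (\<integral>\<^sup>+v. indicator {0..} v * g (u + v) \<partial>lborel)"
        by (intro nn_integral_cong) (auto simp: f_def indicator_def)
      then show ?thesis by (simp add: M1_def ac_simps)
    qed (simp add: f_def)
    finally show ?thesis .
    qed
    then show ?thesis by simp
  qed
  also have "\<dots> = ennreal l * (ennreal l * (\<integral>\<^sup>+u. f u * (\<integral>\<^sup>+v. indicator {0..} v * f (u + v) \<partial>lborel) \<partial>lborel))"
    by (subst nn_integral_cmult) auto
  finally have pairs: "2 * (\<integral>\<^sup>+z. (\<Sum>n. X z n * (\<Sum>k. X z (Suc n + k))) \<partial>S) =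
      ennreal l * ennreal l * (2 * (\<integral>\<^sup>+u. f u * (\<integral>\<^sup>+v. indicator {0..} v * f (u + v) \<partial>lborel) \<partial>lborel))"
    by (simp add: ac_simps)
  also have "\<dots> \<le> ennreal l * ennreal l * (\<integral>\<^sup>+u. f u \<partial>lborel)\<^sup>2"
    by (intro mult_left_mono nn_integral_triangle_le) auto
  also have "\<dots> = m\<^sup>2" by (simp add: m power2_eq_square ac_simps)
  finally have pairs_le: "2 * (\<integral>\<^sup>+z. (\<Sum>n. X z n * (\<Sum>k. X z (Suc n + k))) \<partial>S) \<le> m\<^sup>2" .
  have "(\<integral>\<^sup>+z. (marked_count G z)\<^sup>2 \<partial>S) \<le>
      (\<integral>\<^sup>+z. (\<Sum>n. X z n) + 2 * (\<Sum>n. X z n * (\<Sum>k. X z (Suc n + k))) \<partial>S)"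
    unfolding marked_count_def X_def[symmetric]
    by (intro nn_integral_mono square_suminf_indicator_le) (auto simp: X_def indicator_def)
  also have "\<dots> = m + 2 * (\<integral>\<^sup>+z. (\<Sum>n. X z n * (\<Sum>k. X z (Suc n + k))) \<partial>S)"
  proof -
    have "m = (\<integral>\<^sup>+z. (\<Sum>n. X z n) \<partial>S)" by (simp add: m_def marked_count_def X_def)
    then show ?thesis by (simp add: nn_integral_add nn_integral_cmult)
  qed
  also have "\<dots> \<le> m + m\<^sup>2" using pairs_le by (intro add_left_mono)
  finally show ?thesis .
qed

end

lemma marked_count_eq_emeasure:
  "marked_count G z = emeasure (count_space UNIV) {n. (epoch z n, snd (z n)) \<in> G}"
proof -
  have "emeasure (count_space UNIV) {n. (epoch z n, snd (z n)) \<in> G} =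
    (\<integral>\<^sup>+n. indicator {n. (epoch z n, snd (z n)) \<in> G} n \<partial>count_space UNIV)"
    by simp
  also have "\<dots> = (\<Sum>n. indicator {n. (epoch z n, snd (z n)) \<in> G} n)"
    by (rule nn_integral_count_space_nat)
  finally show ?thesis by (simp add: marked_count_def indicator_def)
qed

text \<open>The bound on the second moment leaves at most \<open>m\<close> for the variance. A
  finite mean makes \<open>Z\<close> finite almost everywhere, so \<open>enn2real\<close> loses
  nothing.\<close>

lemma (in prob_space) chebyshev_second_moment:
  fixes Z :: "'a \<Rightarrow> ennreal"
  assumes Z[measurable]: "Z \<in> borel_measurable M"
    and mean: "(\<integral>\<^sup>+\<omega>. Z \<omega> \<partial>M) = ennreal m" "0 \<le> m"
    and square: "(\<integral>\<^sup>+\<omega>. (Z \<omega>)\<^sup>2 \<partial>M) \<le> ennreal (m + m\<^sup>2)"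
    and "0 < \<epsilon>"
  shows "prob {\<omega> \<in> space M. \<epsilon> \<le> \<bar>enn2real (Z \<omega>) - m\<bar>} \<le> m / \<epsilon>\<^sup>2"
proof -
  have "AE \<omega> in M. Z \<omega> \<noteq> \<infinity>"
    using mean by (intro nn_integral_noteq_infinite) auto
  then have Zr: "AE \<omega> in M. Z \<omega> = ennreal (enn2real (Z \<omega>))"
    by eventually_elim (auto simp: less_top)
  have n1: "(\<integral>\<^sup>+\<omega>. ennreal (enn2real (Z \<omega>)) \<partial>M) = ennreal m"
    unfolding mean(1)[symmetric] using Zr by (intro nn_integral_cong_AE) auto
  have n2: "(\<integral>\<^sup>+\<omega>. ennreal ((enn2real (Z \<omega>))\<^sup>2) \<partial>M) \<le> ennreal (m + m\<^sup>2)"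
  proof -
    have "(\<integral>\<^sup>+\<omega>. ennreal ((enn2real (Z \<omega>))\<^sup>2) \<partial>M) = (\<integral>\<^sup>+\<omega>. (Z \<omega>)\<^sup>2 \<partial>M)"
      using Zr by (intro nn_integral_cong_AE) (auto simp: ennreal_power[symmetric])
    then show ?thesis using square by simp
  qed
  have i2: "integrable M (\<lambda>\<omega>. (enn2real (Z \<omega>))\<^sup>2)"
    using n2 by (intro integrableI_nonneg) (auto simp: less_top[symmetric] top_unique)
  have i1: "integrable M (\<lambda>\<omega>. enn2real (Z \<omega>))"
    using n1 by (intro integrableI_nonneg) auto
  have e1: "expectation (\<lambda>\<omega>. enn2real (Z \<omega>)) = m"
    using n1 mean(2) by (intro integral_eq_nn_integral[THEN trans]) auto
  have "expectation (\<lambda>\<omega>. (enn2real (Z \<omega>))\<^sup>2) \<le> m + m\<^sup>2"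
  proof -
    have "expectation (\<lambda>\<omega>. (enn2real (Z \<omega>))\<^sup>2) = enn2real (\<integral>\<^sup>+\<omega>. ennreal ((enn2real (Z \<omega>))\<^sup>2) \<partial>M)"
      by (intro integral_eq_nn_integral) auto
    also have "\<dots> \<le> m + m\<^sup>2"
      using n2 mean(2) by (intro enn2real_leI) auto
    finally show ?thesis .
  qed
  then have "variance (\<lambda>\<omega>. enn2real (Z \<omega>)) \<le> m"
    using i1 i2 e1 by (subst variance_eq) auto
  moreover have "prob {\<omega> \<in> space M. \<epsilon> \<le> \<bar>enn2real (Z \<omega>) - m\<bar>} \<le> variance (\<lambda>\<omega>. enn2real (Z \<omega>)) / \<epsilon>\<^sup>2"
    using Chebyshev_inequality[OF _ i2 \<open>0 < \<epsilon>\<close>] e1 by simp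
  ultimately show ?thesis
    by (smt (verit) divide_right_mono zero_le_power2)
qed

section \<open>Superposition of independent marked streams\<close>

locale marked_arrivals = prob_space P for P :: "'a measure" +
  fixes D :: "'i set" and lam :: "'i \<Rightarrow> real" and \<kappa> :: "'i \<Rightarrow> 'k measure"
    and Y :: "'i \<times> nat \<Rightarrow> 'a \<Rightarrow> real \<times> 'k"
  assumes finite_D: "finite D"
    and lam_pos: "i \<in> D \<Longrightarrow> 0 < lam i"
    and prob_space_\<kappa>: "i \<in> D \<Longrightarrow> prob_space (\<kappa> i)"
    and indep_Y: "indep_vars (\<lambda>a. density lborel (exponential_density (lam (fst a))) \<Otimes>\<^sub>M \<kappa> (fst a)) Y (D \<times> UNIV)"
    and distr_Y: "a \<in> D \<times> UNIV \<Longrightarrow>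
      distr P (density lborel (exponential_density (lam (fst a))) \<Otimes>\<^sub>M \<kappa> (fst a)) (Y a) =
        density lborel (exponential_density (lam (fst a))) \<Otimes>\<^sub>M \<kappa> (fst a)"
begin

definition Ln :: "'i \<Rightarrow> (real \<times> 'k) measure" where
  "Ln i = density lborel (exponential_density (lam i)) \<Otimes>\<^sub>M \<kappa> i"

definition stream :: "'i \<Rightarrow> 'a \<Rightarrow> nat \<Rightarrow> real \<times> 'k" where
  "stream i \<omega> n = Y (i, n) \<omega>"

lemma marked_poisson: "i \<in> D \<Longrightarrow> marked_poisson (\<kappa> i) (lam i)"
  by (simp add: marked_poisson_def marked_poisson_axioms_def prob_space_\<kappa> lam_pos)

lemma L_eq_Ln: "i \<in> D \<Longrightarrow> marked_poisson.L (\<kappa> i) (lam i) = Ln i"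
  by (simp add: Ln_def marked_poisson.L_def[OF marked_poisson])

lemma sets_Ln: "sets (Ln i) = sets (borel \<Otimes>\<^sub>M \<kappa> i)"
  unfolding Ln_def by (intro sets_pair_measure_cong) auto

lemma prob_space_Ln: "i \<in> D \<Longrightarrow> prob_space (Ln i)"
  using marked_poisson.prob_space_L[OF marked_poisson] L_eq_Ln by metis

lemma indep_Y_Ln: "indep_vars (\<lambda>a. Ln (fst a)) Y (D \<times> UNIV)"
  using indep_Y by (simp add: Ln_def)

lemma measurable_Y: "a \<in> D \<times> UNIV \<Longrightarrow> Y a \<in> measurable P (Ln (fst a))"
  using indep_Y_Ln by (auto simp: indep_vars_def)

lemma measurable_stream: "i \<in> D \<Longrightarrow> stream i \<in> measurable P (PiM UNIV (\<lambda>_. Ln i))"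
  unfolding stream_def[abs_def] using measurable_Y
  by (intro measurable_PiM_single') (fastforce simp: space_PiM dest: measurable_space)+

text \<open>The part of the independent family with first index \<open>i\<close> has a product law
  over \<open>{i} \<times> UNIV\<close>; reindexing by \<open>n\<close> turns this into the law on
  sequence space, so that integrals computed there hold for \<open>stream i\<close>.\<close>

lemma distr_stream:
  assumes "i \<in> D"
  shows "distr P (PiM UNIV (\<lambda>_. Ln i)) (stream i) = PiM UNIV (\<lambda>_. Ln i)"
proof -
  let ?I = "{i} \<times> (UNIV :: nat set)"
  let ?M = "\<lambda>a :: 'i \<times> nat. Ln (fst a)"
  have ind: "indep_vars ?M Y ?I"
    using indep_Y_Ln by (rule indep_vars_subset) (use assms in auto)
  have d: "distr P (PiM ?I ?M) (\<lambda>x. \<lambda>a\<in>?I. Y a x) = PiM ?I ?M"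
  proof -
    have "distr P (PiM ?I ?M) (\<lambda>x. \<lambda>a\<in>?I. Y a x) = (\<Pi>\<^sub>M a\<in>?I. distr P (?M a) (Y a))"
      by (rule indep_vars_iff_distr_eq_PiM'[THEN iffD1]) (use ind assms measurable_Y in auto)
    also have "\<dots> = PiM ?I ?M"
      using distr_Y assms by (intro PiM_cong) (auto simp: Ln_def)
    finally show ?thesis .
  qed
  have m1: "(\<lambda>x. \<lambda>a\<in>?I. Y a x) \<in> measurable P (PiM ?I ?M)"
    using ind by (intro measurable_restrict) (auto simp: indep_vars_def)
  have m2: "(\<lambda>\<omega>. \<lambda>n\<in>UNIV. \<omega> (i, n)) \<in> measurable (PiM ?I ?M) (PiM UNIV (\<lambda>_. Ln i))"
    by (rule measurable_restrict) (use measurable_component_singleton[of "(i, _)" ?I ?M] in auto)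
  have "distr (PiM ?I ?M) (PiM UNIV (\<lambda>n. ?M (i, n))) (\<lambda>\<omega>. \<lambda>n\<in>UNIV. \<omega> (i, n)) = PiM UNIV (\<lambda>n. ?M (i, n))"
    by (rule distr_PiM_reindex) (use prob_space_Ln assms in \<open>auto simp: inj_on_def\<close>)
  then have "PiM UNIV (\<lambda>_. Ln i) = distr (distr P (PiM ?I ?M) (\<lambda>x. \<lambda>a\<in>?I. Y a x)) (PiM UNIV (\<lambda>_. Ln i)) (\<lambda>\<omega>. \<lambda>n\<in>UNIV. \<omega> (i, n))"
    by (simp add: d)
  also have "\<dots> = distr P (PiM UNIV (\<lambda>_. Ln i)) (stream i)"
    using m1 m2 by (subst distr_distr) (auto simp: comp_def stream_def[abs_def] restrict_UNIV)
  finally show ?thesis ..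
qed

lemma nn_integral_stream:
  assumes "i \<in> D" "h \<in> borel_measurable (PiM UNIV (\<lambda>_. Ln i))"
  shows "(\<integral>\<^sup>+\<omega>. h (stream i \<omega>) \<partial>P) = (\<integral>\<^sup>+z. h z \<partial>PiM UNIV (\<lambda>_. Ln i))"
proof -
  have "(\<integral>\<^sup>+z. h z \<partial>PiM UNIV (\<lambda>_. Ln i)) = (\<integral>\<^sup>+z. h z \<partial>distr P (PiM UNIV (\<lambda>_. Ln i)) (stream i))"
    by (simp add: distr_stream[OF assms(1)])
  then show ?thesis by (simp add: nn_integral_distr measurable_stream assms)
qed

lemma indep_streams:
  assumes h: "\<And>i. i \<in> D \<Longrightarrow> h i \<in> measurable (PiM UNIV (\<lambda>_. Ln i)) (N i)"
  shows "indep_vars N (\<lambda>i \<omega>. h i (stream i \<omega>)) D"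
proof -
  let ?M = "\<lambda>a :: 'i \<times> nat. Ln (fst a)"
  let ?K = "\<lambda>i. {i} \<times> (UNIV :: nat set)"
  have "indep_vars (\<lambda>i. PiM (?K i) ?M) (\<lambda>i \<omega>. restrict (\<lambda>a. Y a \<omega>) (?K i)) D"
    using indep_Y_Ln by (rule indep_vars_restrict) (auto simp: disjoint_family_on_def)
  then have "indep_vars N (\<lambda>i \<omega>. (\<lambda>z. h i (\<lambda>n. z (i, n))) (restrict (\<lambda>a. Y a \<omega>) (?K i))) D"
  proof (rule indep_vars_compose2)
    fix i assume "i \<in> D"
    have "(\<lambda>\<omega>. \<lambda>n\<in>UNIV. \<omega> (i, n)) \<in> measurable (PiM (?K i) ?M) (PiM UNIV (\<lambda>_. Ln i))"
      by (rule measurable_restrict) (use measurable_component_singleton[of "(i, _)" "?K i" ?M] in auto)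
    then show "(\<lambda>z. h i (\<lambda>n. z (i, n))) \<in> measurable (PiM (?K i) ?M) (N i)"
      using measurable_compose[OF _ h[OF \<open>i \<in> D\<close>]] by (simp add: restrict_UNIV)
  qed
  then show ?thesis by (simp add: stream_def[abs_def])
qed

definition count :: "(real \<times> 'k) set \<Rightarrow> 'a \<Rightarrow> ennreal" where
  "count G \<omega> = (\<Sum>i\<in>D. marked_count G (stream i \<omega>))"

lemma measurable_marked_count_Ln:
  assumes "i \<in> D" "G \<in> sets (borel \<Otimes>\<^sub>M \<kappa> i)"
  shows "marked_count G \<in> borel_measurable (PiM UNIV (\<lambda>_. Ln i))"
  using marked_poisson.measurable_marked_count[OF marked_poisson assms(2)] assms L_eq_Ln by simp

lemma measurable_count:
  assumes "\<And>i. i \<in> D \<Longrightarrow> G \<in> sets (borel \<Otimes>\<^sub>M \<kappa> i)"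
  shows "count G \<in> borel_measurable P"
  unfolding count_def using assms measurable_compose[OF measurable_stream measurable_marked_count_Ln]
  by (intro borel_measurable_sum) auto

lemma nn_integral_count:
  assumes G: "\<And>i. i \<in> D \<Longrightarrow> G \<in> sets (borel \<Otimes>\<^sub>M \<kappa> i)"
  shows "(\<integral>\<^sup>+\<omega>. count G \<omega> \<partial>P) =
    (\<Sum>i\<in>D. ennreal (lam i) * (\<integral>\<^sup>+u. indicator {0..} u * emeasure (\<kappa> i) (Pair u -` G) \<partial>lborel))"
proof -
  have "(\<integral>\<^sup>+\<omega>. count G \<omega> \<partial>P) = (\<Sum>i\<in>D. \<integral>\<^sup>+\<omega>. marked_count G (stream i \<omega>) \<partial>P)"
    unfolding count_def using G measurable_compose[OF measurable_stream measurable_marked_count_Ln]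
    by (intro nn_integral_sum) auto
  also have "\<dots> = (\<Sum>i\<in>D. ennreal (lam i) * (\<integral>\<^sup>+u. indicator {0..} u * emeasure (\<kappa> i) (Pair u -` G) \<partial>lborel))"
  proof (rule sum.cong)
    fix i assume i: "i \<in> D"
    show "(\<integral>\<^sup>+\<omega>. marked_count G (stream i \<omega>) \<partial>P) =
      ennreal (lam i) * (\<integral>\<^sup>+u. indicator {0..} u * emeasure (\<kappa> i) (Pair u -` G) \<partial>lborel)"
      using nn_integral_stream[OF i measurable_marked_count_Ln[OF i G[OF i]]]
        marked_poisson.nn_integral_marked_count[OF marked_poisson[OF i] G[OF i]]
      by (simp add: L_eq_Ln[OF i])
  qed simp
  finally show ?thesis .
qed

text \<open>Off the diagonal the product of two counts has mean \<open>\<mu> i * \<mu> j\<close> by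
  independence, and on it the bound for one stream adds only \<open>\<mu> i\<close>. The excess over
  \<open>m\<^sup>2\<close> therefore sums to \<open>m\<close>, however many streams there
  are.\<close>

lemma nn_integral_count_square_le:
  assumes G: "\<And>i. i \<in> D \<Longrightarrow> G \<in> sets (borel \<Otimes>\<^sub>M \<kappa> i)"
  defines "m \<equiv> \<integral>\<^sup>+\<omega>. count G \<omega> \<partial>P"
  shows "(\<integral>\<^sup>+\<omega>. (count G \<omega>)\<^sup>2 \<partial>P) \<le> m + m\<^sup>2"
proof -
  let ?Z = "\<lambda>i \<omega>. marked_count G (stream i \<omega>)"
  define \<mu> where "\<mu> i = (\<integral>\<^sup>+\<omega>. ?Z i \<omega> \<partial>P)" for i
  have Z: "?Z i \<in> borel_measurable P" if "i \<in> D" for i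
    using that G measurable_compose[OF measurable_stream measurable_marked_count_Ln] by auto
  have m: "m = (\<Sum>i\<in>D. \<mu> i)"
    unfolding m_def count_def \<mu>_def using Z by (intro nn_integral_sum) auto
  have ind: "indep_vars (\<lambda>_. borel) ?Z D"
    using G by (intro indep_streams measurable_marked_count_Ln) auto
  have le: "(\<integral>\<^sup>+\<omega>. ?Z i \<omega> * ?Z j \<omega> \<partial>P) \<le> \<mu> i * \<mu> j + (if i = j then \<mu> i else 0)"
    if ij: "i \<in> D" "j \<in> D" for i j
  proof (cases "i = j")
    case True
    have "(\<integral>\<^sup>+\<omega>. (?Z i \<omega>)\<^sup>2 \<partial>P) = (\<integral>\<^sup>+z. (marked_count G z)\<^sup>2 \<partial>PiM UNIV (\<lambda>_. Ln i))"
      using nn_integral_stream[OF ij(1), of "\<lambda>z. (marked_count G z)\<^sup>2"] measurable_marked_count_Ln[OF ij(1) G[OF ij(1)]] by simp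
    moreover have "\<mu> i = (\<integral>\<^sup>+z. marked_count G z \<partial>PiM UNIV (\<lambda>_. Ln i))"
      unfolding \<mu>_def using nn_integral_stream[OF ij(1)] measurable_marked_count_Ln[OF ij(1) G[OF ij(1)]] by simp
    ultimately have "(\<integral>\<^sup>+\<omega>. (?Z i \<omega>)\<^sup>2 \<partial>P) \<le> \<mu> i + (\<mu> i)\<^sup>2"
      using marked_poisson.nn_integral_marked_count_square_le[OF marked_poisson[OF ij(1)] G[OF ij(1)]]
      by (simp add: L_eq_Ln[OF ij(1)])
    then show ?thesis using True by (simp add: power2_eq_square add.commute)
  next
    case False
    have "indep_vars (\<lambda>_. borel) ?Z {i, j}"
      using ind by (rule indep_vars_subset) (use ij in auto)
    then have "(\<integral>\<^sup>+\<omega>. (\<Prod>k\<in>{i, j}. ?Z k \<omega>) \<partial>P) = (\<Prod>k\<in>{i, j}. \<integral>\<^sup>+\<omega>. ?Z k \<omega> \<partial>P)"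
      by (intro indep_vars_nn_integral) auto
    then show ?thesis using False by (simp add: \<mu>_def)
  qed
  have "(\<integral>\<^sup>+\<omega>. (count G \<omega>)\<^sup>2 \<partial>P) = (\<Sum>i\<in>D. \<Sum>j\<in>D. \<integral>\<^sup>+\<omega>. ?Z i \<omega> * ?Z j \<omega> \<partial>P)"
    unfolding count_def power2_eq_square sum_product using Z by (simp add: nn_integral_sum)
  also have "\<dots> \<le> (\<Sum>i\<in>D. \<Sum>j\<in>D. \<mu> i * \<mu> j + (if i = j then \<mu> i else 0))"
    using le by (intro sum_mono) auto
  also have "\<dots> = m\<^sup>2 + m"
    using finite_D by (simp add: m sum.distrib power2_eq_square sum_product sum.delta')
  finally show ?thesis by (simp add: add.commute)
qed

section \<open>Almost sure regularity of the arrival epochs\<close>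

lemma AE_gaps_pos: "AE \<omega> in P. \<forall>a\<in>D \<times> UNIV. 0 < fst (Y a \<omega>)"
proof -
  have "AE \<omega> in P. 0 < fst (Y (i, n) \<omega>)" if i: "i \<in> D" for i n
  proof -
    interpret mp: marked_poisson "\<kappa> i" "lam i" by (rule marked_poisson[OF i])
    have [measurable]: "{y \<in> space (Ln i). 0 < fst y} \<in> sets (Ln i)"
      unfolding sets_Ln by (simp add: sets_eq_imp_space_eq[OF sets_Ln])
    have "AE y in Ln i. 0 < fst y"
    proof -
      have "emeasure (Ln i) {y \<in> space (Ln i). \<not> 0 < fst y} = 0"
      proof -
        have "emeasure (Ln i) {y \<in> space (Ln i). \<not> 0 < fst y} = (\<integral>\<^sup>+y. (if 0 < fst y then 0 else 1) \<partial>Ln i)"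
        proof -
          have "{y \<in> space (Ln i). \<not> 0 < fst y} \<in> sets (Ln i)"
            unfolding sets_Ln sets_eq_imp_space_eq[OF sets_Ln] by measurable
          then have "emeasure (Ln i) {y \<in> space (Ln i). \<not> 0 < fst y} = (\<integral>\<^sup>+y. indicator {y \<in> space (Ln i). \<not> 0 < fst y} y \<partial>Ln i)"
            by simp
          also have "\<dots> = (\<integral>\<^sup>+y. (if 0 < fst y then 0 else 1) \<partial>Ln i)"
            by (intro nn_integral_cong) auto
          finally show ?thesis .
        qed
        also have "\<dots> = (\<integral>\<^sup>+a. ennreal (exponential_density (lam i) a) * (\<integral>\<^sup>+k. (if 0 < a then 0 else 1) \<partial>\<kappa> i) \<partial>lborel)"
          using mp.nn_integral_L[of "\<lambda>y. if 0 < fst y then 0 else 1"] by (simp add: L_eq_Ln[OF i])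
        \<comment> \<open>The density vanishes for negative \<open>a\<close>, and the remaining
          exceptional point 0 is null.\<close>
        also have "\<dots> = (\<integral>\<^sup>+(a::real). 0 \<partial>lborel)"
          using AE_lborel_singleton[of 0]
          by (intro nn_integral_cong_AE) (auto simp: exponential_density_def elim!: eventually_mono)
        finally show ?thesis by simp
      qed
      then show ?thesis by (subst AE_iff_measurable[OF _ refl]) (auto simp: sets_Ln sets_eq_imp_space_eq[OF sets_Ln])
    qed
    moreover have "distr P (Ln i) (Y (i, n)) = Ln i"
      using distr_Y[of "(i, n)"] i unfolding Ln_def by simp
    ultimately have "AE y in distr P (Ln i) (Y (i, n)). 0 < fst y"
      by metis
    then show ?thesis
      using measurable_Y[of "(i, n)"] i by (subst (asm) AE_distr_iff) auto
  qed
  then have "AE \<omega> in P. \<forall>i\<in>D. \<forall>n. 0 < fst (Y (i, n) \<omega>)"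
    using finite_D by (subst AE_ball_countable) (auto simp: countable_finite AE_all_countable)
  then show ?thesis by eventually_elim auto
qed

text \<open>Epochs of different streams are independent and have no atoms, being Erlang distributed;
  by Fubini the diagonal is null for their joint law.\<close>

lemma AE_epoch_neq:
  assumes i: "i \<in> D" and j: "j \<in> D" and ij: "i \<noteq> j"
  shows "AE \<omega> in P. epoch (stream i \<omega>) n \<noteq> epoch (stream j \<omega>) n'"
proof -
  let ?A = "\<lambda>\<omega>. epoch (stream i \<omega>) n" and ?B = "\<lambda>\<omega>. epoch (stream j \<omega>) n'"
  have meas: "(\<lambda>z. epoch z n) \<in> borel_measurable (PiM UNIV (\<lambda>_. Ln i))" if "i \<in> D" for i n
    using marked_poisson.measurable_epoch[OF marked_poisson[OF that]] L_eq_Ln[OF that] by simp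
  have [measurable]: "?A \<in> borel_measurable P" "?B \<in> borel_measurable P"
    using measurable_compose[OF measurable_stream meas] i j by auto
  \<comment> \<open>The case distinction puts the epochs \<open>n\<close> and \<open>n'\<close> of
    the two streams into one independent family.\<close>
  have "indep_vars (\<lambda>_. borel) (\<lambda>k \<omega>. epoch (stream k \<omega>) (if k = i then n else n')) D"
    using meas by (intro indep_streams) auto
  then have "indep_vars (\<lambda>_. borel) (\<lambda>k \<omega>. epoch (stream k \<omega>) (if k = i then n else n')) {i, j}"
    by (rule indep_vars_subset) (use i j in auto)
  \<comment> \<open>A sum over the singleton \<open>{j}\<close> serves to pass from a family to a
    pair of variables.\<close>
  then have "indep_var borel ?A borel ?B"
    using indep_vars_sum[of "{j}" i "\<lambda>k \<omega>. epoch (stream k \<omega>) (if k = i then n else n')"] ij by simp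
  then have prod: "distr P borel ?A \<Otimes>\<^sub>M distr P borel ?B = distr P (borel \<Otimes>\<^sub>M borel) (\<lambda>\<omega>. (?A \<omega>, ?B \<omega>))"
    by (simp add: indep_var_distribution_eq)
  interpret A: prob_space "distr P borel ?A" by (rule prob_space_distr) simp
  interpret B: prob_space "distr P borel ?B" by (rule prob_space_distr) simp
  interpret AB: pair_prob_space "distr P borel ?A" "distr P borel ?B" ..
  have null: "emeasure (distr P borel ?B) {x} = 0" for x
  proof -
    interpret mp: marked_poisson "\<kappa> j" "lam j" by (rule marked_poisson[OF j])
    have "emeasure (distr P borel ?B) {x} = (\<integral>\<^sup>+\<omega>. indicator {x} (?B \<omega>) \<partial>P)"
      using nn_integral_distr[of ?B P borel "indicator {x}"] by simp
    also have "\<dots> = (\<integral>\<^sup>+z. indicator {x} (epoch z n') \<partial>PiM UNIV (\<lambda>_. Ln j))"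
      using nn_integral_stream[OF j, of "\<lambda>z. indicator {x} (epoch z n')"]
        measurable_compose[OF meas[OF j], of "indicator {x}" borel n'] by simp
    also have "\<dots> = (\<integral>\<^sup>+u. ennreal (erlang_density n' (lam j) u) * (\<integral>\<^sup>+k. indicator {x} u \<partial>\<kappa> j) \<partial>lborel)"
      using mp.nn_integral_epoch[of "\<lambda>y. indicator {x} (fst y)" 0 n'] by (simp add: L_eq_Ln[OF j])
    also have "\<dots> = (\<integral>\<^sup>+(u::real). 0 \<partial>lborel)"
      using AE_lborel_singleton[of x] by (intro nn_integral_cong_AE) (auto elim!: eventually_mono)
    finally show ?thesis by simp
  qed
  have "AE y in distr P borel ?A \<Otimes>\<^sub>M distr P borel ?B. fst y \<noteq> snd y"
  proof (rule AB.AE_pair_measure)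
    show "{x \<in> space (distr P borel ?A \<Otimes>\<^sub>M distr P borel ?B). fst x \<noteq> snd x} \<in> sets (distr P borel ?A \<Otimes>\<^sub>M distr P borel ?B)"
      by measurable
    show "AE x in distr P borel ?A. AE y in distr P borel ?B. fst (x, y) \<noteq> snd (x, y)"
      using null by (intro AE_I2 AE_I[where N="{_}"]) auto
  qed
  then have "AE \<omega> in P. (\<lambda>y. fst y \<noteq> snd y) (?A \<omega>, ?B \<omega>)"
    unfolding prod by (subst (asm) AE_distr_iff) auto
  then show ?thesis by simp
qed

definition \<tau> :: "'a \<Rightarrow> 'i \<times> nat \<Rightarrow> real" where
  "\<tau> \<omega> a = epoch (stream (fst a) \<omega>) (snd a)"

text \<open>Within a stream epochs increase strictly since gaps are positive. Ties matter because
  \<open>jiq_path\<close> only takes account of strictly earlier arrivals: two simultaneous tasks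
  could be sent to the same idle server.\<close>

lemma AE_inj_epochs: "AE \<omega> in P. inj_on (\<tau> \<omega>) (D \<times> UNIV)"
proof -
  have "AE \<omega> in P. \<forall>i\<in>D. \<forall>j\<in>D. \<forall>n n'. i \<noteq> j \<longrightarrow> epoch (stream i \<omega>) n \<noteq> epoch (stream j \<omega>) n'"
    using AE_epoch_neq finite_D by (auto simp: AE_ball_countable AE_all_countable countable_finite)
  with AE_gaps_pos show ?thesis
  proof eventually_elim
    case (elim \<omega>)
    have mono: "epoch (stream i \<omega>) n < epoch (stream i \<omega>) n'" if "i \<in> D" "n < n'" for i n n'
    proof (rule lift_Suc_mono_less[OF _ \<open>n < n'\<close>])
      show "epoch (stream i \<omega>) k < epoch (stream i \<omega>) (Suc k)" for k
        using elim(1) \<open>i \<in> D\<close> by (simp add: epoch_def stream_def)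
    qed
    show ?case
    proof (rule inj_onI)
      fix a b assume ab: "a \<in> D \<times> UNIV" "b \<in> D \<times> UNIV" "\<tau> \<omega> a = \<tau> \<omega> b"
      then have f: "fst a = fst b" using elim(2) unfolding \<tau>_def by (metis mem_Sigma_iff prod.collapse)
      moreover have "snd a = snd b"
        using mono[of "fst a" "snd a" "snd b"] mono[of "fst a" "snd b" "snd a"] ab f
        by (cases "snd a" "snd b" rule: linorder_cases) (auto simp: \<tau>_def)
      ultimately show "a = b" by (rule prod_eqI)
    qed
  qed
qed

lemma count_eq_card:
  assumes "finite {a \<in> D \<times> UNIV. (\<tau> \<omega> a, snd (Y a \<omega>)) \<in> G}"
  shows "count G \<omega> = of_nat (card {a \<in> D \<times> UNIV. (\<tau> \<omega> a, snd (Y a \<omega>)) \<in> G})"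
proof -
  let ?N = "\<lambda>i. {n. (epoch (stream i \<omega>) n, snd (stream i \<omega> n)) \<in> G}"
  have eq: "{a \<in> D \<times> UNIV. (\<tau> \<omega> a, snd (Y a \<omega>)) \<in> G} = (SIGMA i:D. ?N i)"
    by (auto simp: \<tau>_def stream_def)
  have fin: "finite (?N i)" if "i \<in> D" for i
  proof (rule inj_on_finite)
    show "inj_on (Pair i) (?N i)" by (auto simp: inj_on_def)
    show "Pair i ` ?N i \<subseteq> (SIGMA i:D. ?N i)" using that by auto
    show "finite (SIGMA i:D. ?N i)" using assms eq by simp
  qed
  have "count G \<omega> = (\<Sum>i\<in>D. of_nat (card (?N i)))"
    unfolding count_def marked_count_eq_emeasure using fin by (intro sum.cong) auto
  then show ?thesis
    unfolding eq using fin finite_D by (simp add: card_SigmaI)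
qed

text \<open>The mean number of epochs up to \<open>k\<close> is at most \<open>lam i\<close> times
  \<open>k\<close>, by the mean formula for a strip that puts no condition on the marks. Integer
  levels suffice by monotonicity, which leaves countably many null sets.\<close>

lemma AE_locally_finite: "AE \<omega> in P. \<forall>t. finite {a \<in> D \<times> UNIV. \<tau> \<omega> a \<le> t}"
proof -
  have "AE \<omega> in P. finite {a \<in> D \<times> UNIV. \<tau> \<omega> a \<le> real k}" for k
  proof -
    have "AE \<omega> in P. finite {n. epoch (stream i \<omega>) n \<le> real k}" if i: "i \<in> D" for i
    proof -
      interpret mp: marked_poisson "\<kappa> i" "lam i" by (rule marked_poisson[OF i])
      let ?G = "{..real k} \<times> space (\<kappa> i)"
      have G: "?G \<in> sets (borel \<Otimes>\<^sub>M \<kappa> i)" by auto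
      have "(\<integral>\<^sup>+u. indicator {0..} u * emeasure (\<kappa> i) (Pair u -` ?G) \<partial>lborel) \<le> (\<integral>\<^sup>+u. indicator {0..real k} u \<partial>lborel)"
        by (intro nn_integral_mono) (auto simp: indicator_def mp.K.emeasure_space_1)
      also have "\<dots> < \<infinity>" by simp
      finally have "(\<integral>\<^sup>+\<omega>. marked_count ?G (stream i \<omega>) \<partial>P) < \<infinity>"
        using nn_integral_stream[OF i measurable_marked_count_Ln[OF i G]] mp.nn_integral_marked_count[OF G]
        by (simp add: L_eq_Ln[OF i] ennreal_mult_less_top)
      then have "AE \<omega> in P. marked_count ?G (stream i \<omega>) \<noteq> \<infinity>"
        using measurable_compose[OF measurable_stream[OF i] measurable_marked_count_Ln[OF i G]]
        by (intro nn_integral_noteq_infinite) auto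
      moreover have "AE \<omega> in P. stream i \<omega> \<in> space (PiM UNIV (\<lambda>_. Ln i))"
        using measurable_space[OF measurable_stream[OF i]] by auto
      ultimately show ?thesis
      proof eventually_elim
        case (elim \<omega>)
        have "snd (stream i \<omega> n) \<in> space (\<kappa> i)" for n
          using elim(2) by (auto simp: space_PiM sets_eq_imp_space_eq[OF sets_Ln] space_pair_measure PiE_iff mem_Times_iff)
        then have "{n. (epoch (stream i \<omega>) n, snd (stream i \<omega> n)) \<in> ?G} = {n. epoch (stream i \<omega>) n \<le> real k}"
          by auto
        then show ?case
          using elim(1) unfolding marked_count_eq_emeasure by (metis emeasure_count_space_infinite UNIV_I subsetI)
      qed
    qed
    then have "AE \<omega> in P. \<forall>i\<in>D. finite {n. epoch (stream i \<omega>) n \<le> real k}"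
      using finite_D by (auto simp: AE_ball_countable countable_finite)
    then show ?thesis
    proof eventually_elim
      case (elim \<omega>)
      have "{a \<in> D \<times> UNIV. \<tau> \<omega> a \<le> real k} = (SIGMA i:D. {n. epoch (stream i \<omega>) n \<le> real k})"
        by (auto simp: \<tau>_def)
      then show ?case using elim finite_D by auto
    qed
  qed
  then have "AE \<omega> in P. \<forall>k. finite {a \<in> D \<times> UNIV. \<tau> \<omega> a \<le> real k}"
    by (simp add: AE_all_countable)
  then show ?thesis
  proof eventually_elim
    case (elim \<omega>)
    show ?case
    proof
      fix t
      obtain k :: nat where "t \<le> real k" using real_arch_simple by blast
      then show "finite {a \<in> D \<times> UNIV. \<tau> \<omega> a \<le> t}"
        using elim by (intro finite_subset[OF _ elim[rule_format, of k]]) auto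
    qed
  qed
qed

end

section \<open>Weak convergence and the fluid equation\<close>

text \<open>For arrivals at unit rate and exponential service times of mean \<open>r\<close> without
  waiting, this is the mean number of departures by time \<open>t\<close>: the integral of
  \<open>1 - exp (- (t - x) / r)\<close> over \<open>x\<close> in \<open>[0, t]\<close>. At
  \<open>r = 0\<close> the factor \<open>r\<close> cancels the second term, leaving
  \<open>t\<close>, the mean number of arrivals.\<close>

definition departure_mean :: "real \<Rightarrow> real \<Rightarrow> real" where
  "departure_mean r t = t - r * (1 - exp (- t / r))"

text \<open>For positive \<open>r\<close> the derivative \<open>1 - exp (- t / r)\<close> lies
  between 0 and 1. The argument uses \<open>exp x \<ge> 1 + x\<close> instead of calculus and
  includes \<open>r = 0\<close>.\<close>

lemma departure_mean_bounds:
  assumes "0 \<le> r" "0 \<le> s" "s \<le> t"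
  shows "departure_mean r s \<le> departure_mean r t" "departure_mean r t - departure_mean r s \<le> t - s"
proof -
  have le: "r * (exp (- s / r) - exp (- t / r)) \<le> (t - s) * exp (- s / r)"
  proof (cases "r = 0")
    case False
    have "exp (- t / r) = exp (- s / r) * exp (- ((t - s) / r))"
      by (simp add: exp_add[symmetric] diff_divide_distrib)
    moreover have "1 - (t - s) / r \<le> exp (- ((t - s) / r))"
      using exp_ge_add_one_self[of "- ((t - s) / r)"] by simp
    ultimately have "exp (- s / r) - exp (- t / r) \<le> exp (- s / r) * ((t - s) / r)"
      using mult_left_mono[of "1 - (t - s) / r" "exp (- ((t - s) / r))" "exp (- s / r)"]
      by (simp add: algebra_simps)
    then have "r * (exp (- s / r) - exp (- t / r)) \<le> r * (exp (- s / r) * ((t - s) / r))"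
      using assms by (intro mult_left_mono) auto
    then show ?thesis using False by (simp add: mult.commute)
  qed (use assms in simp)
  have "exp (- s / r) \<le> 1" using assms by simp
  then have "(t - s) * exp (- s / r) \<le> t - s" using assms by (simp add: mult_left_le)
  then show "departure_mean r s \<le> departure_mean r t"
    using le by (simp add: departure_mean_def algebra_simps)
  have "exp (- t / r) \<le> exp (- s / r)" using assms by (simp add: divide_right_mono)
  then have "0 \<le> r * (exp (- s / r) - exp (- t / r))" using assms by simp
  then show "departure_mean r t - departure_mean r s \<le> t - s"
    by (simp add: departure_mean_def algebra_simps)
qed

text \<open>A monotone \<open>F\<close> is caught between its values at the two neighbouring grid
  points, where it is \<open>\<delta>\<close>-close to \<open>f\<close>; the rest is the growth of
  \<open>f\<close> over one cell of length \<open>T / n\<close>. \<open>F\<close> may have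
  jumps.\<close>

lemma uniform_approx_of_grid:
  fixes F f :: "real \<Rightarrow> real"
  assumes F: "\<And>s t. 0 \<le> s \<Longrightarrow> s \<le> t \<Longrightarrow> F s \<le> F t"
    and f: "\<And>s t. 0 \<le> s \<Longrightarrow> s \<le> t \<Longrightarrow> f s \<le> f t" "\<And>s t. 0 \<le> s \<Longrightarrow> s \<le> t \<Longrightarrow> f t - f s \<le> B * (t - s)"
    and "0 < n" "0 \<le> B"
    and grid: "\<And>l. l \<le> n \<Longrightarrow> \<bar>F (T * real l / real n) - f (T * real l / real n)\<bar> \<le> \<delta>"
    and t: "0 \<le> t" "t \<le> T"
  shows "\<bar>F t - f t\<bar> \<le> \<delta> + B * T / real n"
\<comment> \<open>At the right end there is no cell to the right of the grid point. This case also
  covers \<open>T = 0\<close>, so that \<open>T\<close> may be divided by below.\<close>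
proof (cases "t = T")
  case True
  moreover have "0 \<le> B * T / real n" using assms by simp
  ultimately show ?thesis using grid[of n] \<open>0 < n\<close> by simp
next
  case False
  then have "0 < T" "t < T" using t by auto
  define l where "l = nat \<lfloor>t * n / T\<rfloor>"
  have l1: "real l \<le> t * n / T" unfolding l_def using t \<open>0 < T\<close> by (simp add: of_nat_nat)
  have l2: "t * n / T < real l + 1" unfolding l_def using t \<open>0 < T\<close> by (simp add: of_nat_nat)
  have "t * n / T < n" using \<open>t < T\<close> \<open>0 < T\<close> \<open>0 < n\<close> by (simp add: field_simps)
  then have "l < n" using l1 by simp
  define a b where "a = T * real l / real n" and "b = T * real (Suc l) / real n"
  have ab: "0 \<le> a" "a \<le> t" "t \<le> b" "b - a = T / real n"
    using l1 l2 \<open>0 < T\<close> \<open>0 < n\<close> by (auto simp: a_def b_def field_simps)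
  have ga: "\<bar>F a - f a\<bar> \<le> \<delta>" and gb: "\<bar>F b - f b\<bar> \<le> \<delta>"
    using grid[of l] grid[of "Suc l"] \<open>l < n\<close> by (auto simp: a_def b_def)
  have "f b - f a \<le> B * T / real n" using f(2)[of a b] ab by simp
  then show ?thesis
    using F[of a t] F[of t b] f(1)[of a t] f(1)[of t b] ab(1-3) ga gb t(1) unfolding abs_le_iff by linarith
qed

lemma linear_ode_unique:
  fixes x y :: "real \<Rightarrow> real"
  assumes x: "\<And>t. t \<in> {0..T} \<Longrightarrow> (x has_real_derivative l - \<nu> * x t) (at t within {0..T})"
    and y: "\<And>t. t \<in> {0..T} \<Longrightarrow> (y has_real_derivative l - \<nu> * y t) (at t within {0..T})"
    and "x 0 = y 0" and t: "t \<in> {0..T}"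
  shows "x t = y t"
proof -
  \<comment> \<open>Multiplying the difference of the solutions by the integrating factor
    \<open>exp (\<nu> * t)\<close> makes it constant.\<close>
  have "\<exists>c. \<forall>t\<in>{0..T}. exp (\<nu> * t) * (x t - y t) = c"
  proof (rule has_field_derivative_zero_constant)
    fix t assume t: "t \<in> {0..T}"
    show "((\<lambda>t. exp (\<nu> * t) * (x t - y t)) has_real_derivative 0) (at t within {0..T})"
      by (rule derivative_eq_intros x[OF t] y[OF t] refl)+ (simp add: algebra_simps)
  qed simp
  moreover have T0: "0 \<in> {0..T}" using t by auto
  ultimately have "exp (\<nu> * t) * (x t - y t) = exp (\<nu> * 0) * (x 0 - y 0)" using t T0 by metis
  then show ?thesis using assms(3) by simp
qed

lemma fluid_solution_explicit:
  assumes "\<And>m k. m \<in> {1..M} \<Longrightarrow> k \<in> {1..K} \<Longrightarrow> \<nu> k = 0 \<Longrightarrow> lp m k = 0"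
  shows "fluid_solution T M K lp \<nu> (\<lambda>m k t. lp m k / \<nu> k * (1 - exp (- \<nu> k * t)))"
  unfolding fluid_solution_def
proof (intro ballI conjI)
  fix m k t assume mk: "m \<in> {1..M}" "k \<in> {1..K}"
  show "((\<lambda>t. lp m k / \<nu> k * (1 - exp (- \<nu> k * t))) has_real_derivative
      lp m k - \<nu> k * (lp m k / \<nu> k * (1 - exp (- \<nu> k * t)))) (at t within {0..T})"
  \<comment> \<open>With \<open>\<nu> k = 0\<close> the quotient is 0 by convention, so the function
    is constantly 0; that solves the equation because there is then no inflow.\<close>
  proof (cases "\<nu> k = 0")
    case True
    then show ?thesis using assms mk by simp
  next
    case False
    have "((\<lambda>t. lp m k / \<nu> k * (1 - exp (- \<nu> k * t))) has_real_derivative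
        lp m k / \<nu> k * (\<nu> k * exp (- \<nu> k * t))) (at t within {0..T})"
      by (auto intro!: derivative_eq_intros)
    moreover have "lp m k / \<nu> k * (\<nu> k * exp (- \<nu> k * t)) =
        lp m k - \<nu> k * (lp m k / \<nu> k * (1 - exp (- \<nu> k * t)))"
      using False by (simp add: algebra_simps)
    ultimately show ?thesis by simp
  qed
qed simp

lemma fluid_solution_unique:
  assumes "fluid_solution T M K lp \<nu> x" "fluid_solution T M K lp \<nu> y"
    and "m \<in> {1..M}" "k \<in> {1..K}" "t \<in> {0..T}"
  shows "x m k t = y m k t"
proof (rule linear_ode_unique[OF _ _ _ assms(5)])
  show "(x m k has_real_derivative lp m k - \<nu> k * x m k t) (at t within {0..T})" if "t \<in> {0..T}" for t
    using assms(1,3,4) that unfolding fluid_solution_def by blast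
  show "(y m k has_real_derivative lp m k - \<nu> k * y m k t) (at t within {0..T})" if "t \<in> {0..T}" for t
    using assms(2-4) that unfolding fluid_solution_def by blast
  show "x m k 0 = y m k 0"
    using assms(1-4) unfolding fluid_solution_def by metis
qed

text \<open>The limit is a single path, so continuity of \<open>F\<close> at \<open>x\<close> is all
  that matters. On \<open>G\<close> the values are near \<open>F x\<close>, and off \<open>G\<close>
  they differ from it by at most twice the bound of \<open>F\<close>. Both bounds are step functions
  of the measurable \<open>G\<close>, so the composition of \<open>F\<close> with the process need
  not be measurable.\<close>

lemma weakly_converges_unifI:
  fixes P :: "nat \<Rightarrow> 'a measure" and X :: "nat \<Rightarrow> 'a \<Rightarrow> path"
  assumes T: "0 \<le> T"
    and P: "\<And>N. 1 \<le> N \<Longrightarrow> prob_space (P N)"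
    and X: "\<And>N \<omega>. 1 \<le> N \<Longrightarrow> X N \<omega> \<in> bounded_paths T M K"
    and x: "x \<in> bounded_paths T M K"
    and good: "\<And>\<epsilon> \<eta>. 0 < \<epsilon> \<Longrightarrow> 0 < \<eta> \<Longrightarrow>
      eventually (\<lambda>N. \<exists>G\<in>sets (P N). 1 - \<eta> \<le> measure (P N) G \<and> (\<forall>\<omega>\<in>G. unif_dist T M K x (X N \<omega>) < \<epsilon>)) sequentially"
  shows "weakly_converges_unif T M K P X x"
  unfolding weakly_converges_unif_def
proof (intro allI impI, elim conjE)
  fix F assume bF: "bounded (F ` bounded_paths T M K)" and cF: "unif_continuous_functional T M K F"
  obtain C where C: "0 < C" "\<And>y. y \<in> bounded_paths T M K \<Longrightarrow> \<bar>F y\<bar> \<le> C"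
    using bF by (auto simp: bounded_pos)
  show "(\<lambda>N. outer_expectation (P N) (\<lambda>\<omega>. F (X N \<omega>))) \<longlonglongrightarrow> F x"
  proof (rule LIMSEQ_I)
    fix r :: real assume "0 < r"
    define \<epsilon> where "\<epsilon> = r / 3"
    have "0 < \<epsilon>" using \<open>0 < r\<close> by (simp add: \<epsilon>_def)
    obtain \<delta> where \<delta>: "0 < \<delta>" "\<And>y. y \<in> bounded_paths T M K \<Longrightarrow> unif_dist T M K x y < \<delta> \<Longrightarrow> \<bar>F x - F y\<bar> < \<epsilon>"
      using cF x \<open>0 < \<epsilon>\<close> unfolding unif_continuous_functional_def by metis
    \<comment> \<open>With this probability the exceptional event adds at most
      \<open>\<epsilon>\<close>, so the total error is at most \<open>2 * \<epsilon>\<close>, below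
      \<open>r = 3 * \<epsilon>\<close>.\<close>
    define \<eta> where "\<eta> = \<epsilon> / (2 * C)"
    have "0 < \<eta>" using \<open>0 < \<epsilon>\<close> C by (simp add: \<eta>_def)
    have "eventually (\<lambda>N. norm (outer_expectation (P N) (\<lambda>\<omega>. F (X N \<omega>)) - F x) < r) sequentially"
      using good[OF \<delta>(1) \<open>0 < \<eta>\<close>] eventually_ge_at_top[of 1]
    proof eventually_elim
      case (elim N)
      interpret PN: prob_space "P N" using P elim(2) .
      obtain G where G: "G \<in> sets (P N)" "1 - \<eta> \<le> PN.prob G" "\<And>\<omega>. \<omega> \<in> G \<Longrightarrow> unif_dist T M K x (X N \<omega>) < \<delta>"
        using elim(1) by blast
      have FG: "\<bar>F x - F (X N \<omega>)\<bar> < \<epsilon>" if "\<omega> \<in> G" for \<omega>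
        using \<delta>(2)[OF X[OF elim(2)] G(3)[OF that]] .
      have FC: "\<bar>F (X N \<omega>)\<bar> \<le> C" for \<omega> using C(2)[OF X[OF elim(2)]] .
      have Fx: "\<bar>F x\<bar> \<le> C" using C(2)[OF x] .
      define B where "B = space (P N) - G"
      have [measurable]: "G \<in> sets (P N)" "B \<in> sets (P N)" using G by (auto simp: B_def)
      have near: "\<bar>F x - F (X N \<omega>)\<bar> \<le> \<epsilon> + 2 * C * indicator B \<omega>" if "\<omega> \<in> space (P N)" for \<omega>
      proof (cases "\<omega> \<in> G")
        case True
        then have "2 * C * indicator B \<omega> = 0" by (simp add: B_def)
        then show ?thesis using FG[OF True] by linarith
      next
        case False
        then have "2 * C * indicator B \<omega> = 2 * C" using that by (simp add: B_def)
        then show ?thesis using FC[of \<omega>] Fx \<open>0 < \<epsilon>\<close> by linarith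
      qed
      have pB: "PN.prob B \<le> \<eta>" using G by (simp add: B_def PN.prob_compl)
      have CB: "2 * C * PN.prob B \<le> \<epsilon>"
        using mult_left_mono[OF pB, of "2 * C"] C by (simp add: \<eta>_def)
      let ?S = "{integral\<^sup>L (P N) Z | Z. integrable (P N) Z \<and> (\<forall>\<omega>\<in>space (P N). F (X N \<omega>) \<le> Z \<omega>)}"
      have int: "integral\<^sup>L (P N) (\<lambda>\<omega>. a + b * indicator B \<omega>) = a + b * PN.prob B"
        "integrable (P N) (\<lambda>\<omega>. a + b * indicator B \<omega> :: real)" for a b :: real
      proof -
        have i: "integrable (P N) (\<lambda>\<omega>. b * indicator B \<omega> :: real)"
          by (intro integrable_mult_right integrable_real_indicator) (auto simp: PN.emeasure_eq_measure)
        show "integral\<^sup>L (P N) (\<lambda>\<omega>. a + b * indicator B \<omega>) = a + b * PN.prob B"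
          by (subst Bochner_Integration.integral_add[OF _ i]) (auto simp: PN.prob_space)
        show "integrable (P N) (\<lambda>\<omega>. a + b * indicator B \<omega> :: real)"
          by (intro Bochner_Integration.integrable_add i) simp
      qed
      \<comment> \<open>The membership \<open>ub\<close> makes \<open>?S\<close> nonempty and
        \<open>lb\<close> bounds it below; both are needed for \<open>Inf\<close> on the reals to be
        a true infimum.\<close>
      have ub: "F x + \<epsilon> + 2 * C * PN.prob B \<in> ?S"
      proof (intro CollectI exI conjI ballI)
        show "F x + \<epsilon> + 2 * C * PN.prob B = integral\<^sup>L (P N) (\<lambda>\<omega>. (F x + \<epsilon>) + 2 * C * indicator B \<omega>)"
          by (simp add: int)
        show "integrable (P N) (\<lambda>\<omega>. (F x + \<epsilon>) + 2 * C * indicator B \<omega>)" by (rule int)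
        fix \<omega> assume "\<omega> \<in> space (P N)"
        then show "F (X N \<omega>) \<le> F x + \<epsilon> + 2 * C * indicator B \<omega>"
          using near[of \<omega>] by linarith
      qed
      have lb: "F x - \<epsilon> - 2 * C * PN.prob B \<le> z" if z: "z \<in> ?S" for z
      proof -
        obtain Z where Z: "z = integral\<^sup>L (P N) Z" "integrable (P N) Z" "\<forall>\<omega>\<in>space (P N). F (X N \<omega>) \<le> Z \<omega>"
          using z by blast
        have "integral\<^sup>L (P N) (\<lambda>\<omega>. (F x - \<epsilon>) + (- 2 * C) * indicator B \<omega>) \<le> integral\<^sup>L (P N) Z"
        proof (rule integral_mono[OF int(2) Z(2)])
          fix \<omega> assume \<omega>: "\<omega> \<in> space (P N)"
          have "F (X N \<omega>) \<le> Z \<omega>" using Z(3) \<omega> by blast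
          then show "(F x - \<epsilon>) + (- 2 * C) * indicator B \<omega> \<le> Z \<omega>"
            using near[OF \<omega>] by linarith
        qed
        then show ?thesis unfolding int Z(1) by simp
      qed
      have "Inf ?S \<le> F x + \<epsilon> + 2 * C * PN.prob B"
        by (rule cInf_lower[OF ub bdd_belowI[OF lb]])
      moreover have "F x - \<epsilon> - 2 * C * PN.prob B \<le> Inf ?S"
      proof (rule cInf_greatest[OF _ lb])
        show "?S \<noteq> {}" using ub by (metis empty_iff)
      qed
      ultimately have "\<bar>Inf ?S - F x\<bar> \<le> 2 * \<epsilon>" using CB by linarith
      moreover have "2 * \<epsilon> < r" using \<open>0 < r\<close> by (simp add: \<epsilon>_def)
      ultimately show ?case by (simp add: outer_expectation_def)
    qed
    then show "\<exists>no. \<forall>n\<ge>no. norm (outer_expectation (P n) (\<lambda>\<omega>. F (X n \<omega>)) - F x) < r"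
      by (simp add: eventually_sequentially)
  qed
qed

section \<open>The marks of the tasks\<close>

definition mark_law :: "nat \<Rightarrow> (nat \<Rightarrow> real) \<Rightarrow> (nat \<times> real \<times> real) measure" where
  "mark_law M q = point_measure {1..M} (\<lambda>m. ennreal (q m)) \<Otimes>\<^sub>M
     (uniform_measure lborel {0..<1} \<Otimes>\<^sub>M density lborel (exponential_density 1))"

lemma task_law_eq: "task_law r M q = density lborel (exponential_density r) \<Otimes>\<^sub>M mark_law M q"
  by (simp add: task_law_def mark_law_def)

lemma prob_space_selection_requirement:
  "prob_space (uniform_measure lborel {0..<1::real} \<Otimes>\<^sub>M density lborel (exponential_density 1))"
proof -
  interpret u: prob_space "uniform_measure lborel {0..<1::real}"
    by (rule prob_space_uniform_measure) auto
  interpret e: prob_space "density lborel (exponential_density 1)"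
    by (rule prob_space_exponential_density) simp
  interpret pair_prob_space "uniform_measure lborel {0..<1::real}" "density lborel (exponential_density 1)" ..
  show ?thesis by unfold_locales
qed

lemma prob_space_target_law:
  fixes q :: "nat \<Rightarrow> real"
  assumes "\<And>m. m \<in> {1..M} \<Longrightarrow> 0 \<le> q m" "(\<Sum>m=1..M. q m) = 1"
  shows "prob_space (point_measure {1..M} (\<lambda>m. ennreal (q m)))"
proof
  have "emeasure (point_measure {1..M} (\<lambda>m. ennreal (q m))) {1..M} = (\<Sum>m=1..M. ennreal (q m))"
    by (rule emeasure_point_measure_finite) auto
  also have "\<dots> = 1" using assms by (subst sum_ennreal) auto
  finally show "emeasure (point_measure {1..M} (\<lambda>m. ennreal (q m))) (space (point_measure {1..M} (\<lambda>m. ennreal (q m)))) = 1"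
    by (simp add: space_point_measure)
qed

lemma prob_space_mark_law:
  assumes "\<And>m. m \<in> {1..M} \<Longrightarrow> 0 \<le> q m" "(\<Sum>m=1..M. q m) = 1"
  shows "prob_space (mark_law M q)"
proof -
  interpret b: prob_space "point_measure {1..M} (\<lambda>m. ennreal (q m))"
    using assms by (rule prob_space_target_law)
  interpret r: prob_space "uniform_measure lborel {0..<1::real} \<Otimes>\<^sub>M density lborel (exponential_density 1)"
    by (rule prob_space_selection_requirement)
  interpret pair_prob_space "point_measure {1..M} (\<lambda>m. ennreal (q m))"
    "uniform_measure lborel {0..<1::real} \<Otimes>\<^sub>M density lborel (exponential_density 1)" ..
  show ?thesis unfolding mark_law_def by unfold_locales
qed

lemma space_mark_law: "space (mark_law M q) = {1..M} \<times> UNIV"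
  by (auto simp: mark_law_def space_pair_measure space_point_measure)

lemma sets_mark_law[measurable_cong]:
  "sets (mark_law M q) = sets (count_space {1..M} \<Otimes>\<^sub>M (borel \<Otimes>\<^sub>M borel))"
  unfolding mark_law_def by (intro sets_pair_measure_cong) (auto simp: sets_point_measure)

text \<open>
  Points \<open>(s, b, u, e)\<close> with target \<open>m\<close> that have left by time \<open>t\<close> when the time spent in the
  system is \<open>e * r\<close>; for \<open>r = 0\<close> these are the points that have arrived by time \<open>t\<close>.
\<close>

definition departed :: "nat \<Rightarrow> real \<Rightarrow> real \<Rightarrow> (real \<times> nat \<times> real \<times> real) set" where
  "departed m r t = {y. fst (snd y) = m \<and> fst y + snd (snd (snd y)) * r \<le> t}"

lemma sets_departed:
  assumes "m \<in> {1..M}"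
  shows "departed m r t \<in> sets (borel \<Otimes>\<^sub>M mark_law M q)"
proof -
  have "departed m r t = {y \<in> space (borel \<Otimes>\<^sub>M mark_law M q). fst (snd y) = m \<and> fst y + snd (snd (snd y)) * r \<le> t}"
    using assms by (auto simp: departed_def space_pair_measure space_mark_law)
  also have "\<dots> \<in> sets (borel \<Otimes>\<^sub>M mark_law M q)" by measurable
  finally show ?thesis .
qed

lemma emeasure_exponential_le:
  "emeasure (density lborel (exponential_density 1)) {..a} = ennreal (if a < 0 then 0 else 1 - exp (- a))"
  using emeasure_erlang_density[of 1 0 a] by (simp add: erlang_CDF_0)

lemma emeasure_departed:
  assumes "m \<in> {1..M}" "0 \<le> q m" "0 \<le> r"
  shows "emeasure (mark_law M q) (Pair x -` departed m r t) =
    ennreal (if t < x then 0 else if r = 0 then q m else q m * (1 - exp (- (t - x) / r)))"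
proof -
  let ?E = "density lborel (exponential_density 1) :: real measure"
  let ?U = "uniform_measure lborel {0..<1::real}"
  let ?b = "point_measure {1..M} (\<lambda>m. ennreal (q m))"
  interpret u: prob_space ?U by (rule prob_space_uniform_measure) auto
  interpret e: prob_space ?E by (rule prob_space_exponential_density) simp
  interpret r: prob_space "?U \<Otimes>\<^sub>M ?E" by (rule prob_space_selection_requirement)
  have sp: "emeasure ?U UNIV = 1" using u.emeasure_space_1 by simp
  have spE: "emeasure ?E UNIV = 1" using e.emeasure_space_1 by simp
  have "Pair x -` departed m r t = {m} \<times> (UNIV \<times> {e. x + e * r \<le> t})"
    by (auto simp: departed_def)
  moreover have "emeasure (mark_law M q) ({m} \<times> (UNIV \<times> {e. x + e * r \<le> t})) =
      emeasure ?b {m} * emeasure (?U \<Otimes>\<^sub>M ?E) (UNIV \<times> {e. x + e * r \<le> t})"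
    unfolding mark_law_def using assms(1)
    by (intro r.emeasure_pair_measure_Times) (auto simp: sets_point_measure)
  moreover have "emeasure (?U \<Otimes>\<^sub>M ?E) (UNIV \<times> {e. x + e * r \<le> t}) = emeasure ?U UNIV * emeasure ?E {e. x + e * r \<le> t}"
    by (intro e.emeasure_pair_measure_Times) auto
  moreover have "emeasure ?b {m} = ennreal (q m)"
    using assms(1) by (subst emeasure_point_measure_finite) auto
  \<comment> \<open>\<open>r = 0\<close> is set apart: there the event is \<open>x \<le> t\<close>,
    while the exponential expression would give 0 by division by zero.\<close>
  moreover have "emeasure ?E {e. x + e * r \<le> t} = ennreal (if t < x then 0 else if r = 0 then 1 else 1 - exp (- (t - x) / r))"
  proof (cases "r = 0")
    case True
    then show ?thesis by (cases "t < x") (auto simp: spE not_less)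
  next
    case False
    then have "{e. x + e * r \<le> t} = {..(t - x) / r}"
      using assms(3) by (auto simp: field_simps)
    moreover have "(t - x) / r < 0 \<longleftrightarrow> t < x" using False assms(3) by (simp add: divide_less_0_iff)
    ultimately show ?thesis using False by (simp add: emeasure_exponential_le minus_divide_left)
  qed
  ultimately show ?thesis
    using assms by (auto simp: sp ennreal_mult'[symmetric])
qed

lemma nn_integral_departed:
  assumes m: "m \<in> {1..M}" and q: "0 \<le> q m" and r: "0 \<le> r" and t: "0 \<le> t"
  shows "(\<integral>\<^sup>+x. indicator {0..} x * emeasure (mark_law M q) (Pair x -` departed m r t) \<partial>lborel) =
    ennreal (q m * departure_mean r t)"
proof -
  let ?h = "\<lambda>x. if r = 0 then q m else q m * (1 - exp (- (t - x) / r))"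
  \<comment> \<open>An antiderivative of \<open>?h\<close>; the factor \<open>r\<close> removes the
    exponential when \<open>r = 0\<close>.\<close>
  let ?H = "\<lambda>x. q m * (x - r * exp (- (t - x) / r))"
  have "(\<integral>\<^sup>+x. indicator {0..} x * emeasure (mark_law M q) (Pair x -` departed m r t) \<partial>lborel) =
      (\<integral>\<^sup>+x. ennreal (?h x) * indicator {0..t} x \<partial>lborel)"
    using assms by (intro nn_integral_cong) (auto simp: emeasure_departed indicator_def)
  also have "\<dots> = ennreal (?H t - ?H 0)"
  proof (rule nn_integral_FTC_Icc[where f = ?h and F = ?H])
    show "?h \<in> borel_measurable borel" by measurable
    show "DERIV ?H x :> ?h x" for x
      by (cases "r = 0") (auto intro!: derivative_eq_intros simp: field_simps)
    show "0 \<le> ?h x" if "x \<in> {0..t}" for x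
    proof -
      have "exp (- (t - x) / r) \<le> 1" if "r \<noteq> 0" using \<open>x \<in> {0..t}\<close> r by (simp add: divide_nonpos_nonneg)
      then show ?thesis using q by simp
    qed
  qed (rule t)
  also have "?H t - ?H 0 = q m * departure_mean r t"
    by (simp add: departure_mean_def algebra_simps)
  finally show ?thesis .
qed

text \<open>Deviations are estimated for each class of dispatchers, regularity for all active
  dispatchers at once; both use the same inputs.\<close>

lemma (in marked_arrivals) marked_arrivals_subset:
  assumes "D' \<subseteq> D"
  shows "marked_arrivals P D' lam \<kappa> Y"
proof (intro marked_arrivals.intro marked_arrivals_axioms.intro prob_space_axioms)
  show "finite D'" using assms finite_D finite_subset by blast
  show "indep_vars (\<lambda>a. density lborel (exponential_density (lam (fst a))) \<Otimes>\<^sub>M \<kappa> (fst a)) Y (D' \<times> UNIV)"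
    using indep_Y by (rule indep_vars_subset) (use assms in auto)
  show "0 < lam i" "prob_space (\<kappa> i)" if "i \<in> D'" for i
    using assms lam_pos prob_space_\<kappa> that by blast+
  show "distr P (density lborel (exponential_density (lam (fst a))) \<Otimes>\<^sub>M \<kappa> (fst a)) (Y a) =
      density lborel (exponential_density (lam (fst a))) \<Otimes>\<^sub>M \<kappa> (fst a)" if "a \<in> D' \<times> UNIV" for a
    using assms that by (intro distr_Y) blast
qed

section \<open>Law of large numbers for scaled counts\<close>

lemma (in marked_arrivals) prob_count_deviation:
  assumes G: "\<And>i. i \<in> D \<Longrightarrow> G \<in> sets (borel \<Otimes>\<^sub>M \<kappa> i)"
    and g: "\<And>i. i \<in> D \<Longrightarrow> (\<integral>\<^sup>+u. indicator {0..} u * emeasure (\<kappa> i) (Pair u -` G) \<partial>lborel) = ennreal g"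
    and "0 \<le> g" "0 < \<epsilon>"
  shows "prob {\<omega> \<in> space P. \<epsilon> \<le> \<bar>enn2real (count G \<omega>) - (\<Sum>i\<in>D. lam i) * g\<bar>} \<le> (\<Sum>i\<in>D. lam i) * g / \<epsilon>\<^sup>2"
proof (rule chebyshev_second_moment)
  show "count G \<in> borel_measurable P" using G by (rule measurable_count)
  have "0 \<le> lam i" if "i \<in> D" for i using lam_pos[OF that] by simp
  then show nn: "0 \<le> (\<Sum>i\<in>D. lam i) * g" using \<open>0 \<le> g\<close> by (simp add: sum_nonneg)
  have "(\<integral>\<^sup>+\<omega>. count G \<omega> \<partial>P) = (\<Sum>i\<in>D. ennreal (lam i * g))"
    using lam_pos \<open>0 \<le> g\<close> by (subst nn_integral_count[OF G]) (auto intro!: sum.cong simp: g ennreal_mult less_imp_le)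
  also have "\<dots> = ennreal ((\<Sum>i\<in>D. lam i) * g)"
    using lam_pos \<open>0 \<le> g\<close> by (subst sum_ennreal) (auto simp: sum_distrib_right less_imp_le)
  finally show mean: "(\<integral>\<^sup>+\<omega>. count G \<omega> \<partial>P) = ennreal ((\<Sum>i\<in>D. lam i) * g)" .
  show "(\<integral>\<^sup>+\<omega>. (count G \<omega>)\<^sup>2 \<partial>P) \<le> ennreal ((\<Sum>i\<in>D. lam i) * g + ((\<Sum>i\<in>D. lam i) * g)\<^sup>2)"
    using nn_integral_count_square_le[OF G] nn by (simp add: mean ennreal_power[symmetric])
qed fact

text \<open>The variance of the count is at most its mean, which grows linearly in \<open>N\<close>.\<close>

lemma prob_scaled_count_deviation_tendsto_0:
  fixes P :: "nat \<Rightarrow> 'a measure" and D :: "nat \<Rightarrow> 'i set"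
  assumes arr: "\<And>N. 1 \<le> N \<Longrightarrow> marked_arrivals (P N) (D N) (lam N) (\<kappa> N) (Y N)"
    and lim: "(\<lambda>N. (\<Sum>i\<in>D N. lam N i) / real N) \<longlonglongrightarrow> \<Lambda>"
    and G: "\<And>N i. 1 \<le> N \<Longrightarrow> i \<in> D N \<Longrightarrow> G \<in> sets (borel \<Otimes>\<^sub>M \<kappa> N i)"
    and g: "\<And>N i. 1 \<le> N \<Longrightarrow> i \<in> D N \<Longrightarrow> (\<integral>\<^sup>+u. indicator {0..} u * emeasure (\<kappa> N i) (Pair u -` G) \<partial>lborel) = ennreal g"
    and "0 \<le> g" "0 < \<delta>"
  shows "(\<lambda>N. measure (P N) {\<omega> \<in> space (P N). \<delta> \<le> \<bar>enn2real (marked_arrivals.count (D N) (Y N) G \<omega>) / real N - \<Lambda> * g\<bar>}) \<longlonglongrightarrow> 0"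
proof -
  define a where "a N = (\<Sum>i\<in>D N. lam N i) / real N" for N
  have a: "a \<longlonglongrightarrow> \<Lambda>" using lim by (simp add: a_def[abs_def])
  let ?Z = "\<lambda>N \<omega>. enn2real (marked_arrivals.count (D N) (Y N) G \<omega>)"
  \<comment> \<open>The total rate over \<open>N\<close> only tends to \<open>\<Lambda>\<close>.
    Half of \<open>\<delta>\<close> absorbs this bias and half is left to Chebyshev, hence the
    factor 4 below.\<close>
  have "eventually (\<lambda>N. \<bar>a N * g - \<Lambda> * g\<bar> < \<delta> / 2) sequentially"
    using tendsto_mult_right[OF a, of g] \<open>0 < \<delta>\<close> tendsto_dist_iff
    by (auto simp: dist_real_def dest!: tendstoD[where e = "\<delta> / 2"])
  then have le: "eventually (\<lambda>N. measure (P N) {\<omega> \<in> space (P N). \<delta> \<le> \<bar>?Z N \<omega> / real N - \<Lambda> * g\<bar>} \<le>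
      4 * g / \<delta>\<^sup>2 * (a N / real N)) sequentially"
    using eventually_ge_at_top[of 1]
  proof eventually_elim
    case (elim N)
    interpret marked_arrivals "P N" "D N" "lam N" "\<kappa> N" "Y N" by (rule arr[OF elim(2)])
    have N: "0 < real N" using elim(2) by simp
    have sum: "(\<Sum>i\<in>D N. lam N i) = a N * real N" using N by (simp add: a_def)
    have meas: "count G \<in> borel_measurable (P N)" using G[OF elim(2)] by (rule measurable_count)
    have "{\<omega> \<in> space (P N). \<delta> \<le> \<bar>?Z N \<omega> / real N - \<Lambda> * g\<bar>} \<subseteq>
        {\<omega> \<in> space (P N). real N * (\<delta> / 2) \<le> \<bar>?Z N \<omega> - (\<Sum>i\<in>D N. lam N i) * g\<bar>}"
    proof safe
      fix \<omega> assume "\<delta> \<le> \<bar>?Z N \<omega> / real N - \<Lambda> * g\<bar>"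
      then have "\<delta> / 2 \<le> \<bar>?Z N \<omega> / real N - a N * g\<bar>" using elim(1) by linarith
      then have "real N * (\<delta> / 2) \<le> real N * \<bar>?Z N \<omega> / real N - a N * g\<bar>" using N by simp
      also have "\<dots> = \<bar>real N * (?Z N \<omega> / real N - a N * g)\<bar>" using N by (simp add: abs_mult)
      also have "real N * (?Z N \<omega> / real N - a N * g) = ?Z N \<omega> - (\<Sum>i\<in>D N. lam N i) * g"
        using N by (simp add: sum algebra_simps)
      finally show "real N * (\<delta> / 2) \<le> \<bar>?Z N \<omega> - (\<Sum>i\<in>D N. lam N i) * g\<bar>" .
    qed
    then have "prob {\<omega> \<in> space (P N). \<delta> \<le> \<bar>?Z N \<omega> / real N - \<Lambda> * g\<bar>} \<le>
        prob {\<omega> \<in> space (P N). real N * (\<delta> / 2) \<le> \<bar>?Z N \<omega> - (\<Sum>i\<in>D N. lam N i) * g\<bar>}"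
      using meas by (intro finite_measure_mono) auto
    also have "\<dots> \<le> (\<Sum>i\<in>D N. lam N i) * g / (real N * (\<delta> / 2))\<^sup>2"
      using G[OF elim(2)] g[OF elim(2)] \<open>0 \<le> g\<close> \<open>0 < \<delta>\<close> N by (intro prob_count_deviation) auto
    also have "\<dots> = 4 * g / \<delta>\<^sup>2 * (a N / real N)"
      using N \<open>0 < \<delta>\<close> by (simp add: sum power2_eq_square field_simps)
    finally show ?case .
  qed
  have lim0: "(\<lambda>N. 4 * g / \<delta>\<^sup>2 * (a N / real N)) \<longlonglongrightarrow> 0"
    using tendsto_mult[OF tendsto_const tendsto_mult[OF a lim_inverse_n], of "4 * g / \<delta>\<^sup>2"]
    by (simp add: divide_inverse)
  show ?thesis
    by (rule tendsto_sandwich[OF _ le tendsto_const lim0]) simp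
qed

section \<open>Almost sure properties of the inputs\<close>

lemma jiq_inputs_marked_arrivals:
  assumes "jiq_inputs P (tasks n lam) lam M q A B U E"
    and "\<And>i m. i \<in> {1..n} \<Longrightarrow> m \<in> {1..M} \<Longrightarrow> 0 \<le> q i m"
    and "\<And>i. i \<in> {1..n} \<Longrightarrow> (\<Sum>m=1..M. q i m) = 1"
  shows "marked_arrivals P {i \<in> {1..n}. 0 < lam i} lam (\<lambda>i. mark_law M (q i)) (\<lambda>a \<omega>. (A a \<omega>, B a \<omega>, U a \<omega>, E a \<omega>))"
proof -
  interpret prob_space P using assms(1) by (simp add: jiq_inputs_def)
  show ?thesis
  proof (intro marked_arrivals.intro marked_arrivals_axioms.intro prob_space_axioms)
    show "prob_space (mark_law M (q i))" if "i \<in> {i \<in> {1..n}. 0 < lam i}" for i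
      using assms(2,3) that by (intro prob_space_mark_law) auto
    show "indep_vars (\<lambda>a. density lborel (exponential_density (lam (fst a))) \<Otimes>\<^sub>M mark_law M (q (fst a)))
        (\<lambda>a \<omega>. (A a \<omega>, B a \<omega>, U a \<omega>, E a \<omega>)) ({i \<in> {1..n}. 0 < lam i} \<times> UNIV)"
      using assms(1) by (simp add: jiq_inputs_def tasks_def task_law_eq)
    show "distr P (density lborel (exponential_density (lam (fst a))) \<Otimes>\<^sub>M mark_law M (q (fst a)))
        (\<lambda>\<omega>. (A a \<omega>, B a \<omega>, U a \<omega>, E a \<omega>)) =
        density lborel (exponential_density (lam (fst a))) \<Otimes>\<^sub>M mark_law M (q (fst a))"
      if "a \<in> {i \<in> {1..n}. 0 < lam i} \<times> UNIV" for a
      using assms(1) that unfolding jiq_inputs_def tasks_def task_law_eq by blast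
  qed auto
qed

lemma AE_mark_law:
  assumes "prob_space (point_measure {1..M} (\<lambda>m. ennreal (q m)))"
  shows "AE k in mark_law M q. 0 \<le> fst (snd k) \<and> fst (snd k) < 1 \<and> 0 \<le> snd (snd k)"
proof -
  let ?E = "density lborel (exponential_density 1) :: real measure"
  let ?U = "uniform_measure lborel {0..<1::real}"
  let ?b = "point_measure {1..M} (\<lambda>m. ennreal (q m))"
  interpret b: prob_space ?b by fact
  interpret u: prob_space ?U by (rule prob_space_uniform_measure) auto
  interpret e: prob_space ?E by (rule prob_space_exponential_density) simp
  interpret r: prob_space "?U \<Otimes>\<^sub>M ?E" by (rule prob_space_selection_requirement)
  interpret ue: pair_prob_space ?U ?E ..
  interpret bue: pair_prob_space ?b "?U \<Otimes>\<^sub>M ?E" ..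
  have U: "AE u in ?U. 0 \<le> u \<and> u < 1" by (rule AE_uniform_measureI) auto
  have E: "AE e in ?E. 0 \<le> e"
    by (subst AE_density) (auto simp: exponential_density_def)
  have ue: "AE y in ?U \<Otimes>\<^sub>M ?E. 0 \<le> fst y \<and> fst y < 1 \<and> 0 \<le> snd y"
  proof (rule ue.AE_pair_measure)
    show "AE u in ?U. AE e in ?E. 0 \<le> fst (u, e) \<and> fst (u, e) < 1 \<and> 0 \<le> snd (u, e)"
      using U by eventually_elim (use E in simp)
  qed measurable
  show ?thesis
    unfolding mark_law_def
  proof (rule bue.AE_pair_measure)
    show "AE b in ?b. AE y in ?U \<Otimes>\<^sub>M ?E. 0 \<le> fst (snd (b, y)) \<and> fst (snd (b, y)) < 1 \<and> 0 \<le> snd (snd (b, y))"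
      using ue by simp
  qed measurable
qed

lemma (in marked_arrivals) AE_marks:
  assumes i: "i \<in> D" and S: "{k \<in> space (\<kappa> i). Q k} \<in> sets (\<kappa> i)" and Q: "AE k in \<kappa> i. Q k"
  shows "AE \<omega> in P. Q (snd (Y (i, n) \<omega>))"
proof -
  let ?e = "density lborel (exponential_density (lam i))"
  interpret K: prob_space "\<kappa> i" by (rule prob_space_\<kappa>[OF i])
  interpret e: prob_space ?e by (rule prob_space_exponential_density[OF lam_pos[OF i]])
  interpret eK: pair_prob_space ?e "\<kappa> i" ..
  have sn: "snd \<in> measurable (?e \<Otimes>\<^sub>M \<kappa> i) (\<kappa> i)" by measurable
  have S2: "{y \<in> space (?e \<Otimes>\<^sub>M \<kappa> i). Q (snd y)} \<in> sets (?e \<Otimes>\<^sub>M \<kappa> i)"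
  proof -
    have "{y \<in> space (?e \<Otimes>\<^sub>M \<kappa> i). Q (snd y)} = snd -` {k \<in> space (\<kappa> i). Q k} \<inter> space (?e \<Otimes>\<^sub>M \<kappa> i)"
      by (auto simp: space_pair_measure)
    then show ?thesis using measurable_sets[OF sn S] by simp
  qed
  have "AE y in ?e \<Otimes>\<^sub>M \<kappa> i. Q (snd y)"
    by (rule eK.AE_pair_measure[OF S2]) (use Q in simp)
  moreover have d: "distr P (?e \<Otimes>\<^sub>M \<kappa> i) (Y (i, n)) = ?e \<Otimes>\<^sub>M \<kappa> i"
    using distr_Y[of "(i, n)"] i by simp
  ultimately have Qd: "AE y in distr P (?e \<Otimes>\<^sub>M \<kappa> i) (Y (i, n)). Q (snd y)"
    by metis
  have mY: "Y (i, n) \<in> measurable P (?e \<Otimes>\<^sub>M \<kappa> i)"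
    using measurable_Y[of "(i, n)"] i by (simp add: Ln_def)
  show ?thesis by (rule AE_distr_iff[OF mY S2, THEN iffD1, OF Qd])
qed

section \<open>Classes cut out by breakpoints\<close>

lemma partition_strict_mono:
  assumes "partition_of_unit_interval n w" "i < j" "j \<le> n"
  shows "w i < w j"
  using assms(2,3)
proof (induction rule: strict_inc_induct)
  case (base i)
  then show ?case using assms(1) by (auto simp: partition_of_unit_interval_def)
next
  case (step i)
  have "w i < w (Suc i)" using assms(1) step(1,3) by (simp add: partition_of_unit_interval_def)
  also have "w (Suc i) < w j" using step by simp
  finally show ?case .
qed

lemma partition_class_unique:
  assumes w: "partition_of_unit_interval n w"
    and h: "h \<in> {1..n}" "x \<in> {w (h - 1)..<w h}" and h': "h' \<in> {1..n}" "x \<in> {w (h' - 1)..<w h'}"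
  shows "h = h'"
proof -
  have False if "a < b" "a \<in> {1..n}" "b \<in> {1..n}" "x \<in> {w (a - 1)..<w a}" "x \<in> {w (b - 1)..<w b}" for a b
  proof -
    have "w a \<le> w (b - 1)"
    proof (cases "a = b - 1")
      case False
      then have "a < b - 1" "b - 1 \<le> n" using that by auto
      then show ?thesis using partition_strict_mono[OF w] by (intro less_imp_le) blast
    qed simp
    then show False using that by auto
  qed
  then show ?thesis using h h' by (metis linorder_neqE_nat)
qed

lemma class_of_eq:
  assumes "partition_of_unit_interval n w" "h \<in> {1..n}" "x \<in> {w (h - 1)..<w h}"
  shows "class_of n w x = h"
  unfolding class_of_def using assms partition_class_unique[OF assms(1)] by (intro the_equality) blast+

lemma class_of_props:
  assumes w: "partition_of_unit_interval n w" and x: "x \<in> {0..<1}"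
  shows "class_of n w x \<in> {1..n}" "x \<in> {w (class_of n w x - 1)..<w (class_of n w x)}"
proof -
  \<comment> \<open>The first breakpoint above \<open>x\<close>; it is not number 0 because
    \<open>w 0 = 0 \<le> x\<close>.\<close>
  define h where "h = (LEAST h. x < w h)"
  have "x < w n" using assms by (simp add: partition_of_unit_interval_def)
  then have h: "x < w h" "h \<le> n" unfolding h_def by (rule LeastI, rule Least_le)
  have "h \<noteq> 0" using h(1) assms by (metis atLeastLessThan_iff not_less partition_of_unit_interval_def)
  moreover have "\<not> x < w (h - 1)" using not_less_Least[of "h - 1" "\<lambda>h. x < w h"] \<open>h \<noteq> 0\<close> by (simp add: h_def)
  ultimately have "h \<in> {1..n}" "x \<in> {w (h - 1)..<w h}" using h by auto
  moreover from this have "class_of n w x = h" by (rule class_of_eq[OF w])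
  ultimately show "class_of n w x \<in> {1..n}" "x \<in> {w (class_of n w x - 1)..<w (class_of n w x)}" by simp_all
qed

text \<open>A union bound over finitely many deviation events. Removing a null set as well turns the
  almost sure property \<open>R\<close> into one that holds at every point of \<open>G\<close>, so
  that the arguments on \<open>G\<close> concern single paths.\<close>

lemma eventually_good_event:
  fixes P :: "nat \<Rightarrow> 'a measure"
  assumes P: "\<And>N. 1 \<le> N \<Longrightarrow> prob_space (P N)"
    and reg: "\<And>N. 1 \<le> N \<Longrightarrow> AE \<omega> in P N. R N \<omega>"
    and I: "finite I"
    and bad: "\<And>j. j \<in> I \<Longrightarrow> (\<lambda>N. measure (P N) {\<omega> \<in> space (P N). Q j N \<omega>}) \<longlonglongrightarrow> 0"
    and meas: "\<And>j N. j \<in> I \<Longrightarrow> 1 \<le> N \<Longrightarrow> {\<omega> \<in> space (P N). Q j N \<omega>} \<in> sets (P N)"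
    and "0 < \<eta>"
  shows "eventually (\<lambda>N. \<exists>G\<in>sets (P N). 1 - \<eta> \<le> measure (P N) G \<and>
    (\<forall>\<omega>\<in>G. \<omega> \<in> space (P N) \<and> R N \<omega> \<and> (\<forall>j\<in>I. \<not> Q j N \<omega>))) sequentially"
proof -
  have "(\<lambda>N. \<Sum>j\<in>I. measure (P N) {\<omega> \<in> space (P N). Q j N \<omega>}) \<longlonglongrightarrow> 0"
    using tendsto_sum[OF bad] by simp
  then have "eventually (\<lambda>N. (\<Sum>j\<in>I. measure (P N) {\<omega> \<in> space (P N). Q j N \<omega>}) < \<eta>) sequentially"
    using \<open>0 < \<eta>\<close> by (rule order_tendstoD)
  then show ?thesis
    using eventually_ge_at_top[of 1]
  proof eventually_elim
    case (elim N)
    interpret prob_space "P N" by (rule P[OF elim(2)])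
    define B where "B = (\<Union>j\<in>I. {\<omega> \<in> space (P N). Q j N \<omega>})"
    have B: "B \<in> sets (P N)" unfolding B_def using meas[OF _ elim(2)] I by blast
    have "prob B \<le> (\<Sum>j\<in>I. prob {\<omega> \<in> space (P N). Q j N \<omega>})"
      unfolding B_def using meas[OF _ elim(2)] I by (intro finite_measure_subadditive_finite) auto
    then have pB: "prob B \<le> \<eta>" using elim(1) by simp
    \<comment> \<open>The failure set of \<open>R\<close> need not be measurable; it is replaced by
      a measurable null set that covers it.\<close>
    obtain Z where Z: "{\<omega> \<in> space (P N). \<not> R N \<omega>} \<subseteq> Z" "emeasure (P N) Z = 0" "Z \<in> sets (P N)"
      using reg[OF elim(2)] by (rule AE_E)
    define G where "G = space (P N) - B - Z"
    have G: "G \<in> sets (P N)" using B Z by (auto simp: G_def)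
    have "prob G = prob (space (P N) - B)"
      unfolding G_def using B Z by (intro measure_Diff_null_set) (auto simp: null_sets_def)
    also have "\<dots> = 1 - prob B" by (rule prob_compl[OF B])
    finally have "1 - \<eta> \<le> prob G" using pB by simp
    moreover have "\<forall>\<omega>\<in>G. \<omega> \<in> space (P N) \<and> R N \<omega> \<and> (\<forall>j\<in>I. \<not> Q j N \<omega>)"
      using Z(1) by (auto simp: G_def B_def)
    ultimately show ?case using G by blast
  qed
qed

section \<open>The scaled system\<close>

locale jiq_sequence =
  fixes f :: "real \<Rightarrow> real \<Rightarrow> real" and \<phi>1 \<phi>2 :: "nat \<Rightarrow> real" and W :: "nat \<Rightarrow> nat"
    and \<mu> :: "nat \<Rightarrow> nat \<Rightarrow> nat \<Rightarrow> real" and lam :: "nat \<Rightarrow> nat \<Rightarrow> real"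
    and H M K :: nat and w v :: "nat \<Rightarrow> real" and c p :: "nat \<Rightarrow> nat \<Rightarrow> real" and \<Lambda> \<nu> :: "nat \<Rightarrow> real"
    and P :: "nat \<Rightarrow> 'a measure"
    and A U E s :: "nat \<Rightarrow> task \<Rightarrow> 'a \<Rightarrow> real" and B J :: "nat \<Rightarrow> task \<Rightarrow> 'a \<Rightarrow> nat"
    and X :: "nat \<Rightarrow> 'a \<Rightarrow> path" and T :: real
  assumes f_seq: "f_sequence f \<phi>1 \<phi>2 W \<mu>"
    and step: "stepwise f H w M v c"
    and lam_nonneg: "\<And>N i. i \<in> {1..W N} \<Longrightarrow> 0 \<le> lam N i"
    and subcrit: "subcritical \<phi>1 \<phi>2 W H w M v c lam \<Lambda> p"
    and jiq: "\<And>N. 1 \<le> N \<Longrightarrow>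
        jiq_system (P N) (tasks (W N) (lam N)) (serv_class \<phi>2 v N) (\<mu> N) (lam N)
          M (\<lambda>i. p (class_of H w (\<phi>1 i))) (A N) (B N) (U N) (E N) (J N) (s N)"
    and X_def: "\<And>N \<omega> m k t. X N \<omega> m k t =
        occupancy N (tasks (W N) (lam N)) (\<mu> N) (\<lambda>a. E N a \<omega>) (\<lambda>a. J N a \<omega>) (\<lambda>a. s N a \<omega>)
          (serv_class \<phi>2 v N m) (\<nu> k) t"
    and T_nonneg: "0 \<le> T"
begin

definition cls :: "nat \<Rightarrow> nat" where
  "cls i = class_of H w (\<phi>1 i)"

lemma w_part: "partition_of_unit_interval H w" and v_part: "partition_of_unit_interval M v"
  using step by (auto simp: stepwise_def)

lemma c_nonneg: "h \<in> {1..H} \<Longrightarrow> m \<in> {1..M} \<Longrightarrow> 0 \<le> c h m"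
  using step by (auto simp: stepwise_def)

lemma p_nonneg: "h \<in> {1..H} \<Longrightarrow> m \<in> {1..M} \<Longrightarrow> 0 \<le> p h m"
  using subcrit by (auto simp: subcritical_def)

lemma p_sum: "h \<in> {1..H} \<Longrightarrow> (\<Sum>m=1..M. p h m) = 1"
  using subcrit by (auto simp: subcritical_def)

lemma \<Lambda>_pos: "h \<in> {1..H} \<Longrightarrow> 0 < \<Lambda> h"
  using subcrit by (auto simp: subcritical_def)

lemma v_diff_pos: "m \<in> {1..M} \<Longrightarrow> 0 < v m - v (m - 1)"
  using partition_strict_mono[OF v_part, of "m - 1" m] by auto

lemma cls_in: "1 \<le> i \<Longrightarrow> cls i \<in> {1..H}"
  unfolding cls_def using f_seq by (intro class_of_props(1)[OF w_part]) (auto simp: f_sequence_def)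

lemma disp_class_iff:
  assumes "h \<in> {1..H}"
  shows "i \<in> disp_class \<phi>1 w W N h \<longleftrightarrow> i \<in> {1..W N} \<and> cls i = h"
proof -
  have "\<phi>1 i \<in> {w (h - 1)..<w h} \<longleftrightarrow> cls i = h" if "1 \<le> i"
  proof -
    have x: "\<phi>1 i \<in> {0..<1}" using f_seq that by (auto simp: f_sequence_def)
    show ?thesis
      using class_of_eq[OF w_part assms, of "\<phi>1 i"] class_of_props(2)[OF w_part x] by (auto simp: cls_def)
  qed
  then show ?thesis by (auto simp: disp_class_def)
qed

text \<open>\<open>f\<close> is constant on each rectangle, so the rate is decided by the classes
  alone and not by the server that is picked.\<close>

lemma service_rate:
  assumes "i \<in> {1..W N}" "m \<in> {1..M}" "j \<in> serv_class \<phi>2 v N m"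
  shows "\<mu> N i j = c (cls i) m"
proof -
  have x: "\<phi>1 i \<in> {0..<1}" using f_seq assms by (auto simp: f_sequence_def)
  have "\<mu> N i j = f (\<phi>1 i) (\<phi>2 j)"
    using f_seq assms by (auto simp: f_sequence_def serv_class_def)
  moreover have "f (\<phi>1 i) (\<phi>2 j) = c (cls i) m"
    using step class_of_props[OF w_part x] assms(2,3)
    unfolding stepwise_def serv_class_def cls_def by blast
  ultimately show ?thesis by simp
qed

lemma finite_serv_class: "finite (serv_class \<phi>2 v N m)"
  by (simp add: serv_class_def)

lemma disjoint_serv_class:
  assumes "m \<in> {1..M}" "m' \<in> {1..M}" "m \<noteq> m'"
  shows "serv_class \<phi>2 v N m \<inter> serv_class \<phi>2 v N m' = {}"
proof (rule ccontr)
  assume "serv_class \<phi>2 v N m \<inter> serv_class \<phi>2 v N m' \<noteq> {}"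
  then obtain j where "\<phi>2 j \<in> {v (m - 1)..<v m}" "\<phi>2 j \<in> {v (m' - 1)..<v m'}"
    unfolding serv_class_def by blast
  then show False using partition_class_unique[OF v_part assms(1) _ assms(2)] assms(3) by blast
qed

text \<open>A positive quotient by zero is \<open>\<infinity>\<close> in \<open>ennreal\<close>, so
  a sum below 1 rules it out. All quotients are then real, and clearing the class size compares the
  stationary load with the capacity.\<close>

lemma load_lt:
  assumes m: "m \<in> {1..M}"
  shows "(\<Sum>h=1..H. \<Lambda> h * p h m / c h m) < v m - v (m - 1)"
    and "\<And>h. h \<in> {1..H} \<Longrightarrow> c h m = 0 \<Longrightarrow> p h m = 0"
proof -
  let ?d = "v m - v (m - 1)"
  have d: "0 < ?d" by (rule v_diff_pos[OF m])
  have lt: "(\<Sum>h=1..H. ennreal (\<Lambda> h * p h m) / ennreal (c h m * ?d)) < 1"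
    using subcrit m by (auto simp: subcritical_def)
  have nn: "0 \<le> \<Lambda> h * p h m" if "h \<in> {1..H}" for h
    using \<Lambda>_pos[OF that] p_nonneg[OF that m] by simp
  show z: "p h m = 0" if h: "h \<in> {1..H}" and c0: "c h m = 0" for h
  proof (rule ccontr)
    assume "p h m \<noteq> 0"
    then have "0 < \<Lambda> h * p h m" using \<Lambda>_pos[OF h] p_nonneg[OF h m] by simp
    then have "ennreal (\<Lambda> h * p h m) / ennreal (c h m * ?d) = \<infinity>"
      using c0 \<open>p h m \<noteq> 0\<close> \<Lambda>_pos[OF h] by (simp add: ennreal_divide_zero)
    moreover have "ennreal (\<Lambda> h * p h m) / ennreal (c h m * ?d) \<le> (\<Sum>h=1..H. ennreal (\<Lambda> h * p h m) / ennreal (c h m * ?d))"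
      using h by (intro member_le_sum) auto
    ultimately have "(\<infinity> :: ennreal) < 1" using lt by (metis order.strict_trans1)
    then show False by simp
  qed
  have "ennreal (\<Lambda> h * p h m) / ennreal (c h m * ?d) = ennreal (\<Lambda> h * p h m / c h m / ?d)" if h: "h \<in> {1..H}" for h
  proof (cases "c h m = 0")
    case True
    then show ?thesis using z[OF h] by simp
  next
    case False
    then have "0 < c h m * ?d" using c_nonneg[OF h m] d by simp
    then show ?thesis using nn[OF h] by (subst divide_ennreal) auto
  qed
  then have "(\<Sum>h=1..H. ennreal (\<Lambda> h * p h m / c h m / ?d)) < 1" using lt by simp
  moreover have "(\<Sum>h=1..H. ennreal (\<Lambda> h * p h m / c h m / ?d)) = ennreal (\<Sum>h=1..H. \<Lambda> h * p h m / c h m / ?d)"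
    using nn c_nonneg m d by (intro sum_ennreal) simp
  ultimately have "(\<Sum>h=1..H. \<Lambda> h * p h m / c h m / ?d) < 1"
    using ennreal_less_iff[of "\<Sum>h=1..H. \<Lambda> h * p h m / c h m / ?d" 1] nn c_nonneg m d
    by (simp add: sum_nonneg)
  then have "(\<Sum>h=1..H. \<Lambda> h * p h m / c h m) / ?d < 1"
    by (simp add: sum_divide_distrib)
  then show "(\<Sum>h=1..H. \<Lambda> h * p h m / c h m) < ?d"
    using d by (simp add: divide_less_eq)
qed

text \<open>The limiting fraction of servers of class \<open>m\<close> that are busy with tasks of class \<open>h\<close>.\<close>

definition fluid :: "nat \<Rightarrow> nat \<Rightarrow> real \<Rightarrow> real" where
  "fluid h m t = \<Lambda> h * p h m / c h m * (1 - exp (- c h m * t))"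

text \<open>Arrivals (service time 0) minus departures (mean service time \<open>1 / c h m\<close>).
  For \<open>c h m = 0\<close> the two coincide, because \<open>1 / 0 = 0\<close>, and
  \<open>fluid\<close> is 0 too.\<close>

lemma fluid_eq_departure_mean:
  "fluid h m t = \<Lambda> h * (p h m * departure_mean 0 t) - \<Lambda> h * (p h m * departure_mean (1 / c h m) t)"
  by (cases "c h m = 0") (simp_all add: fluid_def departure_mean_def algebra_simps add_divide_distrib diff_divide_distrib)

lemma fluid_le:
  assumes "h \<in> {1..H}" "m \<in> {1..M}"
  shows "fluid h m t \<le> \<Lambda> h * p h m / c h m"
proof -
  have "0 \<le> \<Lambda> h * p h m / c h m" using \<Lambda>_pos p_nonneg c_nonneg assms by (simp add: less_imp_le)
  then show ?thesis unfolding fluid_def by (intro mult_left_le) auto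
qed

definition \<tau> :: "nat \<Rightarrow> 'a \<Rightarrow> task \<Rightarrow> real" where
  "\<tau> N \<omega> = arrival_time (\<lambda>a. A N a \<omega>)"

definition Y :: "nat \<Rightarrow> task \<Rightarrow> 'a \<Rightarrow> real \<times> nat \<times> real \<times> real" where
  "Y N a \<omega> = (A N a \<omega>, B N a \<omega>, U N a \<omega>, E N a \<omega>)"

definition active :: "nat \<Rightarrow> nat set" where
  "active N = {i \<in> {1..W N}. 0 < lam N i}"

definition active_class :: "nat \<Rightarrow> nat \<Rightarrow> nat set" where
  "active_class h N = {i \<in> active N. cls i = h}"

lemma tasks_eq: "tasks (W N) (lam N) = active N \<times> UNIV"
  by (simp add: tasks_def active_def)

lemma active_cls: "i \<in> active N \<Longrightarrow> cls i \<in> {1..H}"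
  using cls_in by (auto simp: active_def)

lemma marked_arrivals_active:
  assumes "1 \<le> N"
  shows "marked_arrivals (P N) (active N) (lam N) (\<lambda>i. mark_law M (p (cls i))) (Y N)"
  unfolding active_def Y_def[abs_def]
proof (rule jiq_inputs_marked_arrivals)
  show "jiq_inputs (P N) (tasks (W N) (lam N)) (lam N) M (\<lambda>i. p (cls i)) (A N) (B N) (U N) (E N)"
    using jiq[OF assms] by (simp add: jiq_system_def cls_def)
qed (use cls_in p_nonneg p_sum in auto)

lemma marked_arrivals_class:
  assumes "1 \<le> N"
  shows "marked_arrivals (P N) (active_class h N) (lam N) (\<lambda>i. mark_law M (p (cls i))) (Y N)"
  by (rule marked_arrivals.marked_arrivals_subset[OF marked_arrivals_active[OF assms]]) (auto simp: active_class_def)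

lemma prob_space_P: "1 \<le> N \<Longrightarrow> prob_space (P N)"
  using marked_arrivals_active by (simp add: marked_arrivals_def)

definition class_count :: "nat \<Rightarrow> nat \<Rightarrow> nat \<Rightarrow> real \<Rightarrow> real \<Rightarrow> 'a \<Rightarrow> real" where
  "class_count N h m r t \<omega> = enn2real (marked_arrivals.count (active_class h N) (Y N) (departed m r t) \<omega>)"

lemma prob_class_count_deviation_tendsto_0:
  assumes h: "h \<in> {1..H}" and m: "m \<in> {1..M}" and "0 \<le> r" "0 \<le> t" "0 < \<delta>"
  shows "(\<lambda>N. measure (P N) {\<omega> \<in> space (P N).
    \<delta> \<le> \<bar>class_count N h m r t \<omega> / real N - \<Lambda> h * (p h m * departure_mean r t)\<bar>}) \<longlonglongrightarrow> 0"
  unfolding class_count_def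
proof (rule prob_scaled_count_deviation_tendsto_0[where lam = lam and \<kappa> = "\<lambda>N i. mark_law M (p (cls i))"])
  \<comment> \<open>Dispatchers of rate zero have no tasks and contribute nothing to the sum, so the
    limit for the whole class carries over.\<close>
  have "(\<Sum>i\<in>active_class h N. lam N i) = (\<Sum>i\<in>disp_class \<phi>1 w W N h. lam N i)" for N
  proof (rule sum.mono_neutral_left)
    show "finite (disp_class \<phi>1 w W N h)" by (simp add: disp_class_def)
    show "active_class h N \<subseteq> disp_class \<phi>1 w W N h"
      using disp_class_iff[OF h] by (auto simp: active_class_def active_def)
    show "\<forall>i\<in>disp_class \<phi>1 w W N h - active_class h N. lam N i = 0"
      using disp_class_iff[OF h] lam_nonneg by (force simp: active_class_def active_def)
  qed
  then show "(\<lambda>N. (\<Sum>i\<in>active_class h N. lam N i) / real N) \<longlonglongrightarrow> \<Lambda> h"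
    using subcrit h by (simp add: subcritical_def)
  show "(\<integral>\<^sup>+u. indicator {0..} u * emeasure (mark_law M (p (cls i))) (Pair u -` departed m r t) \<partial>lborel) =
      ennreal (p h m * departure_mean r t)" if "i \<in> active_class h N" for N i
    using that nn_integral_departed[of m M "p h" r t] m p_nonneg[OF h m] assms(3,4) by (simp add: active_class_def)
  have "departure_mean r 0 \<le> departure_mean r t" using assms by (intro departure_mean_bounds) auto
  then show "0 \<le> p h m * departure_mean r t"
    using p_nonneg[OF h m] by (simp add: departure_mean_def)
qed (use marked_arrivals_class sets_departed m \<open>0 < \<delta>\<close> in auto)

lemma measurable_class_count:
  assumes "m \<in> {1..M}" "1 \<le> N"
  shows "class_count N h m r t \<in> borel_measurable (P N)"
  unfolding class_count_def[abs_def]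
proof -
  have [measurable]: "marked_arrivals.count (active_class h N) (Y N) (departed m r t) \<in> borel_measurable (P N)"
    by (rule marked_arrivals.measurable_count[OF marked_arrivals_class[OF assms(2)] sets_departed[OF assms(1)]])
  show "(\<lambda>\<omega>. enn2real (marked_arrivals.count (active_class h N) (Y N) (departed m r t) \<omega>)) \<in> borel_measurable (P N)"
    by measurable
qed

text \<open>The almost sure properties that the pathwise arguments use. Given \<open>regular\<close>
  and room in every class, the comparison with the unlimited queue is deterministic.\<close>

definition regular :: "nat \<Rightarrow> 'a \<Rightarrow> bool" where
  "regular N \<omega> \<longleftrightarrow>
    jiq_path (tasks (W N) (lam N)) (serv_class \<phi>2 v N) (\<mu> N) (\<tau> N \<omega>) (\<lambda>a. B N a \<omega>) (\<lambda>a. U N a \<omega>)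
      (\<lambda>a. E N a \<omega>) (\<lambda>a. J N a \<omega>) (\<lambda>a. s N a \<omega>) \<and>
    inj_on (\<tau> N \<omega>) (active N \<times> UNIV) \<and>
    (\<forall>t. finite {a \<in> active N \<times> UNIV. \<tau> N \<omega> a \<le> t}) \<and>
    (\<forall>a\<in>active N \<times> UNIV. 0 \<le> \<tau> N \<omega> a \<and> B N a \<omega> \<in> {1..M} \<and> 0 \<le> U N a \<omega> \<and> U N a \<omega> < 1 \<and> 0 \<le> E N a \<omega>)"

lemma \<tau>_eq:
  assumes "1 \<le> N"
  shows "marked_arrivals.\<tau> (Y N) \<omega> = \<tau> N \<omega>"
  by (rule ext) (simp add: marked_arrivals.\<tau>_def[OF marked_arrivals_active[OF assms]]
      marked_arrivals.stream_def[OF marked_arrivals_active[OF assms]] epoch_def \<tau>_def arrival_time_def Y_def)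

lemma AE_regular:
  assumes N: "1 \<le> N"
  shows "AE \<omega> in P N. regular N \<omega>"
proof -
  interpret ma: marked_arrivals "P N" "active N" "lam N" "\<lambda>i. mark_law M (p (cls i))" "Y N"
    by (rule marked_arrivals_active[OF N])
  have path: "AE \<omega> in P N. jiq_path (tasks (W N) (lam N)) (serv_class \<phi>2 v N) (\<mu> N) (\<tau> N \<omega>) (\<lambda>a. B N a \<omega>) (\<lambda>a. U N a \<omega>)
      (\<lambda>a. E N a \<omega>) (\<lambda>a. J N a \<omega>) (\<lambda>a. s N a \<omega>)"
    using jiq[OF N] by (simp add: jiq_system_def \<tau>_def)
  let ?Q = "\<lambda>k::nat \<times> real \<times> real. fst k \<in> {1..M} \<and> 0 \<le> fst (snd k) \<and> fst (snd k) < 1 \<and> 0 \<le> snd (snd k)"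
  have "AE \<omega> in P N. ?Q (snd (Y N (i, n) \<omega>))" if i: "i \<in> active N" for i n
  proof (rule ma.AE_marks[OF i])
    have h: "cls i \<in> {1..H}" using i active_cls by blast
    have sp: "space (mark_law M (p (cls i))) = {1..M} \<times> UNIV" by (rule space_mark_law)
    have "{k \<in> space (mark_law M (p (cls i))). ?Q k} = {k \<in> space (mark_law M (p (cls i))). 0 \<le> fst (snd k) \<and> fst (snd k) < 1 \<and> 0 \<le> snd (snd k)}"
      unfolding sp by auto
    also have "\<dots> \<in> sets (mark_law M (p (cls i)))" by measurable
    finally show "{k \<in> space (mark_law M (p (cls i))). ?Q k} \<in> sets (mark_law M (p (cls i)))" .
    \<comment> \<open>The range of the target comes from the space of the mark law, the other bounds
      from its almost sure properties.\<close>
    have "AE k in mark_law M (p (cls i)). k \<in> space (mark_law M (p (cls i)))" by simp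
    with AE_mark_law[OF prob_space_target_law]
    show "AE k in mark_law M (p (cls i)). ?Q k"
      using p_nonneg[OF h] p_sum[OF h] by (auto simp: sp elim!: eventually_elim2)
  qed
  then have marks: "AE \<omega> in P N. \<forall>i\<in>active N. \<forall>n. ?Q (snd (Y N (i, n) \<omega>))"
    using ma.finite_D by (subst AE_ball_countable) (auto simp: countable_finite AE_all_countable)
  show ?thesis
    using path ma.AE_inj_epochs ma.AE_locally_finite ma.AE_gaps_pos marks
  proof eventually_elim
    case (elim \<omega>)
    have "0 \<le> \<tau> N \<omega> a" if "a \<in> active N \<times> UNIV" for a
      unfolding \<tau>_def arrival_time_def
    proof (rule sum_nonneg)
      fix l :: nat
      have "(fst a, l) \<in> active N \<times> UNIV" using that by auto
      then have "0 < fst (Y N (fst a, l) \<omega>)" using elim(4) by blast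
      then show "0 \<le> A N (fst a, l) \<omega>" by (simp add: Y_def)
    qed
    then show ?case
      using elim unfolding regular_def \<tau>_eq[OF N] by (auto simp: Y_def)
  qed
qed

text \<open>The tasks present in the queue with unlimited servers. Neither \<open>J\<close> nor
  \<open>s\<close> occurs.\<close>

definition in_service :: "nat \<Rightarrow> nat \<Rightarrow> nat \<Rightarrow> real \<Rightarrow> 'a \<Rightarrow> task set" where
  "in_service N h m t \<omega> = {a \<in> active_class h N \<times> UNIV. B N a \<omega> = m \<and> \<tau> N \<omega> a \<le> t \<and> t < \<tau> N \<omega> a + E N a \<omega> / c h m}"

lemma finite_arrived:
  assumes "regular N \<omega>"
  shows "finite {a \<in> active N \<times> UNIV. \<tau> N \<omega> a \<le> t \<and> Q a}"
proof (rule finite_subset)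
  show "{a \<in> active N \<times> UNIV. \<tau> N \<omega> a \<le> t \<and> Q a} \<subseteq> {a \<in> active N \<times> UNIV. \<tau> N \<omega> a \<le> t}" by blast
  show "finite {a \<in> active N \<times> UNIV. \<tau> N \<omega> a \<le> t}" using assms unfolding regular_def by blast
qed

lemma finite_in_service:
  assumes "regular N \<omega>"
  shows "finite (in_service N h m t \<omega>)"
  by (rule finite_subset[OF _ finite_arrived[OF assms, of t "\<lambda>_. True"]])
    (auto simp: in_service_def active_class_def)

definition departed_tasks :: "nat \<Rightarrow> nat \<Rightarrow> nat \<Rightarrow> real \<Rightarrow> real \<Rightarrow> 'a \<Rightarrow> task set" where
  "departed_tasks N h m r t \<omega> = {a \<in> active_class h N \<times> UNIV. B N a \<omega> = m \<and> \<tau> N \<omega> a + E N a \<omega> * r \<le> t}"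

lemma departed_tasks_subset:
  assumes "regular N \<omega>" "0 \<le> r"
  shows "departed_tasks N h m r t \<omega> \<subseteq> departed_tasks N h m 0 t \<omega>"
proof
  fix a assume a: "a \<in> departed_tasks N h m r t \<omega>"
  then have "a \<in> active N \<times> UNIV" by (auto simp: departed_tasks_def active_class_def)
  then have "0 \<le> E N a \<omega>" using assms(1) unfolding regular_def by blast
  then have "0 \<le> E N a \<omega> * r" using assms(2) by simp
  then show "a \<in> departed_tasks N h m 0 t \<omega>" using a by (auto simp: departed_tasks_def)
qed

lemma finite_departed_tasks:
  assumes "regular N \<omega>" "0 \<le> r"
  shows "finite (departed_tasks N h m r t \<omega>)"
  by (rule finite_subset[OF departed_tasks_subset[OF assms]],
      rule finite_subset[OF _ finite_arrived[OF assms(1), of t "\<lambda>_. True"]])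
    (auto simp: departed_tasks_def active_class_def)

lemma class_count_eq_card:
  assumes N: "1 \<le> N" and reg: "regular N \<omega>" and r: "0 \<le> r"
  shows "class_count N h m r t \<omega> = real (card (departed_tasks N h m r t \<omega>))"
proof -
  have eq: "{a \<in> active_class h N \<times> UNIV. (marked_arrivals.\<tau> (Y N) \<omega> a, snd (Y N a \<omega>)) \<in> departed m r t} =
      departed_tasks N h m r t \<omega>"
    by (auto simp: \<tau>_eq[OF N] departed_def departed_tasks_def Y_def)
  have "marked_arrivals.count (active_class h N) (Y N) (departed m r t) \<omega> =
      of_nat (card (departed_tasks N h m r t \<omega>))"
    using marked_arrivals.count_eq_card[OF marked_arrivals_class[OF N, of h], of \<omega> "departed m r t"]
      finite_departed_tasks[OF reg r] unfolding eq by blast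
  then show ?thesis by (simp add: class_count_def ennreal_of_nat_eq_real_of_nat)
qed

lemma class_count_mono:
  assumes "1 \<le> N" "regular N \<omega>" "0 \<le> r" "t \<le> t'"
  shows "class_count N h m r t \<omega> \<le> class_count N h m r t' \<omega>"
proof -
  have "departed_tasks N h m r t \<omega> \<subseteq> departed_tasks N h m r t' \<omega>"
    using assms(4) by (auto simp: departed_tasks_def)
  then show ?thesis
    unfolding class_count_eq_card[OF assms(1-3)] using finite_departed_tasks[OF assms(2,3)]
    by (simp add: card_mono)
qed

text \<open>Present means arrived and not departed, and departed tasks have arrived since
  requirements are nonnegative. This writes a count that rises and falls as a difference of two
  monotone ones.\<close>

lemma card_in_service:
  assumes "1 \<le> N" "regular N \<omega>" "h \<in> {1..H}" "m \<in> {1..M}"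
  shows "real (card (in_service N h m t \<omega>)) = class_count N h m 0 t \<omega> - class_count N h m (1 / c h m) t \<omega>"
proof -
  let ?r = "1 / c h m"
  have r: "0 \<le> ?r" using c_nonneg[OF assms(3,4)] by simp
  have "in_service N h m t \<omega> = departed_tasks N h m 0 t \<omega> - departed_tasks N h m ?r t \<omega>"
    by (auto simp: in_service_def departed_tasks_def)
  then have "card (in_service N h m t \<omega>) = card (departed_tasks N h m 0 t \<omega>) - card (departed_tasks N h m ?r t \<omega>)"
    using card_Diff_subset[OF finite_departed_tasks[OF assms(2) r] departed_tasks_subset[OF assms(2) r]] by simp
  moreover have "card (departed_tasks N h m ?r t \<omega>) \<le> card (departed_tasks N h m 0 t \<omega>)"
    using finite_departed_tasks[OF assms(2), of 0] departed_tasks_subset[OF assms(2) r] by (simp add: card_mono)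
  ultimately show ?thesis
    using class_count_eq_card[OF assms(1,2) r] class_count_eq_card[OF assms(1,2), of 0] by simp
qed

lemma class_count_uniform:
  assumes N: "1 \<le> N" and reg: "regular N \<omega>" and h: "h \<in> {1..H}" and m: "m \<in> {1..M}" and r: "0 \<le> r" and n: "0 < n"
    and grid: "\<And>l. l \<le> n \<Longrightarrow>
      \<bar>class_count N h m r (T * real l / real n) \<omega> / real N - \<Lambda> h * (p h m * departure_mean r (T * real l / real n))\<bar> \<le> \<delta>"
    and t: "t \<in> {0..T}"
  shows "\<bar>class_count N h m r t \<omega> / real N - \<Lambda> h * (p h m * departure_mean r t)\<bar> \<le> \<delta> + \<Lambda> h * p h m * T / real n"
proof (rule uniform_approx_of_grid[where F = "\<lambda>t. class_count N h m r t \<omega> / real N"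
      and f = "\<lambda>t. \<Lambda> h * (p h m * departure_mean r t)", OF _ _ _ n _ grid])
  have nn: "0 \<le> \<Lambda> h" "0 \<le> p h m" using \<Lambda>_pos[OF h] p_nonneg[OF h m] by simp_all
  show "0 \<le> \<Lambda> h * p h m" using nn by simp
  fix x y :: real assume xy: "0 \<le> x" "x \<le> y"
  show "class_count N h m r x \<omega> / real N \<le> class_count N h m r y \<omega> / real N"
    using class_count_mono[OF N reg r xy(2)] by (simp add: divide_right_mono)
  show "\<Lambda> h * (p h m * departure_mean r x) \<le> \<Lambda> h * (p h m * departure_mean r y)"
    using departure_mean_bounds(1)[OF r xy] nn by (intro mult_left_mono)
  have "\<Lambda> h * p h m * (departure_mean r y - departure_mean r x) \<le> \<Lambda> h * p h m * (y - x)"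
    using departure_mean_bounds(2)[OF r xy] nn by (intro mult_left_mono) auto
  then show "\<Lambda> h * (p h m * departure_mean r y) - \<Lambda> h * (p h m * departure_mean r x) \<le> \<Lambda> h * p h m * (y - x)"
    by (simp add: algebra_simps)
qed (use t in auto)

text \<open>\<open>Q\<close> selects dispatcher classes: all of them for the total load of a server
  class, those with \<open>c h m = \<nu> k\<close> for the tasks served at one rate.\<close>

lemma card_in_service_classes:
  assumes reg: "regular N \<omega>"
  shows "card {a \<in> active N \<times> UNIV. B N a \<omega> = m \<and> Q (cls (fst a)) \<and> \<tau> N \<omega> a \<le> t \<and>
      t < \<tau> N \<omega> a + E N a \<omega> / c (cls (fst a)) m} =
    (\<Sum>h\<in>{h \<in> {1..H}. Q h}. card (in_service N h m t \<omega>))"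
proof -
  have eq: "{a \<in> active N \<times> UNIV. B N a \<omega> = m \<and> Q (cls (fst a)) \<and> \<tau> N \<omega> a \<le> t \<and>
      t < \<tau> N \<omega> a + E N a \<omega> / c (cls (fst a)) m} = (\<Union>h\<in>{h \<in> {1..H}. Q h}. in_service N h m t \<omega>)"
    using active_cls by (auto simp: in_service_def active_class_def)
  show ?thesis unfolding eq
  proof (rule card_UN_disjoint)
    show "\<forall>h\<in>{h \<in> {1..H}. Q h}. \<forall>h'\<in>{h \<in> {1..H}. Q h}. h \<noteq> h' \<longrightarrow> in_service N h m t \<omega> \<inter> in_service N h' m t \<omega> = {}"
      unfolding in_service_def active_class_def by fastforce
    show "\<forall>h\<in>{h \<in> {1..H}. Q h}. finite (in_service N h m t \<omega>)"
      using finite_in_service[OF reg] by blast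
  qed simp
qed

text \<open>Several classes of dispatchers may be served at the same rate \<open>\<nu> k\<close>,
  hence the sum. The hypothesis \<open>room\<close> is the one of the sample path argument,
  regrouped by dispatcher class.\<close>

lemma occupancy_eq_in_service:
  assumes N: "1 \<le> N" and reg: "regular N \<omega>"
    and room: "\<And>m t. m \<in> {1..M} \<Longrightarrow> t \<in> {0..T} \<Longrightarrow>
      (\<Sum>h=1..H. card (in_service N h m t \<omega>)) < card (serv_class \<phi>2 v N m)"
    and m: "m \<in> {1..M}" and t: "t \<in> {0..T}"
  shows "X N \<omega> m k t = (\<Sum>h\<in>{h \<in> {1..H}. c h m = \<nu> k}. real (card (in_service N h m t \<omega>)) / real N)"
proof -
  let ?\<rho> = "\<lambda>a. c (cls (fst a)) (B N a \<omega>)"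
  have B: "B N a \<omega> \<in> {1..M}" if "a \<in> active N \<times> UNIV" for a
    using reg that unfolding regular_def by blast
  interpret jiq_sample_path "tasks (W N) (lam N)" "serv_class \<phi>2 v N" "\<mu> N" "\<tau> N \<omega>" "\<lambda>a. B N a \<omega>" "\<lambda>a. U N a \<omega>"
    "\<lambda>a. E N a \<omega>" "\<lambda>a. J N a \<omega>" "\<lambda>a. s N a \<omega>" "{1..M}" ?\<rho> T
    unfolding tasks_eq
  proof
    show "jiq_path (active N \<times> UNIV) (serv_class \<phi>2 v N) (\<mu> N) (\<tau> N \<omega>) (\<lambda>a. B N a \<omega>) (\<lambda>a. U N a \<omega>)
      (\<lambda>a. E N a \<omega>) (\<lambda>a. J N a \<omega>) (\<lambda>a. s N a \<omega>)"
      using reg unfolding regular_def tasks_eq by blast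
    show "inj_on (\<tau> N \<omega>) (active N \<times> UNIV)" "finite {a \<in> active N \<times> UNIV. \<tau> N \<omega> a \<le> t}" for t
      using reg unfolding regular_def by blast+
    fix a assume a: "a \<in> active N \<times> (UNIV :: nat set)"
    show "0 \<le> \<tau> N \<omega> a" "0 \<le> U N a \<omega> \<and> U N a \<omega> < 1" "B N a \<omega> \<in> {1..M}"
      using reg a unfolding regular_def by blast+
    show "\<mu> N (fst a) j = ?\<rho> a" if "j \<in> serv_class \<phi>2 v N (B N a \<omega>)" for j
      using service_rate[OF _ B[OF a] that] a by (auto simp: active_def)
  next
    fix t m assume tm: "t \<in> {0..T}" "m \<in> {1..M}"
    have "{a \<in> active N \<times> UNIV. B N a \<omega> = m \<and> \<tau> N \<omega> a \<le> t \<and> t < \<tau> N \<omega> a + E N a \<omega> / ?\<rho> a} =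
      {a \<in> active N \<times> UNIV. B N a \<omega> = m \<and> True \<and> \<tau> N \<omega> a \<le> t \<and> t < \<tau> N \<omega> a + E N a \<omega> / c (cls (fst a)) m}"
      by blast
    moreover have all: "{h \<in> {1..H}. True} = {1..H}" by auto
    ultimately have "card {a \<in> active N \<times> UNIV. B N a \<omega> = m \<and> \<tau> N \<omega> a \<le> t \<and> t < \<tau> N \<omega> a + E N a \<omega> / ?\<rho> a} =
      (\<Sum>h=1..H. card (in_service N h m t \<omega>))"
      using card_in_service_classes[OF reg, of m "\<lambda>_. True" t] unfolding all by simp
    then show "card {a \<in> active N \<times> UNIV. B N a \<omega> = m \<and> \<tau> N \<omega> a \<le> t \<and> t < \<tau> N \<omega> a + E N a \<omega> / ?\<rho> a} <
        card (serv_class \<phi>2 v N m)"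
      using room[OF tm(2,1)] by simp
  qed (use finite_serv_class disjoint_serv_class in blast)+
  have "{a \<in> tasks (W N) (lam N). B N a \<omega> = m \<and> ?\<rho> a = \<nu> k \<and> \<tau> N \<omega> a \<le> t \<and> t < \<tau> N \<omega> a + E N a \<omega> / ?\<rho> a} =
      {a \<in> active N \<times> UNIV. B N a \<omega> = m \<and> c (cls (fst a)) m = \<nu> k \<and> \<tau> N \<omega> a \<le> t \<and>
        t < \<tau> N \<omega> a + E N a \<omega> / c (cls (fst a)) m}"
    unfolding tasks_eq by blast
  then show ?thesis
    using occupancy_eq[OF t m, of N "\<nu> k"] card_in_service_classes[OF reg, of m "\<lambda>h. c h m = \<nu> k" t]
    by (simp add: X_def sum_divide_distrib)
qed

end

section \<open>Uniform closeness to the fluid and the weak limit\<close>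

context jiq_sequence
begin

lemma eventually_in_service_close:
  assumes "0 < \<epsilon>" "0 < \<eta>"
  shows "eventually (\<lambda>N. \<exists>G\<in>sets (P N). 1 - \<eta> \<le> measure (P N) G \<and> (\<forall>\<omega>\<in>G. regular N \<omega> \<and>
    (\<forall>h\<in>{1..H}. \<forall>m\<in>{1..M}. \<forall>t\<in>{0..T}.
      \<bar>real (card (in_service N h m t \<omega>)) / real N - fluid h m t\<bar> \<le> \<epsilon>))) sequentially"
proof -
  define L where "L = (\<Sum>h=1..H. \<Lambda> h)"
  \<comment> \<open>A grid so fine that the limiting means grow by at most
    \<open>\<epsilon> / 4\<close> over a cell, for all classes at once since \<open>L\<close> bounds
    each \<open>\<Lambda> h * p h m\<close>. \<open>Suc\<close> makes \<open>n\<close>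
    positive.\<close>
  obtain n :: nat where n: "4 * L * T / \<epsilon> < real n" "0 < n"
  proof -
    obtain n0 :: nat where "4 * L * T / \<epsilon> < real n0" using reals_Archimedean2 by blast
    then show ?thesis using that[of "Suc n0"] by simp
  qed
  have mesh: "\<Lambda> h * p h m * T / real n \<le> \<epsilon> / 4" if "h \<in> {1..H}" "m \<in> {1..M}" for h m
  proof -
    have "\<Lambda> h \<le> L" unfolding L_def using that(1) \<Lambda>_pos by (intro member_le_sum) (auto intro: less_imp_le)
    moreover have "p h m \<le> 1" using subcrit that by (auto simp: subcritical_def)
    ultimately have "\<Lambda> h * p h m \<le> L" using \<Lambda>_pos[OF that(1)] p_nonneg[OF that] by (meson less_imp_le mult_left_le order_trans)
    then have "\<Lambda> h * p h m * T \<le> L * T" using T_nonneg by (rule mult_right_mono)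
    also have "\<dots> \<le> \<epsilon> / 4 * real n" using n(1) \<open>0 < \<epsilon>\<close> by (simp add: field_simps)
    finally show ?thesis using n(2) by (simp add: pos_divide_le_eq)
  qed
  \<comment> \<open>\<open>b\<close> tells departures from arrivals; with the finitely many grid
    points this gives a finite index set for the union bound.\<close>
  define r where "r h m b = (if b then 1 / c h m else 0)" for h m b
  have r: "0 \<le> r h m b" if "h \<in> {1..H}" "m \<in> {1..M}" for h m b
    using c_nonneg[OF that] by (simp add: r_def)
  define I where "I = {1..H} \<times> {1..M} \<times> (UNIV :: bool set) \<times> {..n}"
  \<comment> \<open>Arrivals and departures may each err by \<open>\<epsilon> / 4\<close> on the
    grid and by another \<open>\<epsilon> / 4\<close> between grid points, which makes
    \<open>\<epsilon>\<close> in total.\<close>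
  define Q where "Q = (\<lambda>(h, m, b, l) N \<omega>. \<epsilon> / 4 \<le> \<bar>class_count N h m (r h m b) (T * real l / real n) \<omega> / real N -
      \<Lambda> h * (p h m * departure_mean (r h m b) (T * real l / real n))\<bar>)"
  have "eventually (\<lambda>N. \<exists>G\<in>sets (P N). 1 - \<eta> \<le> measure (P N) G \<and>
    (\<forall>\<omega>\<in>G. \<omega> \<in> space (P N) \<and> regular N \<omega> \<and> (\<forall>j\<in>I. \<not> Q j N \<omega>))) sequentially"
  proof (rule eventually_good_event[OF prob_space_P AE_regular _ _ _ \<open>0 < \<eta>\<close>])
    show "finite I" by (simp add: I_def)
    fix j assume "j \<in> I"
    then obtain h m b l where j: "j = (h, m, b, l)" "h \<in> {1..H}" "m \<in> {1..M}" by (auto simp: I_def)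
    have "0 \<le> T * real l / real n" using T_nonneg by simp
    then show "(\<lambda>N. measure (P N) {\<omega> \<in> space (P N). Q j N \<omega>}) \<longlonglongrightarrow> 0"
      unfolding j(1) Q_def prod.case
      by (rule prob_class_count_deviation_tendsto_0[OF j(2,3) r[OF j(2,3)]]) (use \<open>0 < \<epsilon>\<close> in simp)
    fix N :: nat assume "1 \<le> N"
    then have [measurable]: "class_count N h m (r h m b) (T * real l / real n) \<in> borel_measurable (P N)"
      using measurable_class_count[OF j(3)] by blast
    show "{\<omega> \<in> space (P N). Q j N \<omega>} \<in> sets (P N)"
      unfolding j(1) Q_def prod.case by measurable
  qed
  then show ?thesis
    using eventually_ge_at_top[of 1]
  proof eventually_elim
    case (elim N)
    have "\<bar>real (card (in_service N h m t \<omega>)) / real N - fluid h m t\<bar> \<le> \<epsilon>"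
      if reg: "regular N \<omega>" and good: "\<And>j. j \<in> I \<Longrightarrow> \<not> Q j N \<omega>"
        and hm: "h \<in> {1..H}" "m \<in> {1..M}" and t: "t \<in> {0..T}" for \<omega> h m t
    proof -
      have dev: "\<bar>class_count N h m (r h m b) t \<omega> / real N - \<Lambda> h * (p h m * departure_mean (r h m b) t)\<bar> \<le> \<epsilon> / 4 + \<epsilon> / 4" for b
      proof -
        have "\<bar>class_count N h m (r h m b) (T * real l / real n) \<omega> / real N -
          \<Lambda> h * (p h m * departure_mean (r h m b) (T * real l / real n))\<bar> \<le> \<epsilon> / 4" if "l \<le> n" for l
          using good[of "(h, m, b, l)"] hm that by (simp add: I_def Q_def)
        then have "\<bar>class_count N h m (r h m b) t \<omega> / real N - \<Lambda> h * (p h m * departure_mean (r h m b) t)\<bar> \<le>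
            \<epsilon> / 4 + \<Lambda> h * p h m * T / real n"
          by (rule class_count_uniform[OF elim(2) reg hm r[OF hm] n(2) _ t])
        then show ?thesis using mesh[OF hm] by linarith
      qed
      have "real (card (in_service N h m t \<omega>)) / real N - fluid h m t =
        (class_count N h m (r h m False) t \<omega> / real N - \<Lambda> h * (p h m * departure_mean (r h m False) t)) -
        (class_count N h m (r h m True) t \<omega> / real N - \<Lambda> h * (p h m * departure_mean (r h m True) t))"
        unfolding card_in_service[OF elim(2) reg hm] fluid_eq_departure_mean by (simp add: r_def diff_divide_distrib)
      then show ?thesis using dev[of False] dev[of True] by linarith
    qed
    then show ?case using elim(1) by blast
  qed
qed

lemma rate_zero:
  assumes "m \<in> {1..M}" "\<nu> k = 0"
  shows "lam_p H p \<Lambda> c \<nu> m k = 0"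
  unfolding lam_p_def using load_lt(2)[OF assms(1)] assms(2) by (intro sum.neutral) auto

text \<open>Classes with \<open>c h m = \<nu> k\<close> relax at the same rate, so their fluids add
  up to the solution of one equation; when \<open>\<nu> k = 0\<close> both sides are 0.\<close>

lemma explicit_eq_fluid_sum:
  "lam_p H p \<Lambda> c \<nu> m k / \<nu> k * (1 - exp (- \<nu> k * t)) = (\<Sum>h\<in>{h \<in> {1..H}. c h m = \<nu> k}. fluid h m t)"
proof -
  have "lam_p H p \<Lambda> c \<nu> m k / \<nu> k * (1 - exp (- \<nu> k * t)) =
      (\<Sum>h=1..H. if c h m = \<nu> k then fluid h m t else 0)"
    unfolding lam_p_def sum_divide_distrib sum_distrib_right
    by (intro sum.cong) (auto simp: fluid_def mult.commute)
  also have "\<dots> = (\<Sum>h\<in>{h \<in> {1..H}. c h m = \<nu> k}. fluid h m t)"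
    by (rule sum.inter_filter[symmetric]) simp
  finally show ?thesis .
qed

lemma fluid_solution_exists:
  "fluid_solution T M K (lam_p H p \<Lambda> c \<nu>) \<nu> (\<lambda>m k t. lam_p H p \<Lambda> c \<nu> m k / \<nu> k * (1 - exp (- \<nu> k * t)))"
  by (rule fluid_solution_explicit) (rule rate_zero)

lemma path_bounded:
  assumes "\<And>m k t. m \<in> {1..M} \<Longrightarrow> k \<in> {1..K} \<Longrightarrow> t \<in> {0..T} \<Longrightarrow> \<bar>x m k t\<bar> \<le> b m k"
  shows "x \<in> bounded_paths T M K"
  unfolding bounded_paths_def
  by (auto intro!: bdd_aboveI2[where M = "\<Sum>m=1..M. \<Sum>k=1..K. b m k"] sum_mono assms)

lemma X_bounded: "X N \<omega> \<in> bounded_paths T M K"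
proof (rule path_bounded)
  fix m k t
  have "card {j \<in> serv_class \<phi>2 v N m. \<exists>a\<in>tasks (W N) (lam N). J N a \<omega> = j \<and> \<mu> N (fst a) j = \<nu> k \<and> s N a \<omega> \<le> t \<and>
      t < completion_time (\<mu> N) (\<lambda>a. E N a \<omega>) (\<lambda>a. J N a \<omega>) (\<lambda>a. s N a \<omega>) a} \<le> card {1..N}"
    by (intro card_mono) (auto simp: serv_class_def)
  then show "\<bar>X N \<omega> m k t\<bar> \<le> 1"
    unfolding X_def occupancy_def by (simp add: divide_le_eq)
qed

lemma fluid_solution_eq:
  assumes "fluid_solution T M K (lam_p H p \<Lambda> c \<nu>) \<nu> x" "m \<in> {1..M}" "k \<in> {1..K}" "t \<in> {0..T}"
  shows "x m k t = (\<Sum>h\<in>{h \<in> {1..H}. c h m = \<nu> k}. fluid h m t)"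
  using fluid_solution_unique[OF assms(1) fluid_solution_exists assms(2-4)] explicit_eq_fluid_sum by simp

lemma fluid_nonneg:
  assumes "h \<in> {1..H}" "m \<in> {1..M}" "0 \<le> t"
  shows "0 \<le> fluid h m t"
  using assms \<Lambda>_pos p_nonneg c_nonneg by (simp add: fluid_def less_imp_le)

lemma fluid_solution_bounded:
  assumes "fluid_solution T M K (lam_p H p \<Lambda> c \<nu>) \<nu> x"
  shows "x \<in> bounded_paths T M K"
proof (rule path_bounded)
  fix m k t assume mkt: "m \<in> {1..M}" "k \<in> {1..K}" "t \<in> {0..T}"
  have "0 \<le> x m k t"
    unfolding fluid_solution_eq[OF assms mkt] using mkt by (intro sum_nonneg fluid_nonneg) auto
  moreover have "x m k t \<le> (\<Sum>h\<in>{h \<in> {1..H}. c h m = \<nu> k}. \<Lambda> h * p h m / c h m)"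
    unfolding fluid_solution_eq[OF assms mkt] using mkt by (intro sum_mono fluid_le) auto
  ultimately show "\<bar>x m k t\<bar> \<le> (\<Sum>h\<in>{h \<in> {1..H}. c h m = \<nu> k}. \<Lambda> h * p h m / c h m)" by simp
qed

lemma weak_convergence:
  assumes x: "fluid_solution T M K (lam_p H p \<Lambda> c \<nu>) \<nu> x"
  shows "weakly_converges_unif T M K P X x"
proof (rule weakly_converges_unifI[OF T_nonneg prob_space_P X_bounded fluid_solution_bounded[OF x]])
  fix \<epsilon> \<eta> :: real assume "0 < \<epsilon>" "0 < \<eta>"
  define load where "load m = (\<Sum>h=1..H. \<Lambda> h * p h m / c h m)" for m
  \<comment> \<open>A spare capacity common to all classes; \<open>insert 1\<close> keeps the set
    under \<open>Min\<close> nonempty without a case distinction on \<open>M\<close>.\<close>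
  define g where "g = Min (insert 1 ((\<lambda>m. v m - v (m - 1) - load m) ` {1..M}))"
  have "0 < g"
    unfolding g_def using load_lt(1) by (subst Min_gr_iff) (auto simp: load_def)
  have g: "g \<le> v m - v (m - 1) - load m" if "m \<in> {1..M}" for m
    unfolding g_def using that by (intro Min_le) auto
  \<comment> \<open>The first bound keeps the error of a class total within \<open>g / 4\<close>;
    the second makes the error summed over all \<open>m\<close>, \<open>k\<close> and
    \<open>h\<close> less than \<open>\<epsilon>\<close>. Adding 1 avoids zero denominators.\<close>
  define \<epsilon>0 where "\<epsilon>0 = min (g / (4 * (real H + 1))) (\<epsilon> / (2 * (real M * (real K * real H) + 1)))"
  have D: "0 < 2 * (real M * (real K * real H) + 1)" by (simp add: add_nonneg_pos)
  have "0 < \<epsilon>0"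
    unfolding \<epsilon>0_def using divide_pos_pos[OF \<open>0 < \<epsilon>\<close> D] \<open>0 < g\<close> by simp
  have "\<epsilon>0 * (real H + 1) \<le> g / 4"
  proof -
    have "\<epsilon>0 \<le> g / (4 * (real H + 1))" by (simp add: \<epsilon>0_def)
    then show ?thesis by (simp add: field_simps)
  qed
  then have g4: "real H * \<epsilon>0 \<le> g / 4" using \<open>0 < \<epsilon>0\<close> by (simp add: algebra_simps)
  have MKH: "real M * (real K * (real H * \<epsilon>0)) < \<epsilon>"
  proof -
    have "\<epsilon>0 \<le> \<epsilon> / (2 * (real M * (real K * real H) + 1))" by (simp add: \<epsilon>0_def)
    then have "\<epsilon>0 * (2 * (real M * (real K * real H) + 1)) \<le> \<epsilon>" using pos_le_divide_eq[OF D] by blast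
    moreover have "\<epsilon>0 * (2 * (real M * (real K * real H) + 1)) = 2 * (real M * (real K * (real H * \<epsilon>0))) + 2 * \<epsilon>0"
      by (simp add: algebra_simps)
    moreover have "0 \<le> real M * (real K * (real H * \<epsilon>0))" using \<open>0 < \<epsilon>0\<close> by simp
    ultimately show ?thesis using \<open>0 < \<epsilon>0\<close> by linarith
  qed
  \<comment> \<open>Class sizes may fall short of their limits by \<open>g / 2\<close>. With an
    error of \<open>g / 4\<close> above the load this still leaves \<open>g / 4\<close> of
    room.\<close>
  have "eventually (\<lambda>N. \<forall>m\<in>{1..M}. v m - v (m - 1) - g / 2 < real (card (serv_class \<phi>2 v N m)) / real N) sequentially"
  proof (rule eventually_ball_finite)
    show "\<forall>m\<in>{1..M}. eventually (\<lambda>N. v m - v (m - 1) - g / 2 < real (card (serv_class \<phi>2 v N m)) / real N) sequentially"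
      using subcrit \<open>0 < g\<close> by (auto simp: subcritical_def intro!: order_tendstoD(1))
  qed simp
  with eventually_in_service_close[OF \<open>0 < \<epsilon>0\<close> \<open>0 < \<eta>\<close>] eventually_ge_at_top[of 1]
  show "eventually (\<lambda>N. \<exists>G\<in>sets (P N). 1 - \<eta> \<le> measure (P N) G \<and> (\<forall>\<omega>\<in>G. unif_dist T M K x (X N \<omega>) < \<epsilon>)) sequentially"
  proof eventually_elim
    case (elim N)
    have N: "0 < real N" using elim(2) by simp
    have "unif_dist T M K x (X N \<omega>) < \<epsilon>"
      if reg: "regular N \<omega>" and close: "\<And>h m t. h \<in> {1..H} \<Longrightarrow> m \<in> {1..M} \<Longrightarrow> t \<in> {0..T} \<Longrightarrow>
        \<bar>real (card (in_service N h m t \<omega>)) / real N - fluid h m t\<bar> \<le> \<epsilon>0" for \<omega>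
    proof -
      \<comment> \<open>The fluid never exceeds its stationary load, so one estimate serves all
        times.\<close>
      have room: "(\<Sum>h=1..H. card (in_service N h m t \<omega>)) < card (serv_class \<phi>2 v N m)"
        if m: "m \<in> {1..M}" and t: "t \<in> {0..T}" for m t
      proof -
        have "(\<Sum>h=1..H. real (card (in_service N h m t \<omega>)) / real N) \<le> (\<Sum>h=1..H. \<Lambda> h * p h m / c h m + \<epsilon>0)"
        proof (rule sum_mono)
          fix h assume h: "h \<in> {1..H}"
          show "real (card (in_service N h m t \<omega>)) / real N \<le> \<Lambda> h * p h m / c h m + \<epsilon>0"
            using close[OF h m t] fluid_le[OF h m, of t] by linarith
        qed
        also have "\<dots> = load m + real H * \<epsilon>0" by (simp add: sum.distrib load_def)
        also have "\<dots> < real (card (serv_class \<phi>2 v N m)) / real N"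
          using g4 g[OF m] elim(3) m \<open>0 < g\<close> by fastforce
        finally have "(\<Sum>h=1..H. real (card (in_service N h m t \<omega>))) / real N < real (card (serv_class \<phi>2 v N m)) / real N"
          by (simp add: sum_divide_distrib)
        then have "real (\<Sum>h=1..H. card (in_service N h m t \<omega>)) < real (card (serv_class \<phi>2 v N m))"
          using N by (simp add: divide_less_cancel)
        then show ?thesis by (simp only: of_nat_less_iff)
      qed
      have "unif_dist T M K x (X N \<omega>) \<le> real M * (real K * (real H * \<epsilon>0))"
        unfolding unif_dist_def
      proof (rule cSUP_least)
        show "{0..T} \<noteq> {}" using T_nonneg by simp
        fix t assume t: "t \<in> {0..T}"
        have "(\<Sum>m=1..M. \<Sum>k=1..K. \<bar>x m k t - X N \<omega> m k t\<bar>) \<le> (\<Sum>m=1..M. \<Sum>k=1..K. real H * \<epsilon>0)"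
        proof (intro sum_mono)
          fix m k assume mk: "m \<in> {1..M}" "k \<in> {1..K}"
          let ?S = "{h \<in> {1..H}. c h m = \<nu> k}"
          have "\<bar>x m k t - X N \<omega> m k t\<bar> = \<bar>\<Sum>h\<in>?S. fluid h m t - real (card (in_service N h m t \<omega>)) / real N\<bar>"
            using fluid_solution_eq[OF x mk t] occupancy_eq_in_service[OF elim(2) reg room mk(1) t, of k]
            by (simp only: sum_subtractf)
          also have "\<dots> \<le> (\<Sum>h\<in>?S. \<bar>fluid h m t - real (card (in_service N h m t \<omega>)) / real N\<bar>)" by (rule sum_abs)
          also have "\<dots> \<le> (\<Sum>h\<in>?S. \<epsilon>0)"
          proof (rule sum_mono)
            fix h assume "h \<in> ?S"
            then show "\<bar>fluid h m t - real (card (in_service N h m t \<omega>)) / real N\<bar> \<le> \<epsilon>0"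
              using close[OF _ mk(1) t, of h] by (simp add: abs_minus_commute)
          qed
          also have "\<dots> \<le> (\<Sum>h=1..H. \<epsilon>0)" using \<open>0 < \<epsilon>0\<close> by (intro sum_mono2) auto
          finally show "\<bar>x m k t - X N \<omega> m k t\<bar> \<le> real H * \<epsilon>0" by simp
        qed
        then show "(\<Sum>m=1..M. \<Sum>k=1..K. \<bar>x m k t - X N \<omega> m k t\<bar>) \<le> real M * (real K * (real H * \<epsilon>0))" by simp
      qed
      then show ?thesis using MKH by simp
    qed
    then show ?case using elim(1) by blast
  qed
qed

end

text \<open>The existence conjunct keeps the universally quantified convergence from being vacuous;
  any two solutions agree on \<open>[0, T]\<close> for the indices that \<open>unif_dist\<close>
  reads.\<close>

theorem theorem3p7:
  fixes f :: "real \<Rightarrow> real \<Rightarrow> real" and \<phi>1 \<phi>2 :: "nat \<Rightarrow> real" and W :: "nat \<Rightarrow> nat"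
    and \<mu> :: "nat \<Rightarrow> nat \<Rightarrow> nat \<Rightarrow> real" and lam :: "nat \<Rightarrow> nat \<Rightarrow> real"
    and H M K :: nat and w v :: "nat \<Rightarrow> real" and c p :: "nat \<Rightarrow> nat \<Rightarrow> real" and \<Lambda> \<nu> :: "nat \<Rightarrow> real"
    and P :: "nat \<Rightarrow> 'a measure"
    and A U E s :: "nat \<Rightarrow> task \<Rightarrow> 'a \<Rightarrow> real" and B J :: "nat \<Rightarrow> task \<Rightarrow> 'a \<Rightarrow> nat"
    and X :: "nat \<Rightarrow> 'a \<Rightarrow> path" and T :: real
  assumes f_seq: "f_sequence f \<phi>1 \<phi>2 W \<mu>"
    and step: "stepwise f H w M v c"
    and lam_nonneg: "\<And>N i. i \<in> {1..W N} \<Longrightarrow> 0 \<le> lam N i"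
    and subcrit: "subcritical \<phi>1 \<phi>2 W H w M v c lam \<Lambda> p"
    and jiq: "\<And>N. 1 \<le> N \<Longrightarrow>
        jiq_system (P N) (tasks (W N) (lam N)) (serv_class \<phi>2 v N) (\<mu> N) (lam N)
          M (\<lambda>i. p (class_of H w (\<phi>1 i))) (A N) (B N) (U N) (E N) (J N) (s N)"
    and distinct_rates: "bij_betw \<nu> {1..K} {c h m | h m. h \<in> {1..H} \<and> m \<in> {1..M}}"
    and X_def: "\<And>N \<omega> m k t. X N \<omega> m k t =
        occupancy N (tasks (W N) (lam N)) (\<mu> N) (\<lambda>a. E N a \<omega>) (\<lambda>a. J N a \<omega>) (\<lambda>a. s N a \<omega>)
          (serv_class \<phi>2 v N m) (\<nu> k) t"
    and T_nonneg: "0 \<le> T"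
  shows "(\<exists>x. fluid_solution T M K (lam_p H p \<Lambda> c \<nu>) \<nu> x) \<and>
    (\<forall>x. fluid_solution T M K (lam_p H p \<Lambda> c \<nu>) \<nu> x \<longrightarrow> weakly_converges_unif T M K P X x)"
proof -
  interpret jiq_sequence f \<phi>1 \<phi>2 W \<mu> lam H M K w v c p \<Lambda> \<nu> P A U E s B J X T
    by (rule jiq_sequence.intro) (fact assms)+
  show ?thesis using fluid_solution_exists weak_convergence by blast
qed

end
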